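(* (a) If for some constant $\epsilon>0$ there is an algorithm that, given an OR-circuit $\mathcal{C}$, outputs a SUM-circuit computing the same matrix in time $|\mathcal{C}|^{2-\epsilon}\mathrm{polylog}(|\mathcal{C}|)$, then the number of satisfying assignments of a CNF formula with $n$ variables and $m$ clauses can be computed in time $2^{(1-\epsilon/2)n}\mathrm{poly}(n,m)$. (b) If for some constant $\epsilon>0$ there is an algorithm that, given an OR-circuit $\mathcal{C}$, outputs an XOR-circuit computing the same matrix in time $|\mathcal{C}|^{2-\epsilon}\mathrm{polylog}(|\mathcal{C}|)$, then the parity of the number of satisfying assignments of a CNF formula with $n$ variables and $m$ clauses can be computed in time $2^{(1-\epsilon/2)n}\mathrm{poly}(n,m)$.
   Context: A circuit is a directed acyclic graph whose in-degree-zero vertices are input gates and other vertices gates of unbounded fan-in, with designated outputs; its size $|\mathcal{C}|$ is its number of wires. One assumes $|\mathcal{C}|$ is at least the number of inputs and that circuits are encoded with binary length $|\mathcal{C}|$ times a polylogarithmic factor, so that evaluation takes time $|\mathcal{C}|$ times a polylogarithmic factor in the RAM model. For a boolean matrix $A=(a_{ij})$: an OR-circuit computes $A$ if, with gates computing boolean OR, output $i$ computes $\bigvee_j a_{ij}x_j$; a SUM-circuit computes $A$ if, with gates computing integer sums, output $i$ computes the formal linear form $\sum_j a_{ij}x_j$ over the non-negative integers; an XOR-circuit computes $A$ if, with gates computing sums mod 2, output $i$ computes $\sum_j a_{ij}x_j$ over $\mathrm{GF}(2)$. *)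

theory Defs
  imports
    Complex_Main
    "HOL-Library.FuncSet"
    "HOL-Library.Landau_Symbols"
    "HOL-Library.Log_Nat"
    "HOL-Library.Poly_Mapping"
    "HOL-Library.Z2"
    "Jordan_Normal_Form.Matrix"
begin

section \<open>Random access machines\<close>

text \<open>
  The random access machine of Cook and Reckhow with the logarithmic cost criterion. Registers
  hold natural numbers; subtraction truncates at zero. Numbers are read from an input tape and
  printed to an output tape, and every operation is charged the bit lengths of the numbers and of
  the indirect addresses it handles. Up to polylogarithmic factors this agrees with the
  unit-cost machine with words of logarithmic length.
\<close>

datatype instr =
    Const nat nat     \<comment> \<open>\<open>X i \<leftarrow> c\<close>\<close>
  | Add nat nat nat   \<comment> \<open>\<open>X i \<leftarrow> X j + X k\<close>\<close>
  | Sub nat nat nat   \<comment> \<open>\<open>X i \<leftarrow> X j - X k\<close>\<close>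
  | Load nat nat      \<comment> \<open>\<open>X i \<leftarrow> X (X j)\<close>\<close>
  | Store nat nat     \<comment> \<open>\<open>X (X i) \<leftarrow> X j\<close>\<close>
  | JumpPos nat nat   \<comment> \<open>go to instruction \<open>l\<close> if \<open>X j > 0\<close>\<close>
  | Read nat
  | Print nat

type_synonym ram = "instr list"

record config =
  pc :: nat
  reg :: "nat \<Rightarrow> nat"
  input_tape :: "nat list"
  output_tape :: "nat list"

text \<open>Reading beyond the end of the input yields zero.\<close>

definition next_input :: "config \<Rightarrow> nat" where
  "next_input s = (case input_tape s of [] \<Rightarrow> 0 | a # _ \<Rightarrow> a)"

fun exec :: "instr \<Rightarrow> config \<Rightarrow> config" where
  "exec (Const i c) s = s\<lparr>pc := pc s + 1, reg := (reg s)(i := c)\<rparr>"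
| "exec (Add i j k) s = s\<lparr>pc := pc s + 1, reg := (reg s)(i := reg s j + reg s k)\<rparr>"
| "exec (Sub i j k) s = s\<lparr>pc := pc s + 1, reg := (reg s)(i := reg s j - reg s k)\<rparr>"
| "exec (Load i j) s = s\<lparr>pc := pc s + 1, reg := (reg s)(i := reg s (reg s j))\<rparr>"
| "exec (Store i j) s = s\<lparr>pc := pc s + 1, reg := (reg s)(reg s i := reg s j)\<rparr>"
| "exec (JumpPos j l) s = s\<lparr>pc := (if reg s j > 0 then l else pc s + 1)\<rparr>"
| "exec (Read i) s = s\<lparr>pc := pc s + 1, reg := (reg s)(i := next_input s),
     input_tape := tl (input_tape s)\<rparr>"
| "exec (Print i) s = s\<lparr>pc := pc s + 1, output_tape := output_tape s @ [reg s i]\<rparr>"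

text \<open>For positive \<open>a\<close>, \<^term>\<open>floorlog 2 a\<close> is the number of binary digits of \<open>a\<close>.\<close>

fun cost :: "instr \<Rightarrow> config \<Rightarrow> nat" where
  "cost (Const i c) s = 1"
| "cost (Add i j k) s = 1 + floorlog 2 (reg s j) + floorlog 2 (reg s k)"
| "cost (Sub i j k) s = 1 + floorlog 2 (reg s j) + floorlog 2 (reg s k)"
| "cost (Load i j) s = 1 + floorlog 2 (reg s j) + floorlog 2 (reg s (reg s j))"
| "cost (Store i j) s = 1 + floorlog 2 (reg s i) + floorlog 2 (reg s j)"
| "cost (JumpPos j l) s = 1 + floorlog 2 (reg s j)"
| "cost (Read i) s = 1 + floorlog 2 (next_input s)"
| "cost (Print i) s = 1 + floorlog 2 (reg s i)"

text \<open>
  \<open>halts_from P s t out\<close>: started in configuration \<open>s\<close>, the program leaves its instruction range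
  after total cost \<open>t\<close>, with \<open>out\<close> on the output tape.
\<close>

inductive halts_from :: "ram \<Rightarrow> config \<Rightarrow> nat \<Rightarrow> nat list \<Rightarrow> bool" for P where
  halt: "length P \<le> pc s \<Longrightarrow> halts_from P s 0 (output_tape s)"
| step: "pc s < length P \<Longrightarrow> halts_from P (exec (P ! pc s) s) t out \<Longrightarrow>
    halts_from P s (cost (P ! pc s) s + t) out"

definition ram_outputs :: "ram \<Rightarrow> nat list \<Rightarrow> nat \<Rightarrow> nat list \<Rightarrow> bool" where
  "ram_outputs P w t out \<longleftrightarrow>
     halts_from P \<lparr>pc = 0, reg = (\<lambda>_. 0), input_tape = w, output_tape = []\<rparr> t out"


section \<open>Circuits\<close>

text \<open>
  The input gates are the vertices \<open>0, \<dots>, num_inputs C - 1\<close>, the other gates are the next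
  \<open>num_gates C\<close> natural numbers; a pair \<open>(u, v)\<close> is a wire from \<open>u\<close> to \<open>v\<close>. The \<open>i\<close>-th output is
  the vertex \<open>outputs C ! i\<close>.
\<close>

record circuit =
  num_inputs :: nat
  num_gates :: nat
  wires :: "(nat \<times> nat) set"
  outputs :: "nat list"

definition vertices :: "circuit \<Rightarrow> nat set" where
  "vertices C = {..<num_inputs C + num_gates C}"

definition preds :: "circuit \<Rightarrow> nat \<Rightarrow> nat set" where
  "preds C v = {u. (u, v) \<in> wires C}"

definition csize :: "circuit \<Rightarrow> nat" where
  "csize C = card (wires C)"

text \<open>
  Different output positions designate different vertices, so that the number of outputs, like
  that of all vertices, is linear in the size.
\<close>

definition wf_circuit :: "circuit \<Rightarrow> bool" where
  "wf_circuit C \<longleftrightarrow>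
     wires C \<subseteq> vertices C \<times> vertices C \<and>
     acyclic (wires C) \<and>
     (\<forall>v\<in>vertices C. preds C v = {} \<longleftrightarrow> v < num_inputs C) \<and>
     set (outputs C) \<subseteq> vertices C \<and> distinct (outputs C) \<and>
     num_inputs C \<le> csize C"

text \<open>
  Evaluation along the wires: vertex \<open>j\<close> has value \<open>x j\<close> if it is an input gate, and otherwise
  \<open>G\<close> combines the values of its in-neighbours.
\<close>

definition circuit_value ::
  "((nat \<Rightarrow> 'a) \<Rightarrow> nat set \<Rightarrow> 'a) \<Rightarrow> circuit \<Rightarrow> (nat \<Rightarrow> 'a) \<Rightarrow> nat \<Rightarrow> 'a" where
  "circuit_value G C x = wfrec (wires C)
     (\<lambda>val v. if v < num_inputs C then x v else G val (preds C v))"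

lemma wf_wires:
  assumes "wf_circuit C"
  shows "wf (wires C)"
proof -
  have "finite (wires C)"
    by (rule finite_subset[of _ "vertices C \<times> vertices C"])
      (use assms in \<open>auto simp: wf_circuit_def vertices_def\<close>)
  then show ?thesis
    using assms by (auto simp: wf_circuit_def intro: finite_acyclic_wf)
qed

lemma circuit_value_unfold:
  assumes "wf_circuit C"
    and G: "\<And>f g U. (\<And>u. u \<in> U \<Longrightarrow> f u = g u) \<Longrightarrow> G f U = G g U"
  shows "circuit_value G C x v =
    (if v < num_inputs C then x v else G (circuit_value G C x) (preds C v))"
  unfolding circuit_value_def
  by (subst wfrec[OF wf_wires[OF assms(1)]]) (auto simp: cut_def preds_def intro!: G)

definition or_computes :: "circuit \<Rightarrow> bool mat \<Rightarrow> bool" where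
  "or_computes C A \<longleftrightarrow>
     A \<in> carrier_mat (length (outputs C)) (num_inputs C) \<and>
     (\<forall>x. \<forall>i < dim_row A.
        circuit_value (\<lambda>f U. \<exists>u\<in>U. f u) C x (outputs C ! i) \<longleftrightarrow>
        (\<exists>j < dim_col A. A $$ (i, j) \<and> x j))"

text \<open>
  The polynomial mapping \<^term>\<open>Poly_Mapping.single j a :: nat \<Rightarrow>\<^sub>0 nat\<close> is the formal linear form
  \<open>a x\<^sub>j\<close>.
\<close>

definition sum_computes :: "circuit \<Rightarrow> bool mat \<Rightarrow> bool" where
  "sum_computes C A \<longleftrightarrow>
     A \<in> carrier_mat (length (outputs C)) (num_inputs C) \<and>
     (\<forall>i < dim_row A.
        circuit_value sum C (\<lambda>j. Poly_Mapping.single j 1 :: nat \<Rightarrow>\<^sub>0 nat) (outputs C ! i) =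
        (\<Sum>j < dim_col A. Poly_Mapping.single j (of_bool (A $$ (i, j)))))"

text \<open>The type \<^typ>\<open>bit\<close> is the field with two elements.\<close>

definition xor_computes :: "circuit \<Rightarrow> bool mat \<Rightarrow> bool" where
  "xor_computes C A \<longleftrightarrow>
     A \<in> carrier_mat (length (outputs C)) (num_inputs C) \<and>
     (\<forall>x :: nat \<Rightarrow> bit. \<forall>i < dim_row A.
        circuit_value sum C x (outputs C ! i) = (\<Sum>j < dim_col A. of_bool (A $$ (i, j)) * x j))"

text \<open>
  A code of a circuit lists its gates in some topological order, each with its name, its
  in-degree and its in-neighbours, followed by the outputs.
\<close>

definition encodes :: "nat list \<Rightarrow> circuit \<Rightarrow> bool" where
  "encodes w C \<longleftrightarrow>
     (\<exists>vs ps.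
        distinct vs \<and> set vs = vertices C - {..<num_inputs C} \<and>
        (\<forall>i < length vs. preds C (vs ! i) \<subseteq> {..<num_inputs C} \<union> set (take i vs)) \<and>
        (\<forall>v \<in> set vs. distinct (ps v) \<and> set (ps v) = preds C v) \<and>
        w = [num_inputs C, num_gates C] @
            concat (map (\<lambda>v. v # length (ps v) # ps v) vs) @
            length (outputs C) # outputs C)"

text \<open>Hence a code has binary length \<open>csize C\<close> times a logarithmic factor.\<close>

lemma encodes_length:
  assumes C: "wf_circuit C" and w: "encodes w C"
  shows "length w \<le> 5 * csize C + 3" and "\<forall>a\<in>set w. a \<le> 2 * csize C"
proof -
  let ?n = "num_inputs C" and ?g = "num_gates C"
  have sub: "wires C \<subseteq> vertices C \<times> vertices C" and n: "?n \<le> csize C"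
    using C by (auto simp: wf_circuit_def)
  have fin: "finite (wires C)"
    by (rule finite_subset[OF sub]) (simp add: vertices_def)
  obtain vs ps where vs: "distinct vs" "set vs = vertices C - {..<?n}"
    and ps: "\<forall>v \<in> set vs. distinct (ps v) \<and> set (ps v) = preds C v"
    and weq: "w = [?n, ?g] @ concat (map (\<lambda>v. v # length (ps v) # ps v) vs) @
      length (outputs C) # outputs C"
    using w unfolding encodes_def by blast
  have vset: "set vs = {?n..<?n + ?g}"
    using vs(2) by (auto simp: vertices_def)
  have lvs: "length vs = ?g"
    using distinct_card[OF vs(1)] vset by simp
  have finp: "finite (preds C v)" for v
  proof (rule finite_subset)
    show "preds C v \<subseteq> fst ` wires C"
      by (force simp: preds_def)
    show "finite (fst ` wires C)"
      using fin by simp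
  qed
  have len: "length (ps v) = card (preds C v)" if "v \<in> set vs" for v
    using ps that distinct_card by fastforce
  have pos: "1 \<le> card (preds C v)" if "v \<in> set vs" for v
  proof -
    have "preds C v \<noteq> {}"
      using C that vs(2) unfolding wf_circuit_def by blast
    then show ?thesis
      using finp[of v] by (simp add: Suc_le_eq card_gt_0_iff)
  qed
  have tgt: "v \<in> set vs" if "(u, v) \<in> wires C" for u v
  proof -
    have "v \<in> vertices C" and "preds C v \<noteq> {}"
      using sub that by (auto simp: preds_def)
    then show ?thesis
      using C vs(2) by (auto simp: wf_circuit_def)
  qed
  then have "wires C = (\<Union>v\<in>set vs. (\<lambda>u. (u, v)) ` preds C v)"
    by (auto simp: preds_def)
  then have "csize C = (\<Sum>v\<in>set vs. card ((\<lambda>u. (u, v)) ` preds C v))"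
    unfolding csize_def by (simp, subst card_UN_disjoint) (auto simp: finp)
  also have "\<dots> = (\<Sum>v\<in>set vs. card (preds C v))"
    by (intro sum.cong) (auto intro!: card_image inj_onI)
  finally have csz: "csize C = (\<Sum>v\<in>set vs. card (preds C v))" .
  have g: "?g \<le> csize C"
    using sum_mono[of "set vs" "\<lambda>_. 1" "\<lambda>v. card (preds C v)"] pos csz vset by simp
  have outs: "set (outputs C) \<subseteq> {..<?n + ?g}" "distinct (outputs C)"
    using C by (auto simp: wf_circuit_def vertices_def)
  have lo: "length (outputs C) \<le> ?n + ?g"
    using card_mono[OF _ outs(1)] distinct_card[OF outs(2)] by simp
  have "length (concat (map (\<lambda>v. v # length (ps v) # ps v) vs)) =
      (\<Sum>v\<leftarrow>vs. 2 + length (ps v))"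
    by (simp add: length_concat comp_def)
  also have "\<dots> = (\<Sum>v\<in>set vs. 2 + card (preds C v))"
    using vs(1) len by (simp add: sum_list_distinct_conv_sum_set)
  also have "\<dots> = 2 * ?g + csize C"
    unfolding csz sum.distrib using lvs distinct_card[OF vs(1)] by simp
  finally show "length w \<le> 5 * csize C + 3"
    unfolding weq using n g lo by simp
  have le: "card (preds C v) \<le> csize C" if "v \<in> set vs" for v
    unfolding csz using that by (intro member_le_sum) auto
  have pr: "u < ?n + ?g" if "u \<in> preds C v" for u v
    using that sub by (auto simp: preds_def vertices_def)
  show "\<forall>a\<in>set w. a \<le> 2 * csize C"
  proof
    fix a assume "a \<in> set w"
    then consider "a = ?n" | "a = ?g" | "a = length (outputs C)" | "a \<in> set (outputs C)"
      | v where "v \<in> set vs" "a = v \<or> a = length (ps v) \<or> a \<in> set (ps v)"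
      unfolding weq by auto
    then show "a \<le> 2 * csize C"
    proof cases
      case 4
      then have "a < ?n + ?g"
        using outs(1) by blast
      then show ?thesis
        using n g by simp
    next
      case (5 v)
      have "v < ?n + ?g"
        using 5(1) vset by simp
      moreover have "length (ps v) \<le> csize C"
        using len[OF 5(1)] le[OF 5(1)] by simp
      moreover have "set (ps v) = preds C v"
        using ps 5(1) by blast
      ultimately show ?thesis
        using 5(2) pr[of a v] n g by auto
    qed (use n g lo in simp_all)
  qed
qed

definition converts_or ::
  "(circuit \<Rightarrow> bool mat \<Rightarrow> bool) \<Rightarrow> ram \<Rightarrow> (nat \<Rightarrow> real) \<Rightarrow> bool" where
  "converts_or computes P T \<longleftrightarrow>
     (\<forall>C A w. wf_circuit C \<and> or_computes C A \<and> encodes w C \<longrightarrow>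
        (\<exists>t w' D. ram_outputs P w t w' \<and> real t \<le> T (csize C) \<and>
           wf_circuit D \<and> computes D A \<and> encodes w' D))"


section \<open>CNF formulas\<close>

datatype literal = Pos nat | Neg nat

primrec var :: "literal \<Rightarrow> nat" where
  "var (Pos i) = i"
| "var (Neg i) = i"

primrec holds :: "(nat \<Rightarrow> bool) \<Rightarrow> literal \<Rightarrow> bool" where
  "holds \<alpha> (Pos i) = \<alpha> i"
| "holds \<alpha> (Neg i) = (\<not> \<alpha> i)"

type_synonym cnf = "literal list list"

text \<open>
  A clause is a set of literals, listed without repetition; this makes the length of a formula
  polynomial in the numbers of variables and clauses.
\<close>

definition cnf_over :: "nat \<Rightarrow> cnf \<Rightarrow> bool" where
  "cnf_over n F \<longleftrightarrow> (\<forall>c\<in>set F. distinct c \<and> (\<forall>l\<in>set c. var l < n))"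

definition num_sat :: "nat \<Rightarrow> cnf \<Rightarrow> nat" where
  "num_sat n F =
     card {\<alpha> \<in> {..<n} \<rightarrow>\<^sub>E (UNIV :: bool set). \<forall>c\<in>set F. \<exists>l\<in>set c. holds \<alpha> l}"

primrec encode_literal :: "literal \<Rightarrow> nat" where
  "encode_literal (Pos i) = 2 * i"
| "encode_literal (Neg i) = 2 * i + 1"

definition encode_cnf :: "nat \<Rightarrow> cnf \<Rightarrow> nat list" where
  "encode_cnf n F =
     [n, length F] @ concat (map (\<lambda>c. length c # map encode_literal c) F)"

definition cnf_computable_in :: "(nat \<Rightarrow> cnf \<Rightarrow> nat) \<Rightarrow> (nat \<Rightarrow> nat \<Rightarrow> real) \<Rightarrow> bool" where
  "cnf_computable_in f T \<longleftrightarrow>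
     (\<exists>Q. \<forall>n F. cnf_over n F \<longrightarrow>
        (\<exists>t. ram_outputs Q (encode_cnf n F) t [f n F] \<and> real t \<le> T n (length F)))"

end

theory Submission
  imports Defs "HOL-Real_Asymp.Real_Asymp"
begin

text \<open>
  Split the variables into two halves with \<open>N1\<close> and \<open>N2\<close> partial assignments. The OR-circuit with
  an input per assignment \<open>\<alpha>\<close> of the first half, a gate per clause and an output per assignment
  \<open>\<beta>\<close> of the second half, where \<open>\<alpha>\<close> feeds the clauses it does not satisfy and these feed the
  \<open>\<beta>\<close> that do not satisfy them, computes the matrix of the pairs whose union falsifies the formula.
  Its size is \<open>2 ^ (n / 2)\<close> up to polynomial factors, and evaluating the converted circuit at the
  all-ones vector counts the ones of each row, exactly for a SUM-circuit and modulo 2 for an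
  XOR-circuit. The number of satisfying assignments is \<open>2 ^ n\<close> minus the number of ones. For
  \<open>\<epsilon> > 1\<close> there is no converter, since it could not even write down the outputs.
\<close>

section \<open>A structured language on random access machines\<close>

text \<open>The hypothesis offers an arbitrary machine program \<open>P\<close>, and the conclusion
  asks for a concrete one, so the reduction has to be written and timed on the machine itself.
  \<open>P\<close> may use any register and expects zeroed memory and its own tapes; it is therefore
  run with all its addresses multiplied by 8 and its tapes kept in arrays, while the surrounding
  code uses other residue classes. Each assignment gets two inputs \<open>2 * \<alpha>\<close> and
  \<open>2 * \<alpha> + 1\<close>, and each clause two gates, so that falsifying a clause only
  changes the parity of an in-neighbour: in-degrees do not depend on the formula, and gates can be
  emitted in one pass without counting. The all-ones vector thus becomes the vector with ones at the
  odd inputs. The always true clause \<open>[Pos n]\<close> is appended because an output gate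
  without clauses would have in-degree zero. Writing the circuit takes about
  \<open>2 ^ (n / 2)\<close> steps, which fits the target bound only for \<epsilon> \<le> 1; this is
  why larger \<epsilon> need the separate refutation of the hypothesis.\<close>

inductive reach :: "ram \<Rightarrow> config \<Rightarrow> nat \<Rightarrow> config \<Rightarrow> bool" for R where
  reach_refl: "reach R s 0 s"
| reach_step: "pc s < length R \<Longrightarrow> reach R (exec (R ! pc s) s) t s' \<Longrightarrow>
    reach R s (cost (R ! pc s) s + t) s'"

lemma reach_trans: "reach R s t s' \<Longrightarrow> reach R s' t' s'' \<Longrightarrow> reach R s (t + t') s''"
proof (induction rule: reach.induct)
  case (reach_step s t s')
  then show ?case
    using reach.reach_step[of s R "t + t'" s''] by (simp add: add.assoc)
qed simp

lemma reach_halts: "reach R s t s' \<Longrightarrow> length R \<le> pc s' \<Longrightarrow> halts_from R s t (output_tape s')"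
  by (induction rule: reach.induct) (auto intro: halts_from.intros)

text \<open>\<open>halts_from\<close> describes only complete runs, whereas pieces of a program are
  verified one by one. \<open>reach\<close> is a partial run with its exact cost; relaxing the cost
  to an upper bound lets budgets be rounded up freely.\<close>

definition reaches :: "ram \<Rightarrow> config \<Rightarrow> nat \<Rightarrow> config \<Rightarrow> bool" where
  "reaches R s b s' \<longleftrightarrow> (\<exists>t\<le>b. reach R s t s')"

lemma reaches_refl: "reaches R s b s"
  using reach_refl by (auto simp: reaches_def)

lemma reaches_step:
  "pc s < length R \<Longrightarrow> cost (R ! pc s) s \<le> b \<Longrightarrow> reaches R (exec (R ! pc s) s) b' s' \<Longrightarrow>
   reaches R s (b + b') s'"
  unfolding reaches_def using reach_step add_mono by blast

lemma reaches_trans: "reaches R s b s' \<Longrightarrow> reaches R s' b' s'' \<Longrightarrow> reaches R s (b + b') s''"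
  unfolding reaches_def using reach_trans add_mono by blast

lemma reaches_mono: "reaches R s b s' \<Longrightarrow> b \<le> b' \<Longrightarrow> reaches R s b' s'"
  unfolding reaches_def using le_trans by blast

text \<open>Jump targets are absolute, so a piece of code is correct only at the position it was
  generated for; this predicate pins that position inside the complete program.\<close>

definition code_at :: "ram \<Rightarrow> nat \<Rightarrow> ram \<Rightarrow> bool" where
  "code_at R p c \<longleftrightarrow> (\<exists>A B. R = A @ c @ B \<and> length A = p)"

lemma code_at_append: "code_at R p (c @ d) \<longleftrightarrow> code_at R p c \<and> code_at R (p + length c) d"
proof
  assume "code_at R p (c @ d)"
  then obtain A B where "R = A @ (c @ d) @ B" "length A = p"
    unfolding code_at_def by blast
  then show "code_at R p c \<and> code_at R (p + length c) d"
    unfolding code_at_def by (metis append.assoc length_append)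
next
  assume "code_at R p c \<and> code_at R (p + length c) d"
  then obtain A B A' B' where "R = A @ c @ B" "length A = p"
    "R = A' @ d @ B'" "length A' = p + length c"
    unfolding code_at_def by blast
  then have "A @ c = A'" and "R = A' @ d @ B'"
    by (metis append.assoc append_eq_append_conv length_append)+
  then show "code_at R p (c @ d)"
    unfolding code_at_def using \<open>length A = p\<close> by (metis append.assoc)
qed

lemma code_at_Cons: "code_at R p (i # c) \<longleftrightarrow> p < length R \<and> R ! p = i \<and> code_at R (Suc p) c"
proof -
  have "code_at R p [i] \<longleftrightarrow> p < length R \<and> R ! p = i"
  proof
    assume "p < length R \<and> R ! p = i"
    then have "R = take p R @ [i] @ drop (Suc p) R" "length (take p R) = p"
      using id_take_nth_drop by auto
    then show "code_at R p [i]"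
      unfolding code_at_def by blast
  qed (auto simp: code_at_def)
  then show ?thesis
    using code_at_append[of R p "[i]" c] by simp
qed

lemma reaches_instr:
  assumes "code_at R (pc s) (i # c)" "cost i s \<le> b" "reaches R (exec i s) b' s'"
  shows "reaches R s (b + b') s'"
  using assms reaches_step[of s R b b' s'] by (simp add: code_at_Cons)

section \<open>A loop language over scalars and arrays: semantics, step counts and value
  bounds\<close>

record st =
  sc :: "nat \<Rightarrow> nat"
  ar :: "nat \<Rightarrow> nat \<Rightarrow> nat"
  itape :: "nat list"
  otape :: "nat list"

datatype com =
    SetC nat nat
  | AddC nat nat nat
  | SubC nat nat nat
  | GetC nat nat nat
  | PutC nat nat nat
  | ReadC nat
  | PrintC nat
  | SeqC com com  (infixr \<open>;;\<close> 60)
  | ForC nat nat com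

definition setx :: "nat \<Rightarrow> nat \<Rightarrow> st \<Rightarrow> st" where
  "setx x v s = s\<lparr>sc := (sc s)(x := v)\<rparr>"

definition seta :: "nat \<Rightarrow> nat \<Rightarrow> nat \<Rightarrow> st \<Rightarrow> st" where
  "seta r i v s = s\<lparr>ar := (ar s)(r := (ar s r)(i := v))\<rparr>"

primrec iter :: "(nat \<Rightarrow> 'a \<Rightarrow> 'a) \<Rightarrow> nat \<Rightarrow> 'a \<Rightarrow> 'a" where
  "iter f 0 s = s"
| "iter f (Suc n) s = f n (iter f n s)"

primrec sem :: "com \<Rightarrow> st \<Rightarrow> st" where
  "sem (SetC x a) = (\<lambda>s. setx x a s)"
| "sem (AddC x y z) = (\<lambda>s. setx x (sc s y + sc s z) s)"
| "sem (SubC x y z) = (\<lambda>s. setx x (sc s y - sc s z) s)"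
| "sem (GetC x r y) = (\<lambda>s. setx x (ar s r (sc s y)) s)"
| "sem (PutC r y x) = (\<lambda>s. seta r (sc s y) (sc s x) s)"
| "sem (ReadC x) = (\<lambda>s. setx x (case itape s of [] \<Rightarrow> 0 | a # _ \<Rightarrow> a) (s\<lparr>itape := tl (itape s)\<rparr>))"
| "sem (PrintC x) = (\<lambda>s. s\<lparr>otape := otape s @ [sc s x]\<rparr>)"
| "sem (a ;; b) = (\<lambda>s. sem b (sem a s))"
| "sem (ForC x y c) = (\<lambda>s. setx x (sc s y) (iter (\<lambda>i s. sem c (setx x i s)) (sc s y) s))"

text \<open>
  \<open>safe M\<close> says that no operation produces a number above \<open>M\<close>, so that the cost of an execution is
  at most the number of its steps times the logarithm of \<open>M\<close>.
\<close>

fun safe :: "nat \<Rightarrow> com \<Rightarrow> st \<Rightarrow> bool" where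
  "safe M (SetC x a) s \<longleftrightarrow> a \<le> M"
| "safe M (AddC x y z) s \<longleftrightarrow> sc s y + sc s z \<le> M"
| "safe M (a ;; b) s \<longleftrightarrow> safe M a s \<and> safe M b (sem a s)"
| "safe M (ForC x y c) s \<longleftrightarrow> (\<forall>i < sc s y.
     safe M c (setx x i (iter (\<lambda>i s. sem c (setx x i s)) i s)))"
| "safe M _ s \<longleftrightarrow> True"

text \<open>Commands are counted here, not machine instructions or bit costs;
  \<open>code_correct\<close> supplies the factor for both.\<close>

fun steps :: "com \<Rightarrow> st \<Rightarrow> nat" where
  "steps (a ;; b) s = steps a s + steps b (sem a s)"
| "steps (ForC x y c) s = 1 + (\<Sum>i < sc s y.
     1 + steps c (setx x i (iter (\<lambda>i s. sem c (setx x i s)) i s)))"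
| "steps _ s = 1"

primrec wsc :: "com \<Rightarrow> nat set" where
  "wsc (SetC x a) = {x}"
| "wsc (AddC x y z) = {x}"
| "wsc (SubC x y z) = {x}"
| "wsc (GetC x r y) = {x}"
| "wsc (PutC r y x) = {}"
| "wsc (ReadC x) = {x}"
| "wsc (PrintC x) = {}"
| "wsc (a ;; b) = wsc a \<union> wsc b"
| "wsc (ForC x y c) = insert x (wsc c)"

fun war :: "com \<Rightarrow> nat set" where
  "war (PutC r y x) = {r}"
| "war (a ;; b) = war a \<union> war b"
| "war (ForC x y c) = war c"
| "war _ = {}"

fun no_print :: "com \<Rightarrow> bool" where
  "no_print (PrintC x) \<longleftrightarrow> False"
| "no_print (a ;; b) \<longleftrightarrow> no_print a \<and> no_print b"
| "no_print (ForC x y c) \<longleftrightarrow> no_print c"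
| "no_print _ \<longleftrightarrow> True"

definition regions :: "nat set" where
  "regions = {1, 2, 4, 5, 6}"

text \<open>A loop must not assign its counter or its bound. The compiled loop increments the
  counter register and rereads the bound at each test, while \<open>sem\<close> fixes the bound at
  entry and sets the counter itself; the restriction makes the two agree.\<close>

fun wfc :: "com \<Rightarrow> bool" where
  "wfc (GetC x r y) \<longleftrightarrow> r \<in> regions"
| "wfc (PutC r y x) \<longleftrightarrow> r \<in> regions"
| "wfc (a ;; b) \<longleftrightarrow> wfc a \<and> wfc b"
| "wfc (ForC x y c) \<longleftrightarrow> x \<noteq> y \<and> x \<notin> wsc c \<and> y \<notin> wsc c \<and> wfc c"
| "wfc _ \<longleftrightarrow> True"

lemma setx_simps [simp]:
  "sc (setx x v s) = (sc s)(x := v)" "ar (setx x v s) = ar s"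
  "itape (setx x v s) = itape s" "otape (setx x v s) = otape s"
  by (simp_all add: setx_def)

lemma seta_simps [simp]:
  "ar (seta r i v s) = (ar s)(r := (ar s r)(i := v))" "sc (seta r i v s) = sc s"
  "itape (seta r i v s) = itape s" "otape (seta r i v s) = otape s"
  by (simp_all add: seta_def)

lemma sem_sc_frame: "x \<notin> wsc c \<Longrightarrow> sc (sem c s) x = sc s x"
proof (induction c arbitrary: s)
  case (ForC y z c)
  have "sc (iter (\<lambda>i s. sem c (setx y i s)) n s) x = sc s x" for n
    by (induction n) (use ForC in auto)
  then show ?case
    using ForC by simp
qed auto

lemma sem_ar_frame: "r \<notin> war c \<Longrightarrow> ar (sem c s) r = ar s r"
proof (induction c arbitrary: s)
  case (ForC y z c)
  have "ar (iter (\<lambda>i s. sem c (setx y i s)) n s) r = ar s r" for n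
    by (induction n) (use ForC in auto)
  then show ?case
    using ForC by simp
qed auto

lemma sem_no_print: "no_print c \<Longrightarrow> otape (sem c s) = otape s"
proof (induction c arbitrary: s)
  case (ForC y z c)
  have "otape (iter (\<lambda>i s. sem c (setx y i s)) n s) = otape s" for n
    by (induction n) (use ForC in auto)
  then show ?case
    using ForC by simp
qed auto

definition bounded :: "nat \<Rightarrow> st \<Rightarrow> bool" where
  "bounded M s \<longleftrightarrow> (\<forall>x. sc s x \<le> M) \<and> (\<forall>r\<in>regions. \<forall>i. ar s r i \<le> M) \<and> (\<forall>a\<in>set (itape s). a \<le> M)"

lemma bounded_setx: "bounded M s \<Longrightarrow> v \<le> M \<Longrightarrow> bounded M (setx x v s)"
  by (auto simp: bounded_def)

text \<open>Only constants and sums can create a number above all present ones: subtraction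
  truncates, the other commands copy, and a loop counter never exceeds a bound that is already
  stored. Hence \<open>safe\<close> checks just \<open>SetC\<close> and \<open>AddC\<close>.\<close>

lemma bounded_sem: "bounded M s \<Longrightarrow> wfc c \<Longrightarrow> safe M c s \<Longrightarrow> bounded M (sem c s)"
proof (induction c arbitrary: s)
  case (ForC x y c)
  let ?f = "\<lambda>i s. sem c (setx x i s)"
  have y: "sc s y \<le> M"
    using ForC.prems by (auto simp: bounded_def)
  have "n \<le> sc s y \<Longrightarrow> bounded M (iter ?f n s)" for n
    by (induction n) (use ForC y in \<open>auto intro!: ForC.IH bounded_setx\<close>)
  from this[of "sc s y"] show ?case
    using y by (auto intro!: bounded_setx)
next
  case (SubC x1 x2 x3)
  then show ?case
    by (auto simp: bounded_def intro: le_trans[OF diff_le_self])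
next
  case (ReadC x)
  then show ?case
    by (auto simp: bounded_def split: list.splits dest: list.set_sel(2))
next
  case (SeqC a b)
  then show ?case
    by simp
qed (auto simp: bounded_def)

text \<open>
  The registers are divided into regions by their residues modulo 8: region 0 is reserved for the
  memory of an embedded program, region 3 holds the scalars and region 7 is scratch space.
\<close>

definition adr :: "nat \<Rightarrow> nat \<Rightarrow> nat" where
  "adr r i = 8 * i + r"

lemma adr_eq: "r < 8 \<Longrightarrow> r' < 8 \<Longrightarrow> adr r i = adr r' j \<longleftrightarrow> r = r' \<and> i = j"
  unfolding adr_def by presburger

text \<open>There is no multiplication, so \<open>adr r v = 8 * v + r\<close> is formed by three
  doublings and one addition, with \<open>adr 7 1\<close> holding the constant
  \<open>r\<close>.\<close>

definition addr_code :: "nat \<Rightarrow> nat \<Rightarrow> ram" where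
  "addr_code r y = [Add (adr 7 0) (adr 3 y) (adr 3 y), Add (adr 7 0) (adr 7 0) (adr 7 0),
     Add (adr 7 0) (adr 7 0) (adr 7 0), Const (adr 7 1) r, Add (adr 7 0) (adr 7 0) (adr 7 1)]"

text \<open>The argument \<open>p\<close> is the position of the first instruction. The loop test
  stands at the end of the loop; the entry gets there by a \<open>JumpPos\<close> on a register just
  set to 1, since the machine has no unconditional jump. The test computes bound minus counter,
  which is positive exactly while rounds remain.\<close>

primrec code :: "com \<Rightarrow> nat \<Rightarrow> ram" where
  "code (SetC x a) = (\<lambda>p. [Const (adr 3 x) a])"
| "code (AddC x y z) = (\<lambda>p. [Add (adr 3 x) (adr 3 y) (adr 3 z)])"
| "code (SubC x y z) = (\<lambda>p. [Sub (adr 3 x) (adr 3 y) (adr 3 z)])"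
| "code (GetC x r y) = (\<lambda>p. addr_code r y @ [Load (adr 3 x) (adr 7 0)])"
| "code (PutC r y x) = (\<lambda>p. addr_code r y @ [Store (adr 7 0) (adr 3 x)])"
| "code (ReadC x) = (\<lambda>p. [Read (adr 3 x)])"
| "code (PrintC x) = (\<lambda>p. [Print (adr 3 x)])"
| "code (a ;; b) = (\<lambda>p. code a p @ code b (p + length (code a p)))"
| "code (ForC x y c) = (\<lambda>p.
     [Const (adr 3 x) 0, Const (adr 7 0) 1, JumpPos (adr 7 0) (p + 5 + length (code c (p + 3)))] @
     code c (p + 3) @
     [Const (adr 7 0) 1, Add (adr 3 x) (adr 3 x) (adr 7 0), Sub (adr 7 0) (adr 3 y) (adr 3 x),
      JumpPos (adr 7 0) (p + 3)])"

text \<open>Regions 0 and 7 are left out: region 7 is overwritten freely, and region 0 belongs to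
  the embedded program, so its preservation is a separate conclusion of
  \<open>code_correct\<close>.\<close>

definition rep :: "st \<Rightarrow> config \<Rightarrow> bool" where
  "rep s cf \<longleftrightarrow> (\<forall>x. reg cf (adr 3 x) = sc s x) \<and> (\<forall>r\<in>regions. \<forall>i. reg cf (adr r i) = ar s r i) \<and>
     input_tape cf = itape s \<and> output_tape cf = otape s"

text \<open>The largest number handled is an address \<open>adr r v\<close> with
  \<open>v \<le> M\<close> and \<open>r < 8\<close>, whence \<open>8 * M + 8\<close>; the factor 2
  is for the two operands of an instruction.\<close>

definition unit_cost :: "nat \<Rightarrow> nat" where
  "unit_cost M = 1 + 2 * floorlog 2 (8 * M + 8)"

lemma unit_cost_le:
  assumes "a \<le> 8 * M + 8" "b \<le> 8 * M + 8"
  shows "1 + floorlog 2 a + floorlog 2 b \<le> unit_cost M"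
  using floorlog_mono[OF assms(1), of 2] floorlog_mono[OF assms(2), of 2] by (simp add: unit_cost_def)

lemma unit_cost_le1:
  assumes "a \<le> 8 * M + 8"
  shows "1 + floorlog 2 a \<le> unit_cost M"
  using unit_cost_le[OF assms assms] by simp

lemma unit_cost_ge1: "1 \<le> unit_cost M"
  by (simp add: unit_cost_def)

lemma regions_lt: "r \<in> regions \<Longrightarrow> r < 8 \<and> r \<noteq> 0 \<and> r \<noteq> 3 \<and> r \<noteq> 7"
  by (auto simp: regions_def)

lemma adr_regions [simp]:
  assumes "r \<in> regions"
  shows "adr r i \<noteq> adr 0 j" "adr r i \<noteq> adr 3 j" "adr r i \<noteq> adr 7 j"
    "adr 0 j \<noteq> adr r i" "adr 3 j \<noteq> adr r i" "adr 7 j \<noteq> adr r i"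
  using regions_lt[OF assms] by (auto simp: adr_eq)

lemma addr_code_reaches:
  assumes "code_at R (pc cf) (addr_code r y)" "reg cf (adr 3 y) \<le> M" "r < 8"
  shows "reaches R cf (5 * unit_cost M)
    (cf\<lparr>pc := pc cf + 5, reg := (reg cf)(adr 7 0 := adr r (reg cf (adr 3 y)), adr 7 1 := r)\<rparr>)"
proof -
  define v where "v = reg cf (adr 3 y)"
  let ?u = "unit_cost M"
  let ?p = "pc cf"
  have R: "?p < length R" "Suc ?p < length R" "Suc (Suc ?p) < length R" "Suc (Suc (Suc ?p)) < length R"
      "Suc (Suc (Suc (Suc ?p))) < length R"
    "R ! ?p = Add (adr 7 0) (adr 3 y) (adr 3 y)" "R ! Suc ?p = Add (adr 7 0) (adr 7 0) (adr 7 0)"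
    "R ! Suc (Suc ?p) = Add (adr 7 0) (adr 7 0) (adr 7 0)" "R ! Suc (Suc (Suc ?p)) = Const (adr 7 1) r"
    "R ! Suc (Suc (Suc (Suc ?p))) = Add (adr 7 0) (adr 7 0) (adr 7 1)"
    using assms(1) by (auto simp: addr_code_def code_at_Cons)
  have v: "v \<le> M"
    using assms v_def by simp
  have "reaches R cf (?u + (?u + (?u + (?u + (?u + 0)))))
    (cf\<lparr>pc := pc cf + 5, reg := (reg cf)(adr 7 0 := adr r (reg cf (adr 3 y)), adr 7 1 := r)\<rparr>)"
    apply (rule reaches_step, simp add: R)
    subgoal using v unit_cost_le[of v M v] by (simp add: v_def R)
    apply (rule reaches_step, simp add: R)
    subgoal using v unit_cost_le[of "v + v" M "v + v"] by (simp add: v_def R)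
    apply (rule reaches_step, simp add: R)
    subgoal using v unit_cost_le[of "v + v + (v + v)" M "v + v + (v + v)"] by (simp add: v_def R)
    apply (rule reaches_step, simp add: R)
    subgoal using unit_cost_ge1 by (simp add: R)
    apply (rule reaches_step, simp add: R)
    subgoal using v assms(3) unit_cost_le[of "v + v + (v + v) + (v + v + (v + v))" M r] by (simp add: v_def adr_eq R)
    subgoal
      by (rule back_subst[of "reaches R _ 0", OF reaches_refl]) (auto simp: adr_eq adr_def fun_eq_iff R)
    done
  then show ?thesis
    by (rule reaches_mono) simp
qed

text \<open>The factor 6 is the length of an indexed access, five instructions for the address and
  one for the transfer; the overhead of loops fits into the same allowance. Region 0 must stay
  untouched so that the embedded program finds its memory zeroed.\<close>

theorem code_correct:
  assumes "code_at R (pc cf) (code c (pc cf))" "rep s cf" "bounded M s" "wfc c" "safe M c s"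
  shows "\<exists>cf'. reaches R cf (steps c s * (6 * unit_cost M)) cf' \<and> rep (sem c s) cf' \<and>
    pc cf' = pc cf + length (code c (pc cf)) \<and> (\<forall>i. reg cf' (adr 0 i) = reg cf (adr 0 i))"
  using assms
proof (induction c arbitrary: s cf)
  case (SetC x a)
  show ?case
    by (rule exI[of _ "exec (Const (adr 3 x) a) cf"], intro conjI)
      (rule reaches_mono[OF reaches_instr[OF _ _ reaches_refl[of _ _ 0]]],
       use SetC unit_cost_ge1[of M] in \<open>auto simp: rep_def adr_eq dest: regions_lt\<close>)
next
  case (AddC x y z)
  have "sc s y \<le> M" "sc s z \<le> M"
    using AddC by (auto simp: bounded_def)
  then have u: "1 + floorlog 2 (sc s y) + floorlog 2 (sc s z) \<le> unit_cost M"
    by (intro unit_cost_le) auto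
  show ?case
    by (rule exI[of _ "exec (Add (adr 3 x) (adr 3 y) (adr 3 z)) cf"], intro conjI)
      (rule reaches_mono[OF reaches_instr[OF _ _ reaches_refl[of _ _ 0]]],
       use AddC u in \<open>auto simp: rep_def adr_eq dest: regions_lt\<close>)
next
  case (SubC x y z)
  have "sc s y \<le> M" "sc s z \<le> M"
    using SubC by (auto simp: bounded_def)
  then have u: "1 + floorlog 2 (sc s y) + floorlog 2 (sc s z) \<le> unit_cost M"
    by (intro unit_cost_le) auto
  show ?case
    by (rule exI[of _ "exec (Sub (adr 3 x) (adr 3 y) (adr 3 z)) cf"], intro conjI)
      (rule reaches_mono[OF reaches_instr[OF _ _ reaches_refl[of _ _ 0]]],
       use SubC u in \<open>auto simp: rep_def adr_eq dest: regions_lt\<close>)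
next
  case (GetC x r y)
  let ?v = "sc s y"
  have r: "r \<in> regions" "r < 8" "r \<noteq> 7"
    using GetC regions_lt by auto
  have v: "?v \<le> M" "ar s r ?v \<le> M"
    using GetC r by (auto simp: bounded_def)
  have rg: "reg cf (adr 3 y) = ?v" "reg cf (adr r ?v) = ar s r ?v"
    using GetC r by (auto simp: rep_def)
  define cf1 where
    "cf1 = cf\<lparr>pc := pc cf + 5, reg := (reg cf)(adr 7 0 := adr r (reg cf (adr 3 y)), adr 7 1 := r)\<rparr>"
  have 1: "reaches R cf (5 * unit_cost M) cf1"
    unfolding cf1_def using GetC.prems r v rg
    by (intro addr_code_reaches) (auto simp: code_at_append)
  have 2: "code_at R (pc cf1) [Load (adr 3 x) (adr 7 0)]"
    using GetC.prems by (simp add: code_at_Cons cf1_def addr_code_def eval_nat_numeral)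
  have "reaches R cf1 (unit_cost M + 0) (exec (Load (adr 3 x) (adr 7 0)) cf1)"
  proof (rule reaches_instr[OF 2 _ reaches_refl])
    have "1 + floorlog 2 (adr r ?v) + floorlog 2 (ar s r ?v) \<le> unit_cost M"
      using v r by (intro unit_cost_le) (auto simp: adr_def)
    then show "cost (Load (adr 3 x) (adr 7 0)) cf1 \<le> unit_cost M"
      using rg r by (simp add: cf1_def adr_eq)
  qed
  from reaches_trans[OF 1 this] show ?case
    by (intro exI conjI, use GetC.prems r rg in
        \<open>auto simp: rep_def adr_eq regions_lt cf1_def addr_code_def elim!: reaches_mono\<close>)
next
  case (PutC r y x)
  let ?v = "sc s y"
  have r: "r \<in> regions" "r < 8" "r \<noteq> 7" "r \<noteq> 3" "r \<noteq> 0"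
    using PutC regions_lt by auto
  have v: "?v \<le> M" "sc s x \<le> M"
    using PutC r by (auto simp: bounded_def)
  have rg: "reg cf (adr 3 y) = ?v" "reg cf (adr 3 x) = sc s x"
    using PutC r by (auto simp: rep_def)
  define cf1 where
    "cf1 = cf\<lparr>pc := pc cf + 5, reg := (reg cf)(adr 7 0 := adr r (reg cf (adr 3 y)), adr 7 1 := r)\<rparr>"
  have 1: "reaches R cf (5 * unit_cost M) cf1"
    unfolding cf1_def using PutC.prems r v rg
    by (intro addr_code_reaches) (auto simp: code_at_append)
  have 2: "code_at R (pc cf1) [Store (adr 7 0) (adr 3 x)]"
    using PutC.prems by (simp add: code_at_Cons cf1_def addr_code_def eval_nat_numeral)
  have "reaches R cf1 (unit_cost M + 0) (exec (Store (adr 7 0) (adr 3 x)) cf1)"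
  proof (rule reaches_instr[OF 2 _ reaches_refl])
    have "1 + floorlog 2 (adr r ?v) + floorlog 2 (sc s x) \<le> unit_cost M"
      using v r by (intro unit_cost_le) (auto simp: adr_def)
    then show "cost (Store (adr 7 0) (adr 3 x)) cf1 \<le> unit_cost M"
      using rg r by (simp add: cf1_def adr_eq)
  qed
  from reaches_trans[OF 1 this] show ?case
    by (intro exI conjI, use PutC.prems r rg in
        \<open>auto simp: rep_def adr_eq regions_lt cf1_def addr_code_def elim!: reaches_mono\<close>)
next
  case (ReadC x)
  have "next_input cf \<le> M"
    using ReadC by (auto simp: bounded_def rep_def next_input_def split: list.splits)
  then have u: "1 + floorlog 2 (next_input cf) \<le> unit_cost M"
    by (intro unit_cost_le1) auto
  show ?case
    by (rule exI[of _ "exec (Read (adr 3 x)) cf"], intro conjI)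
      (rule reaches_mono[OF reaches_instr[OF _ _ reaches_refl[of _ _ 0]]],
       use ReadC u in \<open>auto simp: rep_def adr_eq next_input_def dest: regions_lt\<close>)
next
  case (PrintC x)
  have "sc s x \<le> M"
    using PrintC by (auto simp: bounded_def)
  then have u: "1 + floorlog 2 (sc s x) \<le> unit_cost M"
    by (intro unit_cost_le1) auto
  show ?case
    by (rule exI[of _ "exec (Print (adr 3 x)) cf"], intro conjI)
      (rule reaches_mono[OF reaches_instr[OF _ _ reaches_refl[of _ _ 0]]],
       use PrintC u in \<open>auto simp: rep_def adr_eq dest: regions_lt\<close>)
next
  case (SeqC a b)
  let ?U = "6 * unit_cost M"
  obtain cf1 where 1: "reaches R cf (steps a s * ?U) cf1" "rep (sem a s) cf1"
    "pc cf1 = pc cf + length (code a (pc cf))" "\<forall>i. reg cf1 (adr 0 i) = reg cf (adr 0 i)"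
    using SeqC.IH(1)[of cf s] SeqC.prems by (auto simp: code_at_append)
  obtain cf2 where 2: "reaches R cf1 (steps b (sem a s) * ?U) cf2" "rep (sem b (sem a s)) cf2"
    "pc cf2 = pc cf1 + length (code b (pc cf1))" "\<forall>i. reg cf2 (adr 0 i) = reg cf1 (adr 0 i)"
    using SeqC.IH(2)[of cf1 "sem a s"] SeqC.prems 1 bounded_sem[of M s a]
    by (auto simp: code_at_append)
  have "reaches R cf (steps (a ;; b) s * ?U) cf2"
    using reaches_trans[OF 1(1) 2(1)] by (simp add: algebra_simps)
  moreover have "pc cf2 = pc cf + length (code (a ;; b) (pc cf))"
    using 1(3) 2(3) by simp
  ultimately show ?case
    using 1(4) 2(2,4) by (intro exI[of _ cf2] conjI) (auto simp only: sem.simps)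
next
  case (ForC x y c)
  let ?f = "\<lambda>i s. sem c (setx x i s)" and ?U = "6 * unit_cost M" and ?p = "pc cf"
  let ?L = "length (code c (?p + 3))"
  let ?s = "\<lambda>i. setx x i (iter ?f i s)"
  have wf: "x \<noteq> y" "x \<notin> wsc c" "y \<notin> wsc c" "wfc c"
    using ForC.prems by auto
  have y: "sc s y \<le> M"
    using ForC.prems by (auto simp: bounded_def)
  have scy: "sc (iter ?f i s) y = sc s y" for i
    by (induction i) (use wf in \<open>auto simp: sem_sc_frame\<close>)
  have bd: "i \<le> sc s y \<Longrightarrow> bounded M (?s i)" for i
  proof (induction i)
    case 0
    then show ?case
      using ForC.prems by (auto intro!: bounded_setx)
  next
    case (Suc i)
    then have "bounded M (sem c (?s i))"
      using ForC.prems by (intro bounded_sem) simp_all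
    then show ?case
      using Suc.prems y by (auto intro!: bounded_setx)
  qed
  let ?A = "[Const (adr 3 x) 0, Const (adr 7 0) 1, JumpPos (adr 7 0) (?p + 5 + ?L)]"
    and ?D = "[Const (adr 7 0) 1, Add (adr 3 x) (adr 3 x) (adr 7 0), Sub (adr 7 0) (adr 3 y) (adr 3 x),
      JumpPos (adr 7 0) (?p + 3)]"
  have lA: "length ?A = 3"
    by simp
  have "code_at R ?p (?A @ code c (?p + 3) @ ?D)"
    using ForC.prems(1) by (simp only: code.simps)
  then have at: "code_at R ?p ?A" and at_body: "code_at R (?p + 3) (code c (?p + 3))"
    and at_inc: "code_at R (?p + 3 + ?L) ?D"
    unfolding code_at_append lA by blast+
  \<comment> \<open>\<open>q2\<close> is the first instruction after the body. \<open>q\<close> is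
    the loop test, reached from the entry and after every round; the invariant \<open>?test\<close>
    is stated there, with the counter already equal to \<open>i\<close>.\<close>
  define q2 q where "q2 = ?p + 3 + ?L" and "q = Suc (Suc q2)"
  have q: "?p + 5 + ?L = q" "?p + 3 + ?L = q2" "?p + 7 + ?L = Suc (Suc q)" "Suc (Suc q2) = q"
    by (simp_all add: q_def q2_def)
  have R1: "?p < length R" "Suc ?p < length R" "Suc (Suc ?p) < length R"
    "R ! ?p = Const (adr 3 x) 0" "R ! Suc ?p = Const (adr 7 0) 1"
    "R ! Suc (Suc ?p) = JumpPos (adr 7 0) q"
    using at unfolding q by (auto simp: code_at_Cons)
  have R2: "q2 < length R" "Suc q2 < length R"
    "R ! q2 = Const (adr 7 0) 1" "R ! Suc q2 = Add (adr 3 x) (adr 3 x) (adr 7 0)"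
    and R3: "q < length R" "Suc q < length R"
    "R ! q = Sub (adr 7 0) (adr 3 y) (adr 3 x)" "R ! Suc q = JumpPos (adr 7 0) (?p + 3)"
    using at_inc unfolding q by (auto simp: code_at_Cons q)
  let ?test = "\<lambda>i cf'. rep (?s i) cf' \<and> pc cf' = q \<and>
    (\<forall>i. reg cf' (adr 0 i) = reg cf (adr 0 i))"
  have init: "\<exists>cf'. reaches R cf (3 * unit_cost M) cf' \<and> ?test 0 cf'"
  proof -
    let ?cf = "cf\<lparr>pc := q, reg := (reg cf)(adr 3 x := 0, adr 7 0 := 1)\<rparr>"
    have "reaches R cf (unit_cost M + (unit_cost M + (unit_cost M + 0))) ?cf"
      apply (rule reaches_step, simp add: R1)
      subgoal using unit_cost_ge1 by (simp add: R1)
      apply (rule reaches_step, simp add: R1)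
      subgoal using unit_cost_ge1 by (simp add: R1)
      apply (rule reaches_step, simp add: R1)
      subgoal using unit_cost_le1[of 1 M] by (simp add: R1)
      subgoal by (rule back_subst[of "reaches R _ 0", OF reaches_refl]) (simp add: R1)
      done
    then show ?thesis
      using ForC.prems(2) by (intro exI[of _ ?cf]) (auto simp: rep_def adr_eq dest: regions_lt elim!: reaches_mono)
  qed
  have test_true: "\<exists>cf2. reaches R cf1 (2 * unit_cost M) cf2 \<and> rep (?s i) cf2 \<and> pc cf2 = ?p + 3 \<and>
    (\<forall>i. reg cf2 (adr 0 i) = reg cf (adr 0 i))" if t: "?test i cf1" and i: "i < sc s y" for i cf1
  proof -
    let ?cf = "cf1\<lparr>pc := ?p + 3, reg := (reg cf1)(adr 7 0 := sc s y - i)\<rparr>"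
    have rg: "reg cf1 (adr 3 y) = sc s y" "reg cf1 (adr 3 x) = i"
      using t scy[of i] wf by (auto simp: rep_def)
    have "reaches R cf1 (unit_cost M + (unit_cost M + 0)) ?cf"
      apply (rule reaches_step, simp add: R3 t)
      subgoal using unit_cost_le[of "sc s y" M i] y i by (simp add: rg R3 t)
      apply (rule reaches_step, simp add: R3 t)
      subgoal using unit_cost_le1[of "sc s y - i" M] y i by (simp add: rg R3 t)
      subgoal by (rule back_subst[of "reaches R _ 0", OF reaches_refl]) (use i in \<open>simp add: rg R3 t\<close>)
      done
    then show ?thesis
      using t by (intro exI[of _ ?cf]) (auto simp: rep_def adr_eq dest: regions_lt elim!: reaches_mono)
  qed
  have test_false: "\<exists>cf2. reaches R cf1 (2 * unit_cost M) cf2 \<and> rep (?s i) cf2 \<and> pc cf2 = Suc (Suc q) \<and>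
    (\<forall>i. reg cf2 (adr 0 i) = reg cf (adr 0 i))" if t: "?test i cf1" and i: "i = sc s y" for i cf1
  proof -
    let ?cf = "cf1\<lparr>pc := Suc (Suc q), reg := (reg cf1)(adr 7 0 := sc s y - i)\<rparr>"
    have rg: "reg cf1 (adr 3 y) = sc s y" "reg cf1 (adr 3 x) = i"
      using t scy[of i] wf by (auto simp: rep_def)
    have "reaches R cf1 (unit_cost M + (unit_cost M + 0)) ?cf"
      apply (rule reaches_step, simp add: R3 t)
      subgoal using unit_cost_le[of "sc s y" M i] y i by (simp add: rg R3 t)
      apply (rule reaches_step, simp add: R3 t)
      subgoal using unit_cost_le1[of "sc s y - i" M] y i by (simp add: rg R3 t)
      subgoal by (rule back_subst[of "reaches R _ 0", OF reaches_refl]) (use i in \<open>simp add: rg R3 t\<close>)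
      done
    then show ?thesis
      using t by (intro exI[of _ ?cf]) (auto simp: rep_def adr_eq dest: regions_lt elim!: reaches_mono)
  qed
  have loop: "\<exists>cf'. reaches R cf (3 * unit_cost M + (\<Sum>j<i. (1 + steps c (?s j)) * ?U)) cf' \<and> ?test i cf'"
    if "i \<le> sc s y" for i
    using that
  proof (induction i)
    case 0
    then show ?case
      using init by simp
  next
    case (Suc i)
    then have i: "i < sc s y"
      by simp
    obtain cf1 where 1: "reaches R cf (3 * unit_cost M + (\<Sum>j<i. (1 + steps c (?s j)) * ?U)) cf1"
      and t1: "?test i cf1"
      using Suc by auto
    obtain cf2 where 2: "reaches R cf1 (2 * unit_cost M) cf2" "rep (?s i) cf2" "pc cf2 = ?p + 3"
      "\<forall>i. reg cf2 (adr 0 i) = reg cf (adr 0 i)"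
      using test_true[OF t1 i] by blast
    have "safe M c (?s i)"
      using ForC.prems i by simp
    then obtain cf3 where 3: "reaches R cf2 (steps c (?s i) * ?U) cf3" "rep (sem c (?s i)) cf3"
      "pc cf3 = q2" "\<forall>i. reg cf3 (adr 0 i) = reg cf (adr 0 i)"
      using ForC.IH[of cf2 "?s i"] 2 at_body wf(4) bd[of i] i by (auto simp: q)
    have rg: "reg cf3 (adr 3 x) = i"
      using 3(2) wf by (simp add: rep_def sem_sc_frame)
    let ?cf = "cf3\<lparr>pc := q, reg := (reg cf3)(adr 7 0 := 1, adr 3 x := Suc i)\<rparr>"
    have 4: "reaches R cf3 (unit_cost M + (unit_cost M + 0)) ?cf"
      apply (rule reaches_step, simp add: R2 3 q)
      subgoal using unit_cost_ge1 by (simp add: R2 3 q)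
      apply (rule reaches_step, simp add: R2 3 q)
      subgoal using unit_cost_le[of i M 1] y i by (simp add: rg adr_eq R2 3 q)
      subgoal by (rule back_subst[of "reaches R _ 0", OF reaches_refl]) (simp add: rg adr_eq R2 3 q)
      done
    have "?test (Suc i) ?cf"
      using 3 rg by (auto simp: rep_def adr_eq dest: regions_lt)
    moreover have "reaches R cf (3 * unit_cost M + (\<Sum>j<Suc i. (1 + steps c (?s j)) * ?U)) ?cf"
      by (rule reaches_mono[OF reaches_trans[OF reaches_trans[OF reaches_trans[OF 1 2(1)] 3(1)] 4]]) simp
    ultimately show ?case
      by blast
  qed
  obtain cf1 where 1: "reaches R cf (3 * unit_cost M + (\<Sum>j<sc s y. (1 + steps c (?s j)) * ?U)) cf1"
    "?test (sc s y) cf1"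
    using loop[OF order_refl] by blast
  obtain cf2 where 2: "reaches R cf1 (2 * unit_cost M) cf2" "rep (?s (sc s y)) cf2" "pc cf2 = Suc (Suc q)"
    "\<forall>i. reg cf2 (adr 0 i) = reg cf (adr 0 i)"
    using test_false[OF 1(2) refl] by blast
  \<comment> \<open>The three entry instructions and the two of the failing test are covered by the
    leading 1; each round adds two instructions for the test and two for the increment, covered by
    the 1 in the sum.\<close>
  have "steps (ForC x y c) s * ?U = ?U + (\<Sum>j<sc s y. (1 + steps c (?s j)) * ?U)"
    by (simp only: steps.simps distrib_right mult_1 sum_distrib_right)
  then have "reaches R cf (steps (ForC x y c) s * ?U) cf2"
    by (intro reaches_mono[OF reaches_trans[OF 1(1) 2(1)]]) simp
  moreover have "pc cf2 = ?p + length (code (ForC x y c) ?p)"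
    using 2(3) q(3) by simp
  ultimately show ?case
    using 2(2,4) by (intro exI[of _ cf2] conjI) (auto simp only: sem.simps)
qed

section \<open>Running a program inside another one\<close>

text \<open>Padding with zeros matches the convention that reading past the end of the input yields
  zero, so an array replaces a tape without an end marker, and the empty tape is the same as
  untouched memory.\<close>

definition tape :: "nat list \<Rightarrow> nat \<Rightarrow> nat" where
  "tape w i = (if i < length w then w ! i else 0)"

lemma tape_Nil [simp]: "tape [] = (\<lambda>_. 0)"
  by (simp add: tape_def fun_eq_iff)

lemma tape_snoc: "tape (w @ [a]) = (tape w)(length w := a)"
  by (auto simp: tape_def fun_eq_iff nth_append)

lemma floorlog_double: "floorlog 2 (a + a) \<le> floorlog 2 a + 1"
proof (cases "a = 0")
  case False
  then have "a < 2 ^ floorlog 2 a"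
    using floorlog_bounds[of a 2] by simp
  then show ?thesis
    by (intro floorlog_leI) auto
qed (simp add: floorlog_def)

text \<open>Scratch registers of the simulation: \<open>inR\<close> and \<open>outR\<close> hold the
  addresses of the next input and output cell, \<open>eightR\<close> the distance of consecutive
  cells of a region, and \<open>nop\<close> fills blocks up to four instructions.\<close>

abbreviation tmpR :: nat where "tmpR \<equiv> adr 7 0"
abbreviation inR :: nat where "inR \<equiv> adr 7 2"
abbreviation outR :: nat where "outR \<equiv> adr 7 3"
abbreviation eightR :: nat where "eightR \<equiv> adr 7 4"
abbreviation nop :: instr where "nop \<equiv> Const tmpR 0"

text \<open>
  Every instruction becomes a block of four, so that instruction \<open>l\<close> starts at offset \<open>4 * l\<close>.
  The tapes live in regions 1 and 2.
\<close>

fun sim_instr :: "nat \<Rightarrow> nat \<Rightarrow> instr \<Rightarrow> ram" where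
  "sim_instr p n (Const i c) = [Const (adr 0 i) c, nop, nop, nop]"
| "sim_instr p n (Add i j k) = [Add (adr 0 i) (adr 0 j) (adr 0 k), nop, nop, nop]"
| "sim_instr p n (Sub i j k) = [Sub (adr 0 i) (adr 0 j) (adr 0 k), nop, nop, nop]"
| "sim_instr p n (Load i j) = [Add tmpR (adr 0 j) (adr 0 j), Add tmpR tmpR tmpR, Add tmpR tmpR tmpR,
     Load (adr 0 i) tmpR]"
| "sim_instr p n (Store i j) = [Add tmpR (adr 0 i) (adr 0 i), Add tmpR tmpR tmpR, Add tmpR tmpR tmpR,
     Store tmpR (adr 0 j)]"
| "sim_instr p n (JumpPos j l) = [JumpPos (adr 0 j) (p + 4 * min l n), nop, nop, nop]"
| "sim_instr p n (Read i) = [Load (adr 0 i) inR, Add inR inR eightR, nop, nop]"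
| "sim_instr p n (Print i) = [Store outR (adr 0 i), Add outR outR eightR, nop, nop]"

definition sim_body :: "ram \<Rightarrow> nat \<Rightarrow> ram" where
  "sim_body P p = concat (map (sim_instr p (length P)) P)"

text \<open>The pointers start at the first cells of the tape regions, \<open>adr 1 0 = 1\<close>
  and \<open>adr 2 0 = 2\<close>.\<close>

definition sim :: "ram \<Rightarrow> nat \<Rightarrow> ram" where
  "sim P p = [Const inR 1, Const outR 2, Const eightR 8] @ sim_body P (p + 3)"

lemma length_sim_instr [simp]: "length (sim_instr p n i) = 4"
  by (cases i) auto

lemma length_sim_body: "length (sim_body P p) = 4 * length P"
proof -
  have "length (concat (map (sim_instr p n) Q)) = 4 * length Q" for n Q
    by (induction Q) auto
  then show ?thesis
    by (simp add: sim_body_def)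
qed

lemma code_at_sim_body:
  assumes "code_at R p (sim_body P p)" "l < length P"
  shows "code_at R (p + 4 * l) (sim_instr p (length P) (P ! l))"
proof -
  have "code_at R q (concat (map f Q)) \<Longrightarrow> l < length Q \<Longrightarrow> code_at R (q + 4 * l) (f (Q ! l))"
    if "\<And>i. length (f i) = 4" for q f and Q :: ram
  proof (induction Q arbitrary: q l)
    case (Cons a Q)
    show ?case
    proof (cases l)
      case 0
      then show ?thesis
        using Cons.prems by (simp add: code_at_append)
    next
      case (Suc k)
      then have "code_at R (q + 4 + 4 * k) (f (Q ! k))"
        using Cons.prems by (intro Cons.IH) (auto simp: code_at_append that)
      then show ?thesis
        using Suc by (simp add: add.assoc)
    qed
  qed simp
  from this[of "sim_instr p (length P)" p P] show ?thesis
    using assms by (simp add: sim_body_def)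
qed

lemma code_at_4D:
  assumes "code_at R p [a, b, c, d]"
  shows "p < length R" "Suc p < length R" "Suc (Suc p) < length R" "Suc (Suc (Suc p)) < length R"
    "R ! p = a" "R ! Suc p = b" "R ! Suc (Suc p) = c" "R ! Suc (Suc (Suc p)) = d"
  using assms by (auto simp: code_at_Cons)

lemma reaches_block:
  assumes "code_at R (pc s) [a, b, c, d]"
    "pc (exec a s) = Suc (pc s)" "pc (exec b (exec a s)) = Suc (Suc (pc s))"
    "pc (exec c (exec b (exec a s))) = Suc (Suc (Suc (pc s)))"
    "cost a s + cost b (exec a s) + cost c (exec b (exec a s)) + cost d (exec c (exec b (exec a s))) \<le> t"
  shows "reaches R s t (exec d (exec c (exec b (exec a s))))"
proof -
  note R = code_at_4D[OF assms(1)]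
  have "reaches R s (cost a s + (cost b (exec a s) + (cost c (exec b (exec a s)) +
      (cost d (exec c (exec b (exec a s))) + 0)))) (exec d (exec c (exec b (exec a s))))"
    apply (rule reaches_step, simp add: R)
    subgoal by (simp add: R)
    apply (rule reaches_step, simp add: R assms(2))
    subgoal by (simp add: R assms(2))
    apply (rule reaches_step, simp add: R assms(2,3))
    subgoal by (simp add: R assms(2,3))
    apply (rule reaches_step, simp add: R assms(2-4))
    subgoal by (simp add: R assms(2-4))
    subgoal by (simp add: R assms(2-4) reaches_refl)
    done
  then show ?thesis
    using assms(5) by (auto elim: reaches_mono)
qed

text \<open>\<open>w\<close> is the whole input and \<open>k\<close> counts the reads so far,
  possibly beyond its end. Since the simulated counter is clipped at \<open>length P\<close>, every
  way of leaving the instruction range lands directly behind the simulating block, where the next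
  code begins.\<close>

definition simrel :: "ram \<Rightarrow> nat \<Rightarrow> nat list \<Rightarrow> config \<Rightarrow> nat \<Rightarrow> config \<Rightarrow> config \<Rightarrow> bool" where
  "simrel P p w cf0 k \<sigma> cf \<longleftrightarrow>
     pc cf = p + 4 * min (pc \<sigma>) (length P) \<and>
     (\<forall>i. reg cf (adr 0 i) = reg \<sigma> i) \<and>
     (\<forall>i. reg cf (adr 1 i) = tape w i) \<and>
     (\<forall>i. reg cf (adr 2 i) = tape (output_tape \<sigma>) i) \<and>
     (\<forall>r\<in>{3, 4, 5, 6}. \<forall>i. reg cf (adr r i) = reg cf0 (adr r i)) \<and>
     input_tape \<sigma> = drop k w \<and> reg cf inR = adr 1 k \<and>
     reg cf outR = adr 2 (length (output_tape \<sigma>)) \<and> reg cf eightR = 8 \<and>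
     input_tape cf = input_tape cf0 \<and> output_tape cf = output_tape cf0"

text \<open>The 13 pays for \<open>Load\<close> and \<open>Store\<close>: the three doublings and
  the access cost at most 13 plus seven times the bit length of the address plus that of the value.
  The logarithmic term pays for handling a tape pointer to a cell of index at most
  \<open>B\<close>.\<close>

definition sim_cost :: "nat \<Rightarrow> nat" where
  "sim_cost B = 13 + 3 * floorlog 2 (8 * B + 8)"

lemma next_input_tape: "input_tape \<sigma> = drop k w \<Longrightarrow> next_input \<sigma> = tape w k"
  by (cases "k < length w")
    (auto simp: next_input_def tape_def hd_drop_conv_nth split: list.splits dest: arg_cong[where f = hd])

lemma cost_pos: "1 \<le> cost i s"
  by (cases i) auto

lemma floorlog_quad: "floorlog 2 (a + a + (a + a)) \<le> floorlog 2 a + 2"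
  using floorlog_double[of a] floorlog_double[of "a + a"] by simp

lemma floorlog_oct: "floorlog 2 (a + a + (a + a) + (a + a + (a + a))) \<le> floorlog 2 a + 3"
  using floorlog_quad[of a] floorlog_double[of "a + a + (a + a)"] by simp

lemma oct_adr: "a + a + (a + a) + (a + a + (a + a)) = adr 0 a"
  by (simp add: adr_def)

lemma adr_plus_8: "adr r i + 8 = adr r (Suc i)"
  by (simp add: adr_def)

lemma sim_step:
  assumes at: "code_at R p (sim_body P p)" and rel: "simrel P p w cf0 k \<sigma> cf"
    and pc: "pc \<sigma> < length P" and B: "k \<le> B" "length (output_tape \<sigma>) \<le> B"
  shows "\<exists>cf' k'. k' \<le> Suc k \<and> reaches R cf (cost (P ! pc \<sigma>) \<sigma> * sim_cost B) cf' \<and>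
    simrel P p w cf0 k' (exec (P ! pc \<sigma>) \<sigma>) cf'"
proof -
  let ?L = "floorlog 2 (8 * B + 8)"
  have at': "code_at R (pc cf) (sim_instr p (length P) (P ! pc \<sigma>))"
    using code_at_sim_body[OF at pc] rel pc by (simp add: simrel_def)
  have r0: "reg cf (adr 0 i) = reg \<sigma> i" for i
    using rel by (simp add: simrel_def)
  have f8: "floorlog 2 (8::nat) = 4"
    by (simp add: floorlog_eq_if floorlog_def[of _ 1] compute_floorlog)
  have ptr: "floorlog 2 (adr 1 k) \<le> ?L" "floorlog 2 (adr 2 (length (output_tape \<sigma>))) \<le> ?L"
    using B by (auto intro!: floorlog_mono simp: adr_def)
  have mn: "min (Suc (pc \<sigma>)) (length P) = Suc (pc \<sigma>)" "min (pc \<sigma>) (length P) = pc \<sigma>"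
    using pc by auto
  have K: "13 \<le> sim_cost B" "8 + 2 * ?L \<le> sim_cost B"
    by (simp_all add: sim_cost_def)
  have le: "a \<le> c * sim_cost B" if "a \<le> c * 13" for a c
    using that mult_left_mono[OF K(1), of c] by linarith
  show ?thesis
  proof (cases "P ! pc \<sigma>")
    case (Const i c)
    have "reaches R cf (1 * sim_cost B) (exec nop (exec nop (exec nop (exec (Const (adr 0 i) c) cf))))"
      using at' K by (intro reaches_block) (auto simp: Const floorlog_def)
    then show ?thesis
      by (intro exI[of _ "exec nop (exec nop (exec nop (exec (Const (adr 0 i) c) cf)))"] exI[of _ k])
        (use rel mn in \<open>auto simp: Const simrel_def adr_eq\<close>)
  next
    case (Add i j l)
    let ?c = "cost (P ! pc \<sigma>) \<sigma>"
    have c: "?c = 1 + floorlog 2 (reg \<sigma> j) + floorlog 2 (reg \<sigma> l)"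
      by (simp add: Add)
    then have "?c + 3 \<le> ?c * sim_cost B"
      by (intro le) simp
    then have "reaches R cf (?c * sim_cost B)
        (exec nop (exec nop (exec nop (exec (Add (adr 0 i) (adr 0 j) (adr 0 l)) cf))))"
      using at' by (intro reaches_block) (auto simp: Add r0)
    then show ?thesis
      by (intro exI[of _ "exec nop (exec nop (exec nop (exec (Add (adr 0 i) (adr 0 j) (adr 0 l)) cf)))"]
          exI[of _ k]) (use rel mn in \<open>auto simp: Add simrel_def adr_eq\<close>)
  next
    case (Sub i j l)
    let ?c = "cost (P ! pc \<sigma>) \<sigma>"
    have c: "?c = 1 + floorlog 2 (reg \<sigma> j) + floorlog 2 (reg \<sigma> l)"
      by (simp add: Sub)
    then have "?c + 3 \<le> ?c * sim_cost B"
      by (intro le) simp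
    then have "reaches R cf (?c * sim_cost B)
        (exec nop (exec nop (exec nop (exec (Sub (adr 0 i) (adr 0 j) (adr 0 l)) cf))))"
      using at' by (intro reaches_block) (auto simp: Sub r0)
    then show ?thesis
      by (intro exI[of _ "exec nop (exec nop (exec nop (exec (Sub (adr 0 i) (adr 0 j) (adr 0 l)) cf)))"]
          exI[of _ k]) (use rel mn in \<open>auto simp: Sub simrel_def adr_eq\<close>)
  next
    case (Load i j)
    let ?c = "cost (P ! pc \<sigma>) \<sigma>" and ?a = "reg \<sigma> j"
    let ?cf = "exec (Load (adr 0 i) tmpR) (exec (Add tmpR tmpR tmpR) (exec (Add tmpR tmpR tmpR)
      (exec (Add tmpR (adr 0 j) (adr 0 j)) cf)))"
    have c: "?c = 1 + floorlog 2 ?a + floorlog 2 (reg \<sigma> ?a)"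
      by (simp add: Load)
    have "(1 + floorlog 2 ?a + floorlog 2 ?a) + (1 + floorlog 2 (?a + ?a) + floorlog 2 (?a + ?a)) +
        (1 + floorlog 2 (?a + ?a + (?a + ?a)) + floorlog 2 (?a + ?a + (?a + ?a))) +
        (1 + floorlog 2 (adr 0 ?a) + floorlog 2 (reg \<sigma> ?a)) \<le> ?c * 13"
      unfolding c using floorlog_double[of ?a] floorlog_quad[of ?a] floorlog_oct[of ?a, unfolded oct_adr]
      by simp
    from le[OF this] have "reaches R cf (?c * sim_cost B) ?cf"
      using at' by (intro reaches_block) (auto simp: Load r0 adr_eq oct_adr)
    then show ?thesis
      by (intro exI[of _ ?cf] exI[of _ k]) (use rel mn in \<open>auto simp: Load simrel_def adr_eq oct_adr\<close>)
  next
    case (Store i j)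
    let ?c = "cost (P ! pc \<sigma>) \<sigma>" and ?a = "reg \<sigma> i"
    let ?cf = "exec (Store tmpR (adr 0 j)) (exec (Add tmpR tmpR tmpR) (exec (Add tmpR tmpR tmpR)
      (exec (Add tmpR (adr 0 i) (adr 0 i)) cf)))"
    have c: "?c = 1 + floorlog 2 ?a + floorlog 2 (reg \<sigma> j)"
      by (simp add: Store)
    have "(1 + floorlog 2 ?a + floorlog 2 ?a) + (1 + floorlog 2 (?a + ?a) + floorlog 2 (?a + ?a)) +
        (1 + floorlog 2 (?a + ?a + (?a + ?a)) + floorlog 2 (?a + ?a + (?a + ?a))) +
        (1 + floorlog 2 (adr 0 ?a) + floorlog 2 (reg \<sigma> j)) \<le> ?c * 13"
      unfolding c using floorlog_double[of ?a] floorlog_quad[of ?a] floorlog_oct[of ?a, unfolded oct_adr]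
      by simp
    from le[OF this] have "reaches R cf (?c * sim_cost B) ?cf"
      using at' by (intro reaches_block) (auto simp: Store r0 adr_eq oct_adr)
    then show ?thesis
      by (intro exI[of _ ?cf] exI[of _ k]) (use rel mn in \<open>auto simp: Store simrel_def adr_eq oct_adr\<close>)
  next
    case (JumpPos j l)
    let ?c = "cost (P ! pc \<sigma>) \<sigma>"
    have c: "?c = 1 + floorlog 2 (reg \<sigma> j)"
      by (simp add: JumpPos)
    have K': "?c + 3 \<le> ?c * sim_cost B"
      using c by (intro le) simp
    show ?thesis
    proof (cases "reg \<sigma> j > 0")
      case False
      have "reaches R cf (?c * sim_cost B)
        (exec nop (exec nop (exec nop (exec (JumpPos (adr 0 j) (p + 4 * min l (length P))) cf))))"
        using at' K' False by (intro reaches_block) (auto simp: JumpPos r0)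
      then show ?thesis
        by (intro exI[of _ "exec nop (exec nop (exec nop
            (exec (JumpPos (adr 0 j) (p + 4 * min l (length P))) cf)))"] exI[of _ k])
          (use rel mn False in \<open>auto simp: JumpPos simrel_def adr_eq\<close>)
    next
      case True
      note R = code_at_4D[OF at'[unfolded JumpPos sim_instr.simps]]
      have "reaches R cf (?c + 0) (exec (JumpPos (adr 0 j) (p + 4 * min l (length P))) cf)"
        by (rule reaches_step) (auto simp: R JumpPos r0 reaches_refl)
      then have "reaches R cf (?c * sim_cost B) (exec (JumpPos (adr 0 j) (p + 4 * min l (length P))) cf)"
        by (rule reaches_mono) (rule order_trans[OF _ K'], simp)
      then show ?thesis
        by (intro exI[of _ "exec (JumpPos (adr 0 j) (p + 4 * min l (length P))) cf"] exI[of _ k])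
          (use rel mn True in \<open>auto simp: JumpPos simrel_def adr_eq\<close>)
    qed
  next
    case (Read i)
    let ?c = "cost (P ! pc \<sigma>) \<sigma>" and ?v = "tape w k"
    let ?cf = "exec nop (exec nop (exec (Add inR inR eightR) (exec (Load (adr 0 i) inR) cf)))"
    have v: "next_input \<sigma> = ?v"
      using rel by (intro next_input_tape) (simp add: simrel_def)
    have rg: "reg cf inR = adr 1 k" "reg cf (adr 1 k) = ?v" "reg cf eightR = 8"
      using rel by (auto simp: simrel_def)
    have c: "?c = 1 + floorlog 2 ?v"
      by (simp add: Read v)
    have "(1 + floorlog 2 (adr 1 k) + floorlog 2 ?v) + (1 + floorlog 2 (adr 1 k) + 4) + 1 + 1 \<le>
        floorlog 2 ?v * 1 + sim_cost B"
      using K ptr by simp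
    also have "\<dots> \<le> ?c * sim_cost B"
      unfolding c using K by simp
    finally have "reaches R cf (?c * sim_cost B) ?cf"
      using at' by (intro reaches_block) (auto simp: Read rg rg[unfolded One_nat_def] adr_eq f8)
    then show ?thesis
      by (intro exI[of _ ?cf] exI[of _ "Suc k"])
        (use rel mn rg v in \<open>auto simp: Read simrel_def adr_eq adr_plus_8 drop_Suc tl_drop\<close>)
  next
    case (Print i)
    let ?c = "cost (P ! pc \<sigma>) \<sigma>" and ?l = "length (output_tape \<sigma>)"
    let ?cf = "exec nop (exec nop (exec (Add outR outR eightR) (exec (Store outR (adr 0 i)) cf)))"
    have rg: "reg cf outR = adr 2 ?l" "reg cf eightR = 8"
      using rel by (auto simp: simrel_def)
    have c: "?c = 1 + floorlog 2 (reg \<sigma> i)"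
      by (simp add: Print)
    have "(1 + floorlog 2 (adr 2 ?l) + floorlog 2 (reg \<sigma> i)) + (1 + floorlog 2 (adr 2 ?l) + 4) + 1 + 1 \<le>
        floorlog 2 (reg \<sigma> i) * 1 + sim_cost B"
      using K ptr by simp
    also have "\<dots> \<le> ?c * sim_cost B"
      unfolding c using K by simp
    finally have "reaches R cf (?c * sim_cost B) ?cf"
      using at' by (intro reaches_block) (auto simp: Print rg adr_eq f8 r0)
    then show ?thesis
      by (intro exI[of _ ?cf] exI[of _ k])
        (use rel mn rg in \<open>auto simp: Print simrel_def adr_eq adr_plus_8 tape_snoc\<close>)
  qed
qed

text \<open>Each instruction costs at least 1 and reads or prints at most one number. So the tape
  positions plus the remaining cost never increase, and the two hypotheses on \<open>B\<close>
  survive the induction.\<close>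

lemma sim_halts:
  assumes "halts_from P \<sigma> t ys" "code_at R p (sim_body P p)"
    "simrel P p w cf0 k \<sigma> cf" "k + t \<le> B" "length (output_tape \<sigma>) + t \<le> B"
  shows "\<exists>cf' k' \<sigma>'. reaches R cf (t * sim_cost B) cf' \<and> simrel P p w cf0 k' \<sigma>' cf' \<and>
    length P \<le> pc \<sigma>' \<and> output_tape \<sigma>' = ys"
  using assms
proof (induction arbitrary: k cf rule: halts_from.induct)
  case (halt s)
  then show ?case
    using reaches_refl by blast
next
  case (step s t ys)
  let ?i = "P ! pc s"
  note c = cost_pos[of ?i s]
  obtain cf1 k1 where 1: "k1 \<le> Suc k" "reaches R cf (cost ?i s * sim_cost B) cf1"
    "simrel P p w cf0 k1 (exec ?i s) cf1"
    using sim_step[OF step.prems(1,2) step.hyps(1), of B] step.prems(3,4) by auto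
  have "length (output_tape (exec ?i s)) \<le> Suc (length (output_tape s))"
    by (cases ?i) auto
  then obtain cf2 k2 \<sigma>2 where 2: "reaches R cf1 (t * sim_cost B) cf2" "simrel P p w cf0 k2 \<sigma>2 cf2"
    "length P \<le> pc \<sigma>2" "output_tape \<sigma>2 = ys"
    using step.IH[OF step.prems(1) 1(3)] 1(1) c step.prems(3,4) by fastforce
  have "reaches R cf ((cost ?i s + t) * sim_cost B) cf2"
    using reaches_trans[OF 1(2) 2(1)] by (simp add: distrib_right)
  then show ?case
    using 2 by blast
qed

text \<open>Every printed number costs at least 1. This bounds the output of the converter by its
  running time, and it is also what makes a sublinear converter impossible.\<close>

lemma halts_from_length: "halts_from P \<sigma> t ys \<Longrightarrow> length ys \<le> length (output_tape \<sigma>) + t"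
proof (induction rule: halts_from.induct)
  case (step s t ys)
  have "length (output_tape (exec (P ! pc s) s)) \<le> Suc (length (output_tape s))"
    by (cases "P ! pc s") auto
  then show ?case
    using step.IH cost_pos[of "P ! pc s" s] by simp
qed simp

theorem sim_correct:
  assumes "ram_outputs P w t w'" "code_at R (pc cf) (sim P (pc cf))" "rep s cf"
    "\<And>i. reg cf (adr 0 i) = 0" "ar s 1 = tape w" "ar s 2 = (\<lambda>_. 0)"
  shows "\<exists>cf'. reaches R cf (3 + t * sim_cost t) cf' \<and> rep (s\<lparr>ar := (ar s)(2 := tape w')\<rparr>) cf' \<and>
    pc cf' = pc cf + length (sim P (pc cf))"
proof -
  let ?p = "pc cf"
  let ?cf = "cf\<lparr>pc := ?p + 3, reg := (reg cf)(inR := 1, outR := 2, eightR := 8)\<rparr>"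
  let ?\<sigma> = "\<lparr>pc = 0, reg = (\<lambda>_. 0), input_tape = w, output_tape = []\<rparr>"
  have at: "code_at R (?p + 3) (sim_body P (?p + 3))"
    and R: "?p < length R" "Suc ?p < length R" "Suc (Suc ?p) < length R"
    "R ! ?p = Const inR 1" "R ! Suc ?p = Const outR 2" "R ! Suc (Suc ?p) = Const eightR 8"
    using assms(2) by (auto simp: sim_def code_at_Cons numeral_3_eq_3)
  have "reaches R cf (1 + (1 + (1 + 0))) ?cf"
    apply (rule reaches_step, simp add: R)
    subgoal by (simp add: R)
    apply (rule reaches_step, simp add: R)
    subgoal by (simp add: R)
    apply (rule reaches_step, simp add: R)
    subgoal by (simp add: R)
    subgoal by (rule back_subst[of "reaches R _ 0", OF reaches_refl]) (simp add: R)
    done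
  then have 1: "reaches R cf 3 ?cf"
    by (simp add: numeral_3_eq_3)
  have reg: "reg cf (adr 1 i) = tape w i" "reg cf (adr 2 i) = 0" for i
    using assms(3,5,6) by (auto simp: rep_def regions_def)
  have "simrel P (?p + 3) w cf 0 ?\<sigma> ?cf"
    using assms(4) reg by (auto simp: simrel_def adr_eq) (auto simp: adr_def)
  then obtain cf' k' \<sigma>' where 2: "reaches R ?cf (t * sim_cost t) cf'" "simrel P (?p + 3) w cf k' \<sigma>' cf'"
    "length P \<le> pc \<sigma>'" "output_tape \<sigma>' = w'"
    using sim_halts[OF assms(1)[unfolded ram_outputs_def] at, of w cf 0 ?cf t] by auto
  have "rep (s\<lparr>ar := (ar s)(2 := tape w')\<rparr>) cf'"
    using 2 assms(3,5) by (auto simp: simrel_def rep_def regions_def)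
  moreover have "pc cf' = ?p + length (sim P ?p)"
    using 2 by (simp add: simrel_def sim_def length_sim_body min_def)
  ultimately show ?thesis
    using reaches_trans[OF 1 2(1)] by blast
qed

section \<open>Correctness triples\<close>

text \<open>A fixed start state in place of a precondition turns symbolic execution with
  \<open>tri_simps\<close> into plain rewriting of that state.\<close>

definition tri :: "nat \<Rightarrow> com \<Rightarrow> st \<Rightarrow> nat \<Rightarrow> (st \<Rightarrow> bool) \<Rightarrow> bool" where
  "tri M c s k Q \<longleftrightarrow> safe M c s \<and> steps c s \<le> k \<and> Q (sem c s)"

definition frame :: "com \<Rightarrow> st \<Rightarrow> st \<Rightarrow> bool" where
  "frame c s s' \<longleftrightarrow> (\<forall>z. z \<notin> wsc c \<longrightarrow> sc s' z = sc s z) \<and> (\<forall>r. r \<notin> war c \<longrightarrow> ar s' r = ar s r) \<and>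
     (no_print c \<longrightarrow> otape s' = otape s)"

lemma frame_sem: "frame c s (sem c s)"
  by (simp add: frame_def sem_sc_frame sem_ar_frame sem_no_print)

lemma tri_conseq:
  assumes "tri M c s k Q" "k \<le> k'" "\<And>s'. Q s' \<Longrightarrow> frame c s s' \<Longrightarrow> Q' s'"
  shows "tri M c s k' Q'"
  using assms frame_sem[of c s] by (auto simp: tri_def)

lemma tri_seq:
  assumes "tri M a s k P" "\<And>s'. P s' \<Longrightarrow> frame a s s' \<Longrightarrow> tri M b s' k' Q"
  shows "tri M (a ;; b) s (k + k') Q"
  using assms frame_sem[of a s] by (fastforce simp: tri_def)

lemma tri_seq':
  assumes "tri M a s k P" "k \<le> K" "\<And>s'. P s' \<Longrightarrow> frame a s s' \<Longrightarrow> tri M b s' (K - k) Q"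
  shows "tri M (a ;; b) s K Q"
  using tri_seq[OF assms(1,3)] assms(2) by simp

lemma tri_simps:
  "tri M (SetC x a) s k Q \<longleftrightarrow> 1 \<le> k \<and> a \<le> M \<and> Q (setx x a s)"
  "tri M (AddC x y z) s k Q \<longleftrightarrow> 1 \<le> k \<and> sc s y + sc s z \<le> M \<and> Q (setx x (sc s y + sc s z) s)"
  "tri M (SubC x y z) s k Q \<longleftrightarrow> 1 \<le> k \<and> Q (setx x (sc s y - sc s z) s)"
  "tri M (GetC x r y) s k Q \<longleftrightarrow> 1 \<le> k \<and> Q (setx x (ar s r (sc s y)) s)"
  "tri M (PutC r y x) s k Q \<longleftrightarrow> 1 \<le> k \<and> Q (seta r (sc s y) (sc s x) s)"
  "tri M (ReadC x) s k Q \<longleftrightarrow> 1 \<le> k \<and>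
     Q (setx x (case itape s of [] \<Rightarrow> 0 | a # _ \<Rightarrow> a) (s\<lparr>itape := tl (itape s)\<rparr>))"
  "tri M (PrintC x) s k Q \<longleftrightarrow> 1 \<le> k \<and> Q (s\<lparr>otape := otape s @ [sc s x]\<rparr>)"
  "tri M (SetC x a ;; c) s k Q \<longleftrightarrow> 1 \<le> k \<and> a \<le> M \<and> tri M c (setx x a s) (k - 1) Q"
  "tri M (AddC x y z ;; c) s k Q \<longleftrightarrow> 1 \<le> k \<and> sc s y + sc s z \<le> M \<and>
     tri M c (setx x (sc s y + sc s z) s) (k - 1) Q"
  "tri M (SubC x y z ;; c) s k Q \<longleftrightarrow> 1 \<le> k \<and> tri M c (setx x (sc s y - sc s z) s) (k - 1) Q"
  "tri M (GetC x r y ;; c) s k Q \<longleftrightarrow> 1 \<le> k \<and> tri M c (setx x (ar s r (sc s y)) s) (k - 1) Q"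
  "tri M (PutC r y x ;; c) s k Q \<longleftrightarrow> 1 \<le> k \<and> tri M c (seta r (sc s y) (sc s x) s) (k - 1) Q"
  "tri M (ReadC x ;; c) s k Q \<longleftrightarrow> 1 \<le> k \<and>
     tri M c (setx x (case itape s of [] \<Rightarrow> 0 | a # _ \<Rightarrow> a) (s\<lparr>itape := tl (itape s)\<rparr>)) (k - 1) Q"
  by (auto simp: tri_def)

text \<open>Symbolic execution subtracts each step from the remaining budget; this turns the
  accumulated truncated subtractions back into sums. Positivity of \<open>a\<close> is what rules
  out truncation.\<close>

lemma budget: "0 < a \<Longrightarrow> a \<le> k - x \<longleftrightarrow> a + x \<le> (k::nat)"
  by linarith

lemma tri_assoc: "tri M ((a ;; b) ;; c) s k Q \<longleftrightarrow> tri M (a ;; b ;; c) s k Q"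
  by (auto simp: tri_def add.assoc)

lemma tri_ForC:
  assumes "I 0 s"
    and step: "\<And>i s'. i < sc s y \<Longrightarrow> I i s' \<Longrightarrow> frame (ForC x y c) s s' \<Longrightarrow>
      tri M c (setx x i s') (k i) (I (Suc i))"
    and fin: "\<And>s'. I (sc s y) s' \<Longrightarrow> frame (ForC x y c) s s' \<Longrightarrow> Q (setx x (sc s y) s')"
    and "1 + (\<Sum>i<sc s y. 1 + k i) \<le> K"
  shows "tri M (ForC x y c) s K Q"
proof -
  let ?f = "\<lambda>i s. sem c (setx x i s)" and ?n = "sc s y"
  have fr: "frame (ForC x y c) s (iter ?f i s)" for i
  proof (induction i)
    case (Suc i)
    then show ?case
      using frame_sem[of c "setx x i (iter ?f i s)"] by (simp add: frame_def)
  qed (simp add: frame_def)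
  have I: "i \<le> ?n \<Longrightarrow> I i (iter ?f i s)" for i
  proof (induction i)
    case (Suc i)
    then show ?case
      using step[of i "iter ?f i s"] fr[of i] by (simp add: tri_def)
  qed (use assms in simp)
  have t: "tri M c (setx x i (iter ?f i s)) (k i) (I (Suc i))" if "i < ?n" for i
    using step[OF that I fr] that by simp
  have "(\<Sum>i<?n. 1 + steps c (setx x i (iter ?f i s))) \<le> (\<Sum>i<?n. 1 + k i)"
    using t by (intro sum_mono) (auto simp: tri_def)
  then show ?thesis
    unfolding tri_def using t assms(4) fin[OF I fr] by (auto simp: tri_def)
qed

lemma tri_ForC_const:
  assumes "I 0 s"
    and "\<And>i s'. i < sc s y \<Longrightarrow> I i s' \<Longrightarrow> frame (ForC x y c) s s' \<Longrightarrow>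
      tri M c (setx x i s') k (I (Suc i))"
    and "\<And>s'. I (sc s y) s' \<Longrightarrow> frame (ForC x y c) s s' \<Longrightarrow> Q (setx x (sc s y) s')"
    and "1 + sc s y * (1 + k) \<le> K"
  shows "tri M (ForC x y c) s K Q"
  by (rule tri_ForC[where I = I and k = "\<lambda>_. k"]) (use assms in auto)

section \<open>Program fragments\<close>

text \<open>
  The arrays hold the code of the OR-circuit (1), the output of the converter
  (2), the formula (4), and the literal values under the two partial assignments (5, 6); the second
  program reuses array 5 for the values of the gates.
\<close>

abbreviation (input) "vN \<equiv> 0::nat"
abbreviation (input) "vM \<equiv> 27::nat"
abbreviation (input) "vOne \<equiv> 2::nat"
abbreviation (input) "vP \<equiv> 3::nat"
abbreviation (input) "vLen \<equiv> 4::nat"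
abbreviation (input) "vL \<equiv> 5::nat"
abbreviation (input) "vJ \<equiv> 6::nat"
abbreviation (input) "vAcc \<equiv> 7::nat"
abbreviation (input) "vT \<equiv> 8::nat"
abbreviation (input) "vU \<equiv> 9::nat"
abbreviation (input) "vCarry \<equiv> 10::nat"
abbreviation (input) "vI \<equiv> 11::nat"
abbreviation (input) "vE \<equiv> 12::nat"
abbreviation (input) "vH \<equiv> 13::nat"
abbreviation (input) "vG \<equiv> 14::nat"
abbreviation (input) "vN1 \<equiv> 15::nat"
abbreviation (input) "vN2 \<equiv> 16::nat"
abbreviation (input) "vM1 \<equiv> 17::nat"
abbreviation (input) "vIp \<equiv> 18::nat"
abbreviation (input) "vV \<equiv> 19::nat"
abbreviation (input) "vQ \<equiv> 20::nat"
abbreviation (input) "vA \<equiv> 21::nat"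
abbreviation (input) "vC \<equiv> 22::nat"
abbreviation (input) "vAl \<equiv> 23::nat"
abbreviation (input) "vZero \<equiv> 24::nat"
abbreviation (input) "vCap \<equiv> 25::nat"
abbreviation (input) "vD \<equiv> 26::nat"

text \<open>Truncated subtraction serves as the test: one minus the number of true literals is 1
  exactly if there is none. \<open>vP\<close> is left just behind the clause, so consecutive clauses
  can be scanned without further bookkeeping.\<close>

definition EVAL_CLAUSE :: "nat \<Rightarrow> com" where
  "EVAL_CLAUSE r = GetC vLen 4 vP ;; AddC vP vP vOne ;; SetC vAcc 0 ;;
     ForC vJ vLen (GetC vL 4 vP ;; AddC vP vP vOne ;; GetC vT r vL ;; AddC vAcc vAcc vT) ;;
     SubC vU vOne vAcc"

definition clause_code :: "literal list \<Rightarrow> nat list" where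
  "clause_code c = length c # map encode_literal c"

lemma tape_nth_append: "i < length w \<Longrightarrow> tape (v @ w @ z) (length v + i) = w ! i"
  by (auto simp: tape_def nth_append)

lemma tri_EVAL_CLAUSE:
  assumes "sc s vOne = 1" "ar s 4 = tape (xs @ clause_code c @ ys)" "sc s vP = length xs"
    "ar s r = lv" "\<And>j. lv j \<le> 1" "length xs + 1 + length c \<le> M"
  shows "tri M (EVAL_CLAUSE r) s (5 + 5 * length c) (\<lambda>s'.
    sc s' vU = 1 - (\<Sum>l\<leftarrow>c. lv (encode_literal l)) \<and> sc s' vP = length xs + 1 + length c)"
proof -
  let ?s = "setx vAcc 0 (setx vP (length xs + 1) (setx vLen (length c) s))"
  let ?body = "GetC vL 4 vP ;; AddC vP vP vOne ;; GetC vT r vL ;; AddC vAcc vAcc vT"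
  have F0: "ar s 4 (length xs) = length c"
    using tape_nth_append[of 0 "clause_code c" xs ys] by (simp add: assms(2) clause_code_def)
  have F: "ar s 4 (length xs + 1 + i) = encode_literal (c ! i)" if "i < length c" for i
    using tape_nth_append[of "Suc i" "clause_code c" xs ys] that by (simp add: assms(2) clause_code_def)
  have le: "(\<Sum>l\<leftarrow>take i c. lv (encode_literal l)) \<le> length c" for i
  proof -
    have "(\<Sum>l\<leftarrow>d. lv (encode_literal l)) \<le> length d" for d
    proof (induction d)
      case (Cons a d)
      then show ?case
        using assms(5)[of "encode_literal a"] by simp
    qed simp
    from this[of "take i c"] show ?thesis
      by simp
  qed
  let ?I = "\<lambda>i (s' :: st). sc s' vAcc = (\<Sum>l\<leftarrow>take i c. lv (encode_literal l))
      \<and> sc s' vP = length xs + 1 + i"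
  have "tri M (ForC vJ vLen ?body) ?s (1 + length c * 5)
    (\<lambda>s'. sc s' vAcc = (\<Sum>l\<leftarrow>c. lv (encode_literal l)) \<and> sc s' vP = length xs + 1 + length c)"
  proof (rule tri_ForC_const[where k = 4 and I = ?I])
    fix i and s' :: st assume i: "i < sc ?s vLen"
      and I: "?I i s'"
      and fr: "frame (ForC vJ vLen ?body) ?s s'"
    have i': "i < length c"
      using i by simp
    have "ar s' 4 = ar s 4" "ar s' r = lv" "sc s' vOne = 1"
      using fr assms by (simp_all add: frame_def)
    then show "tri M ?body (setx vJ i s') 4 (?I (Suc i))"
      using I i' F[OF i'] le[of "Suc i"] assms(6)
      by (simp add: tri_simps take_Suc_conv_app_nth)
  qed auto
  then have "tri M (ForC vJ vLen ?body ;; SubC vU vOne vAcc) ?s (2 + 5 * length c) (\<lambda>s'.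
      sc s' vU = 1 - (\<Sum>l\<leftarrow>c. lv (encode_literal l)) \<and> sc s' vP = length xs + 1 + length c)"
    by (rule tri_seq') (use assms in \<open>simp_all add: tri_simps frame_def\<close>)
  then show ?thesis
    unfolding EVAL_CLAUSE_def using assms F0 by (simp add: tri_simps)
qed

text \<open>
  The table of literal values under the partial assignment that gives the variables
  \<open>lo, \<dots>, lo + len - 1\<close> the binary digits of \<open>\<alpha>\<close>. Unassigned literals are false; the extra
  literal \<open>Pos n\<close> is true.
\<close>

definition lval :: "nat \<Rightarrow> nat \<Rightarrow> nat \<Rightarrow> nat \<Rightarrow> nat \<Rightarrow> nat" where
  "lval lo len n \<alpha> j =
     (if lo \<le> j div 2 \<and> j div 2 < lo + len
      then (if even j then \<alpha> div 2 ^ (j div 2 - lo) mod 2 else 1 - \<alpha> div 2 ^ (j div 2 - lo) mod 2)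
      else if j = 2 * n then 1 else 0)"

lemma lval_le: "lval lo len n \<alpha> j \<le> 1"
proof -
  have "x mod 2 \<le> 1" for x :: nat
    by presburger
  then show ?thesis
    unfolding lval_def by (auto simp del: One_nat_def)
qed

lemma lval_outside:
  "\<not> (lo \<le> j div 2 \<and> j div 2 < lo + len) \<Longrightarrow> lval lo len n \<alpha> j = lval lo len n \<beta> j"
  unfolding lval_def by (simp only: if_False)

lemma lval_even:
  "i < len \<Longrightarrow> lval lo len n \<alpha> (lo + i + (lo + i)) = \<alpha> div 2 ^ i mod 2"
  by (simp add: lval_def)

lemma lval_odd:
  "i < len \<Longrightarrow> lval lo len n \<alpha> (Suc (lo + i + (lo + i))) = 1 - \<alpha> div 2 ^ i mod 2"
  by (simp add: lval_def)

text \<open>The lowest \<open>len\<close> digits of \<open>2 ^ len\<close> are all zero. Counting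
  through all assignments therefore returns the table to its initial state, ready for the next
  clause.\<close>

lemma lval_wrap: "lval lo len n (2 ^ len) = lval lo len n 0"
proof
  fix j
  show "lval lo len n (2 ^ len) j = lval lo len n 0 j"
  proof (cases "lo \<le> j div 2 \<and> j div 2 < lo + len")
    case True
    let ?d = "j div 2 - lo"
    have "(2::nat) ^ len = 2 ^ ?d * 2 ^ (len - ?d)" "len - ?d > 0"
      using True by (auto simp: power_add[symmetric])
    then have "2 ^ len div 2 ^ ?d mod (2::nat) = 0"
      by simp
    then show ?thesis
      using True unfolding lval_def by (simp only: if_True simp_thms div_0 mod_0)
  next
    case False
    then show ?thesis
      unfolding lval_def by (simp only: if_False)
  qed
qed

text \<open>Increments the binary counter that the table represents, rewriting both literals of each
  variable. The sum of digit and carry is 0, 1 or 2; the new carry is this sum minus 1, truncated,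
  and the new digit is the sum minus twice the new carry.\<close>

definition NEXT_ASSIGNMENT :: "nat \<Rightarrow> nat \<Rightarrow> nat \<Rightarrow> com" where
  "NEXT_ASSIGNMENT r lo len = SetC vCarry 1 ;;
     ForC vI len (AddC vE lo vI ;; AddC vE vE vE ;; GetC vT r vE ;; AddC vT vT vCarry ;;
       SubC vCarry vT vOne ;; SubC vT vT vCarry ;; SubC vT vT vCarry ;; PutC r vE vT ;;
       SubC vT vOne vT ;; AddC vE vE vOne ;; PutC r vE vT)"

lemma carry_arith:
  fixes A C :: nat
  assumes "C \<le> 1"
  shows "A mod 2 + C - 1 = (A + C) div 2 - A div 2"
    "A mod 2 + C - (A mod 2 + C - 1) - (A mod 2 + C - 1) = (A + C) mod 2"
proof -
  have "C = 0 \<or> C = 1"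
    using assms by linarith
  moreover obtain a where "A = 2 * a \<or> A = 2 * a + 1"
    using oddE evenE by metis
  ultimately show "A mod 2 + C - 1 = (A + C) div 2 - A div 2"
    "A mod 2 + C - (A mod 2 + C - 1) - (A mod 2 + C - 1) = (A + C) mod 2"
    by auto
qed

lemma tri_NEXT_ASSIGNMENT:
  assumes "lo \<notin> {vCarry, vE, vT, vI}" "len \<notin> {vCarry, vE, vT, vI}" "sc s vOne = 1"
    "ar s r = lval (sc s lo) (sc s len) n \<alpha>" "sc s lo + sc s len \<le> n" "2 * n + 2 \<le> M"
  shows "tri M (NEXT_ASSIGNMENT r lo len) s (2 + 12 * sc s len)
    (\<lambda>s'. ar s' r = lval (sc s lo) (sc s len) n (Suc \<alpha>))"
proof -
  define l k where "l = sc s lo" and "k = sc s len"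
  define A B C where "A = (\<lambda>i. \<alpha> div 2 ^ i)" and "B = (\<lambda>i. Suc \<alpha> div 2 ^ i)" and "C = (\<lambda>i. B i - A i)"
  let ?t = "\<lambda>i j. if j div 2 < l + i then lval l k n (Suc \<alpha>) j else lval l k n \<alpha> j"
  let ?body = "AddC vE lo vI ;; AddC vE vE vE ;; GetC vT r vE ;; AddC vT vT vCarry ;;
       SubC vCarry vT vOne ;; SubC vT vT vCarry ;; SubC vT vT vCarry ;; PutC r vE vT ;;
       SubC vT vOne vT ;; AddC vE vE vOne ;; PutC r vE vT"
  have BA: "A i \<le> B i" "B i \<le> Suc (A i)" for i
    by (simp_all add: A_def B_def div_le_mono div_Suc)
  have C: "C i \<le> 1" "A i + C i = B i" for i
    using BA[of i] by (simp_all add: C_def)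
  have half: "A (Suc i) = A i div 2" "B (Suc i) = B i div 2" for i
    by (simp_all add: A_def B_def div_mult2_eq mult.commute[of 2])
  have C_Suc: "A i mod 2 + C i - 1 = C (Suc i)" for i
  proof -
    have "C (Suc i) = B (Suc i) - A (Suc i)"
      by (simp only: C_def)
    then show ?thesis
      using carry_arith(1)[OF C(1), of "A i" i] by (simp only: C(2) half)
  qed
  have B_mod: "A i mod 2 + C i - C (Suc i) - C (Suc i) = B i mod 2" for i
    using carry_arith(2)[OF C(1), of "A i" i] by (simp only: C_Suc C(2))
  have C0: "C 0 = 1"
    by (simp add: C_def A_def B_def)
  let ?I = "\<lambda>i (s' :: st). ar s' r = ?t i \<and> sc s' vCarry = C i"
  have "tri M (ForC vI len ?body) (setx vCarry 1 s) (1 + k * 12) (\<lambda>s'. ar s' r = lval l k n (Suc \<alpha>))"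
  proof (rule tri_ForC_const[where k = 11 and I = ?I])
    have "?t 0 = lval l k n \<alpha>"
      using lval_outside[of l _ k n "Suc \<alpha>" \<alpha>] by (intro ext) (simp split: if_split)
    then show "ar (setx vCarry 1 s) r = ?t 0 \<and> sc (setx vCarry 1 s) vCarry = C 0"
      using assms(4) C0 by (simp add: l_def k_def)
  next
    fix i and s' :: st assume i: "i < sc (setx vCarry 1 s) len" and I: "?I i s'"
      and fr: "frame (ForC vI len ?body) (setx vCarry 1 s) s'"
    have i': "i < k"
      using i assms(2) by (simp add: k_def)
    have s': "sc s' lo = l" "sc s' vOne = 1"
      using fr assms(1-3) by (simp_all add: frame_def l_def)
    let ?e = "l + i + (l + i)"
    have e: "?e div 2 = l + i" "Suc ?e div 2 = l + i" "even ?e"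
      by simp_all
    have get: "ar s' r ?e = A i mod 2"
      using I e lval_even[OF i', of l n \<alpha>] by (simp add: A_def)
    have val: "lval l k n (Suc \<alpha>) ?e = B i mod 2" "lval l k n (Suc \<alpha>) (Suc ?e) = 1 - B i mod 2"
      by (simp_all only: lval_even[OF i'] lval_odd[OF i'] B_def)
    have new: "(ar s' r)(?e := B i mod 2, Suc ?e := 1 - B i mod 2) = ?t (Suc i)"
    proof
      fix j
      have "j = ?e \<or> j = Suc ?e" if "j div 2 = l + i"
        using that div_mult_mod_eq[of j 2] mod_less_divisor[of 2 j] by linarith
      then consider "j = ?e" | "j = Suc ?e" | "j div 2 \<noteq> l + i" "j \<noteq> ?e" "j \<noteq> Suc ?e"
        by blast
      then show "((ar s' r)(?e := B i mod 2, Suc ?e := 1 - B i mod 2)) j = ?t (Suc i) j"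
      proof cases
        case 3
        then have "j div 2 < l + Suc i \<longleftrightarrow> j div 2 < l + i"
          by linarith
        then show ?thesis
          using 3 I by simp
      qed (use e val in simp_all)
    qed
    have bd: "A i mod 2 + C i \<le> M" "l + i \<le> M" "?e \<le> M" "Suc ?e \<le> M"
      using i' assms(5,6) C(1)[of i] mod_less_divisor[of 2 "A i"] unfolding l_def k_def by linarith+
    define a where "a = ar s' r"
    show "tri M ?body (setx vI i s') 11 (?I (Suc i))"
      unfolding new[symmetric] a_def[symmetric]
      using I[THEN conjunct2] s' get bd assms(1,2) C_Suc[of i] B_mod[of i]
      by (simp add: tri_simps a_def[symmetric])
  next
    fix s' :: st assume I: "ar s' r = ?t (sc (setx vCarry 1 s) len) \<and> sc s' vCarry = C (sc (setx vCarry 1 s) len)"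
    have k: "sc (setx vCarry 1 s) len = k"
      using assms(2) by (simp add: k_def)
    have "?t k = lval l k n (Suc \<alpha>)"
      using lval_outside[of l _ k n \<alpha> "Suc \<alpha>"] by (intro ext) (simp split: if_split)
    with I show "ar (setx vI (sc (setx vCarry 1 s) len) s') r = lval l k n (Suc \<alpha>)"
      unfolding k by simp
  next
    show "1 + sc (setx vCarry 1 s) len * (1 + 11) \<le> 1 + k * 12"
      using assms(2) by (simp add: k_def)
  qed
  then show ?thesis
    unfolding NEXT_ASSIGNMENT_def l_def[symmetric] k_def[symmetric] using assms(6) by (simp add: tri_simps mult.commute)
qed

text \<open>Under the assignment 0 exactly the negative literals of the assigned variables are true,
  besides the extra literal at index \<open>2 * n\<close>. Only ones are written because the array
  is still zero.\<close>

definition INIT_TABLE :: "nat \<Rightarrow> nat \<Rightarrow> nat \<Rightarrow> com" where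
  "INIT_TABLE r lo len = ForC vI len (AddC vE lo vI ;; AddC vE vE vE ;; AddC vE vE vOne ;; PutC r vE vOne) ;;
     AddC vE vN vN ;; PutC r vE vOne"

lemma tri_INIT_TABLE:
  assumes "lo \<notin> {vE, vI}" "len \<notin> {vE, vI}" "sc s vOne = 1" "sc s vN = n"
    "ar s r = (\<lambda>_. 0)" "sc s lo + sc s len \<le> n" "2 * n + 2 \<le> M"
  shows "tri M (INIT_TABLE r lo len) s (3 + 5 * sc s len)
    (\<lambda>s'. ar s' r = lval (sc s lo) (sc s len) n 0)"
proof -
  define l k where "l = sc s lo" and "k = sc s len"
  let ?t = "\<lambda>i j. if l \<le> j div 2 \<and> j div 2 < l + i \<and> odd j then 1 else (0::nat)"
  let ?body = "AddC vE lo vI ;; AddC vE vE vE ;; AddC vE vE vOne ;; PutC r vE vOne"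
  let ?I = "\<lambda>i (s' :: st). ar s' r = ?t i"
  have "tri M (ForC vI len ?body) s (1 + k * 5) (\<lambda>s'. ar s' r = ?t k)"
  proof (rule tri_ForC_const[where k = 4 and I = ?I])
    show "ar s r = ?t 0"
      using assms by auto
  next
    fix i and s' :: st assume i: "i < sc s len" and I: "?I i s'" and fr: "frame (ForC vI len ?body) s s'"
    have s': "sc s' lo = l" "sc s' vOne = 1"
      using fr assms by (simp_all add: frame_def l_def)
    have new: "(ar s' r)(Suc (l + i + (l + i)) := 1) = ?t (Suc i)"
    proof
      fix j
      show "((ar s' r)(Suc (l + i + (l + i)) := 1)) j = ?t (Suc i) j"
      proof (cases "j = Suc (l + i + (l + i))")
        case False
        then have "odd j \<Longrightarrow> j div 2 \<noteq> l + i"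
          by (auto elim!: oddE)
        then have "odd j \<Longrightarrow> j div 2 < l + Suc i \<longleftrightarrow> j div 2 < l + i"
          by linarith
        then show ?thesis
          using False I by auto
      qed simp
    qed
    define a where "a = ar s' r"
    show "tri M ?body (setx vI i s') 4 (?I (Suc i))"
      unfolding new[symmetric] a_def[symmetric]
      using s' i assms(1,2,6,7) by (simp add: tri_simps a_def[symmetric] l_def[symmetric])
  qed (use assms(2) in \<open>simp_all add: k_def\<close>)
  then show ?thesis
    unfolding INIT_TABLE_def l_def[symmetric] k_def[symmetric]
  proof (rule tri_seq')
    fix s' :: st assume t: "ar s' r = ?t k" and fr: "frame (ForC vI len ?body) s s'"
    have s': "sc s' vN = n" "sc s' vOne = 1"
      using fr assms by (simp_all add: frame_def)
    have "(?t k)(n + n := 1) = lval l k n 0"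
    proof
      fix j
      show "((?t k)(n + n := 1)) j = lval l k n 0 j"
      proof (cases "j = n + n")
        case True
        then show ?thesis
          using assms(6) unfolding lval_def by (simp add: l_def k_def mult_2)
      next
        case False
        then show ?thesis
          unfolding lval_def by (simp add: mult_2)
      qed
    qed
    then show "tri M (AddC vE vN vN ;; PutC r vE vOne) s' (3 + 5 * k - (1 + k * 5))
        (\<lambda>s'. ar s' r = lval l k n 0)"
      using t s' assms(7) by (simp add: tri_simps)
  qed simp
qed

text \<open>With no division at hand, the pair \<open>(i div 2, i - i div 2)\<close> is advanced by
  the rule \<open>(a, b) \<mapsto> (b, a + 1)\<close>.\<close>

definition HALVE :: com where
  "HALVE = SetC vH 0 ;; SetC vG 0 ;;
     ForC vI vN (AddC vT vH vZero ;; AddC vH vG vZero ;; AddC vG vT vOne)"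

lemma tri_HALVE:
  assumes "sc s vOne = 1" "sc s vZero = 0" "sc s vN = n" "n \<le> M"
  shows "tri M HALVE s (3 + 4 * n) (\<lambda>s'. sc s' vH = n div 2 \<and> sc s' vG = n - n div 2)"
proof -
  have h: "Suc i - Suc i div 2 = Suc (i div 2)" "Suc i div 2 = i - i div 2" for i :: nat
    by presburger+
  let ?body = "AddC vT vH vZero ;; AddC vH vG vZero ;; AddC vG vT vOne"
  let ?I = "\<lambda>i (s' :: st). sc s' vH = i div 2 \<and> sc s' vG = i - i div 2"
  have "tri M (ForC vI vN ?body) (setx vG 0 (setx vH 0 s)) (1 + n * 4)
      (\<lambda>s'. sc s' vH = n div 2 \<and> sc s' vG = n - n div 2)"
  proof (rule tri_ForC_const[where k = 3 and I = ?I])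
    fix i and s' :: st assume i: "i < sc (setx vG 0 (setx vH 0 s)) vN"
      and I: "?I i s'"
      and fr: "frame (ForC vI vN ?body) (setx vG 0 (setx vH 0 s)) s'"
    have "sc s' vOne = 1" "sc s' vZero = 0"
      using fr assms by (simp_all add: frame_def)
    moreover have "i div 2 \<le> M" "i - i div 2 \<le> M" "Suc (i div 2) \<le> M"
      using i assms(3,4) by simp_all
    ultimately show "tri M ?body (setx vI i s') 3 (?I (Suc i))"
      using I i assms h[of i] by (simp add: tri_simps)
  qed (use assms in auto)
  then show ?thesis
    unfolding HALVE_def using assms by (simp add: tri_simps mult.commute)
qed

definition POW :: "nat \<Rightarrow> nat \<Rightarrow> com" where
  "POW x y = SetC x 1 ;; ForC vI y (AddC x x x)"

lemma tri_POW:
  assumes "x \<noteq> vI" "y \<noteq> vI" "x \<noteq> y" "2 ^ sc s y \<le> M"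
  shows "tri M (POW x y) s (2 + 2 * sc s y) (\<lambda>s'. sc s' x = 2 ^ sc s y)"
proof -
  let ?I = "\<lambda>i (s' :: st). sc s' x = 2 ^ i"
  have "tri M (ForC vI y (AddC x x x)) (setx x 1 s) (1 + sc s y * 2) (\<lambda>s'. sc s' x = 2 ^ sc s y)"
  proof (rule tri_ForC_const[where k = 1 and I = ?I])
    fix i and s' :: st assume i: "i < sc (setx x 1 s) y" and I: "?I i s'"
    have "(2::nat) ^ Suc i \<le> 2 ^ sc s y"
      using i assms(3) by (intro power_increasing) auto
    then show "tri M (AddC x x x) (setx vI i s') 1 (?I (Suc i))"
      using I assms by (simp add: tri_simps)
  qed (use assms in auto)
  moreover have "1 \<le> M"
    using assms(4) order_trans[of 1 "2 ^ sc s y" M] by simp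
  ultimately show ?thesis
    unfolding POW_def by (simp add: tri_simps mult.commute)
qed

section \<open>Writing the circuit\<close>

definition fcode :: "cnf \<Rightarrow> nat list" where
  "fcode F = concat (map clause_code F)"

lemma fcode_simps [simp]: "fcode [] = []" "fcode (c # F) = clause_code c @ fcode F"
  "fcode (F @ G) = fcode F @ fcode G"
  by (simp_all add: fcode_def)

lemma length_clause_code [simp]: "length (clause_code c) = Suc (length c)"
  by (simp add: clause_code_def)

lemma encode_cnf_eq: "encode_cnf n F = n # length F # fcode F"
  by (simp add: encode_cnf_def fcode_def clause_code_def[abs_def])

lemma fcode_split: "i < length F \<Longrightarrow> fcode F = fcode (take i F) @ clause_code (F ! i) @ fcode (drop (Suc i) F)"
  by (metis append.assoc fcode_simps(2,3) id_take_nth_drop)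

lemma fcode_take_Suc: "i < length F \<Longrightarrow> fcode (take (Suc i) F) = fcode (take i F) @ clause_code (F ! i)"
  by (simp add: take_Suc_conv_app_nth)

lemma length_fcode_take: "length (fcode (take i F)) \<le> length (fcode F)"
  by (metis append_take_drop_id fcode_simps(3) le_add1 length_append)

section \<open>Reading the formula into memory\<close>

definition READ_CLAUSE :: com where
  "READ_CLAUSE = ReadC vLen ;; PutC 4 vP vLen ;; AddC vP vP vOne ;;
     ForC vJ vLen (ReadC vL ;; PutC 4 vP vL ;; AddC vP vP vOne)"

lemma tri_READ_CLAUSE:
  assumes "sc s vOne = 1" "itape s = clause_code c @ ys" "ar s 4 = tape xs" "sc s vP = length xs"
    "length xs + 1 + length c \<le> M" "4 + 4 * length c \<le> k"
  shows "tri M READ_CLAUSE s k (\<lambda>s'. itape s' = ys \<and> ar s' 4 = tape (xs @ clause_code c) \<and>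
    sc s' vP = length (xs @ clause_code c))"
proof -
  let ?body = "ReadC vL ;; PutC 4 vP vL ;; AddC vP vP vOne"
  let ?Q = "\<lambda>s'. itape s' = ys \<and> ar s' 4 = tape (xs @ clause_code c) \<and>
    sc s' vP = length (xs @ clause_code c)"
  let ?xs = "\<lambda>i. xs @ take (Suc i) (clause_code c)"
  let ?I = "\<lambda>i (s' :: st). itape s' = map encode_literal (drop i c) @ ys \<and> ar s' 4 = tape
      (?xs i) \<and> sc s' vP = length xs + 1 + i"
  have loop: "tri M (ForC vJ vLen ?body) s1 (1 + 4 * length c) ?Q"
    if s1: "sc s1 vLen = length c" "itape s1 = map encode_literal c @ ys"
      "ar s1 4 = tape (xs @ [length c])" "sc s1 vP = Suc (length xs)" "sc s1 vOne = 1" for s1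
  proof (rule tri_ForC_const[where k = 3 and I = ?I])
    fix i and s' :: st assume i: "i < sc s1 vLen" and fr: "frame (ForC vJ vLen ?body) s1 s'"
      and I: "?I i s'"
    have i': "i < length c"
      using i s1 by simp
    have one: "sc s' vOne = 1"
      using fr s1 by (simp add: frame_def)
    have d: "drop i c = c ! i # drop (Suc i) c"
      using i' by (simp add: Cons_nth_drop_Suc)
    have "?xs (Suc i) = ?xs i @ [encode_literal (c ! i)]"
      using i' by (simp add: clause_code_def take_Suc_conv_app_nth)
    then have t: "tape (?xs (Suc i)) = (tape (?xs i))(length xs + 1 + i := encode_literal (c ! i))"
      using i' by (simp only: tape_snoc) (simp add: clause_code_def)
    have bd: "length xs + 1 + i + 1 \<le> M"
      using i' assms(5) by simp
    define a where "a = tape (?xs i)"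
    show "tri M ?body (setx vJ i s') 3 (?I (Suc i))"
      unfolding t a_def[symmetric]
      using I[folded a_def] one bd by (simp add: tri_simps d del: fun_upd_apply) simp
  qed (use s1 assms(6) in \<open>simp_all add: clause_code_def\<close>)
  show ?thesis
    unfolding READ_CLAUSE_def using assms
    by (auto simp: tri_simps budget clause_code_def tape_snoc intro!: tri_conseq[OF loop])
qed

text \<open>The clause \<open>[Pos n]\<close> is appended as the two numbers 1 and
  \<open>2 * n\<close>. Its literal is true in both tables, so it is never falsified; it only
  guarantees that there is a clause even if the formula is empty.\<close>

definition READ_CNF :: com where
  "READ_CNF = ReadC vN ;; ReadC vM ;; SetC vOne 1 ;; SetC vP 0 ;; ForC vC vM READ_CLAUSE ;;
     PutC 4 vP vOne ;; AddC vP vP vOne ;; AddC vT vN vN ;; PutC 4 vP vT ;; AddC vM1 vM vOne"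

lemma tri_READ_CNF:
  assumes "itape s = encode_cnf n F" "ar s 4 = (\<lambda>_. 0)" "\<And>c. c \<in> set F \<Longrightarrow> length c \<le> K"
    "length (fcode F) + 2 \<le> M" "2 * n \<le> M" "length F + 1 \<le> M"
    "10 + length F * (5 + 4 * K) \<le> k"
  shows "tri M READ_CNF s k (\<lambda>s'. sc s' vN = n \<and> sc s' vOne = 1 \<and> sc s' vM1 = length F + 1 \<and>
    ar s' 4 = tape (fcode (F @ [[Pos n]])))"
proof -
  let ?I = "\<lambda>i (s' :: st). itape s' = fcode (drop i F) \<and> ar s' 4 = tape (fcode (take i F))
      \<and> sc s' vP = length (fcode (take i F))"
  have loop: "tri M (ForC vC vM READ_CLAUSE) s1 (1 + length F * (5 + 4 * K))
      (\<lambda>s'. ar s' 4 = tape (fcode F) \<and> sc s' vP = length (fcode F))"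
    if s1: "sc s1 vM = length F" "itape s1 = fcode F" "ar s1 4 = (\<lambda>_. 0)" "sc s1 vP = 0" "sc s1 vOne = 1" for s1
  proof (rule tri_ForC_const[where k = "4 + 4 * K" and I = ?I])
    fix i and s' :: st assume i: "i < sc s1 vM" and fr: "frame (ForC vC vM READ_CLAUSE) s1 s'"
      and I: "?I i s'"
    have i': "i < length F"
      using i s1 by simp
    have one: "sc s' vOne = 1"
      using fr s1 by (simp add: frame_def READ_CLAUSE_def)
    have d: "drop i F = F ! i # drop (Suc i) F"
      using i' by (simp add: Cons_nth_drop_Suc)
    have "length (fcode (take (Suc i) F)) \<le> length (fcode F)"
      by (rule length_fcode_take)
    then have bd: "length (fcode (take i F)) + 1 + length (F ! i) \<le> M"
      using fcode_take_Suc[OF i'] assms(4) by simp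
    have K: "length (F ! i) \<le> K"
      using assms(3) i' by simp
    show "tri M READ_CLAUSE (setx vC i s') (4 + 4 * K) (?I (Suc i))"
      unfolding fcode_take_Suc[OF i'] by (rule tri_READ_CLAUSE) (use I one d bd K in simp_all)
  qed (use s1 in simp_all)
  have fin: "tape (fcode (F @ [[Pos n]])) =
      (tape (fcode F))(length (fcode F) := 1, Suc (length (fcode F)) := 2 * n)"
    using tape_snoc[of "fcode F @ [1]" "2 * n"] by (simp add: tape_snoc clause_code_def)
  let ?rest = "PutC 4 vP vOne ;; AddC vP vP vOne ;; AddC vT vN vN ;; PutC 4 vP vT ;; AddC vM1 vM vOne"
  have rest: "tri M (ForC vC vM READ_CLAUSE ;; ?rest) s1 (6 + length F * (5 + 4 * K)) (\<lambda>s'. sc s' vN = n \<and> sc s' vOne = 1 \<and>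
      sc s' vM1 = length F + 1 \<and> ar s' 4 = tape (fcode (F @ [[Pos n]])))"
    if s1: "sc s1 vM = length F" "itape s1 = fcode F" "ar s1 4 = (\<lambda>_. 0)" "sc s1 vP = 0" "sc s1 vOne = 1"
      "sc s1 vN = n" for s1
  proof (rule tri_seq'[OF loop[OF s1(1-5)]])
    fix s' assume Q: "ar s' 4 = tape (fcode F) \<and> sc s' vP = length (fcode F)"
      and fr: "frame (ForC vC vM READ_CLAUSE) s1 s'"
    have s': "sc s' vN = n" "sc s' vOne = 1" "sc s' vM = length F"
      using fr s1 by (simp_all add: frame_def READ_CLAUSE_def)
    define a where "a = tape (fcode F)"
    show "tri M ?rest s' (6 + length F * (5 + 4 * K) - (1 + length F * (5 + 4 * K))) (\<lambda>s'. sc s' vN = n \<and> sc s' vOne = 1 \<and>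
        sc s' vM1 = length F + 1 \<and> ar s' 4 = tape (fcode (F @ [[Pos n]])))"
      unfolding fin a_def[symmetric]
      using s' Q[folded a_def] assms(4-7) by (simp add: tri_simps budget mult_2)
  qed simp
  show ?thesis
    unfolding READ_CNF_def using assms(1,2,6,7)
    by (auto simp: tri_simps budget encode_cnf_eq intro!: tri_conseq[OF rest])
qed

section \<open>Emitting the code of the circuit, gate by gate\<close>

definition emit :: "nat \<Rightarrow> st \<Rightarrow> st" where
  "emit v s = setx vIp (sc s vIp + sc s vOne) (seta 1 (sc s vIp) v s)"

definition EMIT :: "nat \<Rightarrow> com" where
  "EMIT x = PutC 1 vIp x ;; AddC vIp vIp vOne"

lemma tri_EMIT:
  "tri M (EMIT x) s k Q \<longleftrightarrow> 2 \<le> k \<and> sc s vIp + sc s vOne \<le> M \<and> Q (emit (sc s x) s)"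
  "tri M (EMIT x ;; c) s k Q \<longleftrightarrow> 2 \<le> k \<and> sc s vIp + sc s vOne \<le> M \<and> tri M c (emit (sc s x) s) (k - 2) Q"
  by (auto simp: EMIT_def tri_def emit_def)

lemma EMIT_wr [simp]: "wsc (EMIT x) = {vIp}" "war (EMIT x) = {1}" "no_print (EMIT x)" "wfc (EMIT x)"
  by (auto simp: EMIT_def regions_def)

lemma emit_simps [simp]:
  "sc (emit v s) = (sc s)(vIp := sc s vIp + sc s vOne)"
  "r \<noteq> 1 \<Longrightarrow> ar (emit v s) r = ar s r"
  "itape (emit v s) = itape s" "otape (emit v s) = otape s"
  by (simp_all add: emit_def)

definition emitted :: "st \<Rightarrow> nat list \<Rightarrow> bool" where
  "emitted s xs \<longleftrightarrow> ar s 1 = tape xs \<and> sc s vIp = length xs"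

text \<open>A separate name for appending one number protects the emitted list from the simplifier's
  normalisation of \<open>@\<close>.\<close>

definition snoc :: "nat list \<Rightarrow> nat \<Rightarrow> nat list" where
  "snoc xs a = xs @ [a]"

lemma emitted_setx [simp]: "x \<noteq> vIp \<Longrightarrow> emitted (setx x v s) xs = emitted s xs"
  by (simp add: emitted_def)

lemma emitted_emit [simp]:
  "emitted s xs \<Longrightarrow> sc s vOne = 1 \<Longrightarrow> emitted (emit v s) (snoc xs v)"
  by (simp add: emitted_def emit_def tape_snoc snoc_def)

lemma emitted_frame: "frame c s s' \<Longrightarrow> 1 \<notin> war c \<Longrightarrow> vIp \<notin> wsc c \<Longrightarrow> emitted s' = emitted s"
  by (simp add: frame_def emitted_def fun_eq_iff)

lemma emitted_Ip: "emitted s xs \<Longrightarrow> sc s vIp = length xs"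
  by (simp add: emitted_def)

lemma EVAL_CLAUSE_wr [simp]: "wsc (EVAL_CLAUSE r) = {vLen, vP, vAcc, vJ, vL, vT, vU}" "war (EVAL_CLAUSE r) = {}" "no_print (EVAL_CLAUSE r)"
  "wfc (EVAL_CLAUSE r) \<longleftrightarrow> r \<in> regions"
  by (auto simp: EVAL_CLAUSE_def regions_def)

lemma NEXT_ASSIGNMENT_wr [simp]: "wsc (NEXT_ASSIGNMENT r lo len) = {vCarry, vI, vE, vT}" "war (NEXT_ASSIGNMENT r lo len) = {r}" "no_print (NEXT_ASSIGNMENT r lo len)"
  "wfc (NEXT_ASSIGNMENT r lo len) \<longleftrightarrow> r \<in> regions \<and> len \<notin> {vCarry, vI, vE, vT}"
  by (auto simp: NEXT_ASSIGNMENT_def)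

text \<open>All assignments look at the same clause, hence \<open>vP\<close> is reset from
  \<open>vQ\<close> each time. \<open>vA\<close> holds \<open>2 * \<alpha>\<close>, and adding the
  falsification bit chooses between the dummy input and the proper one without a
  conditional.\<close>

definition GATE1 :: com where
  "GATE1 = AddC vP vQ vZero ;; EVAL_CLAUSE 5 ;; AddC vT vA vU ;; EMIT vT ;; AddC vA vA vOne ;;
     AddC vA vA vOne ;; NEXT_ASSIGNMENT 5 vZero vH"

text \<open>The first three numbers are the dummy gate with its single in-neighbour 0, the next two
  the name and in-degree of the clause gate. At the end \<open>vQ\<close> moves on by the length of
  the clause plus 1 for its length field.\<close>

definition CLAUSE_GATES :: com where
  "CLAUSE_GATES = EMIT vV ;; EMIT vOne ;; EMIT vZero ;; AddC vV vV vOne ;; EMIT vV ;; EMIT vN1 ;; SetC vA 0 ;;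
     ForC vAl vN1 GATE1 ;; AddC vV vV vOne ;; GetC vT 4 vQ ;; AddC vQ vQ vT ;; AddC vQ vQ vOne"

text \<open>Here the assignment is fixed and the clauses vary, so \<open>vP\<close> simply runs on
  through the formula.\<close>

definition GATE2 :: com where
  "GATE2 = EVAL_CLAUSE 6 ;; AddC vT vA vU ;; EMIT vT ;; AddC vA vA vOne ;; AddC vA vA vOne"

definition OUTPUT_GATE :: com where
  "OUTPUT_GATE = EMIT vV ;; EMIT vM1 ;; SetC vP 0 ;; AddC vA vN1 vN1 ;; ForC vAl vM1 GATE2 ;;
     NEXT_ASSIGNMENT 6 vH vG ;; AddC vV vV vOne"

lemma GATE1_wr [simp]:
  "wsc GATE1 = {vP, vLen, vAcc, vJ, vL, vT, vU, vIp, vA, vCarry, vI, vE}" "war GATE1 = {1, 5}" "no_print GATE1" "wfc GATE1"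
  by (auto simp: GATE1_def regions_def)

lemma GATE2_wr [simp]:
  "wsc GATE2 = {vP, vLen, vAcc, vJ, vL, vT, vU, vIp, vA}" "war GATE2 = {1}" "no_print GATE2" "wfc GATE2"
  by (auto simp: GATE2_def regions_def)

lemma CLAUSE_GATES_wr [simp]:
  "wsc CLAUSE_GATES = {vP, vLen, vAcc, vJ, vL, vT, vU, vIp, vA, vCarry, vI, vE, vV, vAl, vQ}" "war CLAUSE_GATES = {1, 5}"
  "no_print CLAUSE_GATES" "wfc CLAUSE_GATES"
  by (auto simp: CLAUSE_GATES_def regions_def)

lemma OUTPUT_GATE_wr [simp]:
  "wsc OUTPUT_GATE = {vP, vLen, vAcc, vJ, vL, vT, vU, vIp, vA, vCarry, vI, vE, vV, vAl}" "war OUTPUT_GATE = {1, 6}"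
  "no_print OUTPUT_GATE" "wfc OUTPUT_GATE"
  by (auto simp: OUTPUT_GATE_def regions_def)

text \<open>Literals of the other half count as false, so a clause is falsified by a full assignment
  exactly if both of its halves give the value 1; this product form is what a circuit of depth two
  can exploit.\<close>

definition falsified :: "nat \<Rightarrow> nat \<Rightarrow> nat \<Rightarrow> literal list \<Rightarrow> nat \<Rightarrow> nat" where
  "falsified lo len n c \<alpha> = 1 - (\<Sum>l\<leftarrow>c. lval lo len n \<alpha> (encode_literal l))"

lemma falsified_le: "falsified lo len n c \<alpha> \<le> 1"
  by (simp add: falsified_def)

lemma tri_GATE1:
  assumes c: "c < length Cs" and Cs: "ar s 4 = tape (fcode Cs)" "sc s vQ = length (fcode (take c Cs))"
    and s: "sc s vOne = 1" "sc s vZero = 0" "sc s vH = h" "h \<le> n" "sc s vA = 2 * \<alpha>"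
      "ar s 5 = lval 0 h n \<alpha>" "emitted s xs"
    and M: "length xs < M" "length (fcode Cs) \<le> M" "2 * n + 2 \<le> M" "2 * \<alpha> + 2 \<le> M"
    and k: "length (Cs ! c) \<le> K" "13 + 5 * K + 12 * h \<le> k"
  shows "tri M GATE1 s k (\<lambda>s'. sc s' vA = 2 * Suc \<alpha> \<and> ar s' 5 = lval 0 h n (Suc \<alpha>) \<and>
    emitted s' (xs @ [2 * \<alpha> + falsified 0 h n (Cs ! c) \<alpha>]))"
proof -
  let ?q = "length (fcode (take c Cs))" and ?u = "falsified 0 h n (Cs ! c) \<alpha>"
  let ?Q = "\<lambda>s'. sc s' vA = 2 * Suc \<alpha> \<and> ar s' 5 = lval 0 h n (Suc \<alpha>) \<and> emitted s' (xs @ [2 * \<alpha> + ?u])"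
  have len: "?q + 1 + length (Cs ! c) \<le> length (fcode Cs)"
    using arg_cong[OF fcode_split[OF c], of length] by simp
  have inc: "tri M (NEXT_ASSIGNMENT 5 vZero vH) s2 (2 + 12 * h) ?Q"
    if "sc s2 vA = 2 * Suc \<alpha>" "ar s2 5 = lval 0 h n \<alpha>" "emitted s2 (snoc xs (2 * \<alpha> + ?u))"
      "sc s2 vOne = 1" "sc s2 vZero = 0" "sc s2 vH = h" for s2
  proof (rule tri_conseq[OF tri_NEXT_ASSIGNMENT])
    fix s' assume "ar s' 5 = lval (sc s2 vZero) (sc s2 vH) n (Suc \<alpha>)" "frame (NEXT_ASSIGNMENT 5 vZero vH) s2 s'"
    then show "?Q s'"
      using that emitted_frame[of "NEXT_ASSIGNMENT 5 vZero vH" s2 s'] by (simp add: snoc_def frame_def)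
  qed (use that s M in simp_all)
  have ev: "tri M (EVAL_CLAUSE 5) (setx vP ?q s) (5 + 5 * K) (\<lambda>s'. sc s' vU = ?u)"
  proof (rule tri_conseq)
    show "tri M (EVAL_CLAUSE 5) (setx vP ?q s) (5 + 5 * length (Cs ! c)) (\<lambda>s'.
      sc s' vU = 1 - (\<Sum>l\<leftarrow>Cs ! c. lval 0 h n \<alpha> (encode_literal l)) \<and> sc s' vP = ?q + 1 + length (Cs ! c))"
      by (rule tri_EVAL_CLAUSE) (use Cs s M len fcode_split[OF c] in \<open>simp_all add: lval_le[simplified]\<close>)
  qed (use k in \<open>auto simp: falsified_def\<close>)
  have u: "2 * \<alpha> + ?u \<le> M"
    using falsified_le[of 0 h n "Cs ! c" \<alpha>] M(4) by linarith
  have "tri M (EVAL_CLAUSE 5 ;; AddC vT vA vU ;; EMIT vT ;; AddC vA vA vOne ;; AddC vA vA vOne ;;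
      NEXT_ASSIGNMENT 5 vZero vH) (setx vP ?q s) (k - 1) ?Q"
  proof (rule tri_seq'[OF ev])
    fix s1 assume U: "sc s1 vU = ?u" and fr: "frame (EVAL_CLAUSE 5) (setx vP ?q s) s1"
    have e: "emitted s1 xs"
      using s(7) emitted_frame[OF fr] by simp
    have s1: "sc s1 vOne = 1" "sc s1 vZero = 0" "sc s1 vH = h" "sc s1 vA = 2 * \<alpha>" "ar s1 5 = lval 0 h n \<alpha>"
      using fr s by (simp_all add: frame_def)
    show "tri M (AddC vT vA vU ;; EMIT vT ;; AddC vA vA vOne ;; AddC vA vA vOne ;; NEXT_ASSIGNMENT 5 vZero vH) s1
        (k - 1 - (5 + 5 * K)) ?Q"
      using U e s1 emitted_Ip[OF e] u M k
      by (auto simp: tri_simps budget tri_EMIT intro!: tri_conseq[OF inc])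
  qed (use k in simp)
  then show ?thesis
    unfolding GATE1_def using s Cs len M k by (simp add: tri_simps budget)
qed

lemma tri_GATE2:
  assumes c: "c < length Cs" and Cs: "ar s 4 = tape (fcode Cs)" "sc s vP = length (fcode (take c Cs))"
    and s: "sc s vOne = 1" "sc s vA = a" "ar s 6 = lval h g n \<beta>" "emitted s xs"
    and M: "length xs < M" "length (fcode Cs) \<le> M" "a + 2 \<le> M"
    and k: "length (Cs ! c) \<le> K" "10 + 5 * K \<le> k"
  shows "tri M GATE2 s k (\<lambda>s'. sc s' vA = a + 2 \<and> sc s' vP = length (fcode (take (Suc c) Cs)) \<and>
    emitted s' (xs @ [a + falsified h g n (Cs ! c) \<beta>]))"
proof -
  let ?q = "length (fcode (take c Cs))" and ?u = "falsified h g n (Cs ! c) \<beta>"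
  let ?Q = "\<lambda>s'. sc s' vA = a + 2 \<and> sc s' vP = length (fcode (take (Suc c) Cs)) \<and> emitted s' (xs @ [a + ?u])"
  have len: "?q + 1 + length (Cs ! c) \<le> length (fcode Cs)"
    using arg_cong[OF fcode_split[OF c], of length] by simp
  have ev: "tri M (EVAL_CLAUSE 6) s (5 + 5 * K) (\<lambda>s'. sc s' vU = ?u \<and> sc s' vP = length (fcode (take (Suc c) Cs)))"
  proof (rule tri_conseq)
    show "tri M (EVAL_CLAUSE 6) s (5 + 5 * length (Cs ! c)) (\<lambda>s'.
      sc s' vU = 1 - (\<Sum>l\<leftarrow>Cs ! c. lval h g n \<beta> (encode_literal l)) \<and> sc s' vP = ?q + 1 + length (Cs ! c))"
      by (rule tri_EVAL_CLAUSE) (use Cs s M len fcode_split[OF c] in \<open>simp_all add: lval_le[simplified]\<close>)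
  qed (use k c in \<open>auto simp: falsified_def fcode_take_Suc\<close>)
  have u: "a + ?u \<le> M"
    using falsified_le[of h g n "Cs ! c" \<beta>] M(3) by linarith
  show ?thesis
    unfolding GATE2_def
  proof (rule tri_seq'[OF ev])
    fix s1 assume U: "sc s1 vU = ?u \<and> sc s1 vP = length (fcode (take (Suc c) Cs))" and fr: "frame (EVAL_CLAUSE 6) s s1"
    have e: "emitted s1 xs"
      using s(4) emitted_frame[OF fr] by simp
    have s1: "sc s1 vOne = 1" "sc s1 vA = a"
      using fr s by (simp_all add: frame_def)
    show "tri M (AddC vT vA vU ;; EMIT vT ;; AddC vA vA vOne ;; AddC vA vA vOne) s1 (k - (5 + 5 * K)) ?Q"
      using U e s1 emitted_Ip[OF e] u M k by (simp add: tri_simps budget tri_EMIT snoc_def[symmetric])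
  qed (use k in simp)
qed

definition clause_gates :: "nat \<Rightarrow> (nat \<Rightarrow> nat \<Rightarrow> nat) \<Rightarrow> nat \<Rightarrow> nat list" where
  "clause_gates N1 u1 c = [2 * N1 + 2 * c, 1, 0, 2 * N1 + 2 * c + 1, N1] @ map (\<lambda>\<alpha>. 2 * \<alpha> + u1 c \<alpha>) [0..<N1]"

definition output_gate :: "nat \<Rightarrow> nat \<Rightarrow> (nat \<Rightarrow> nat \<Rightarrow> nat) \<Rightarrow> nat \<Rightarrow> nat list" where
  "output_gate N1 m u2 \<beta> = [2 * N1 + 2 * m + \<beta>, m] @ map (\<lambda>c. 2 * N1 + 2 * c + u2 c \<beta>) [0..<m]"

definition circuit_code ::
  "nat \<Rightarrow> nat \<Rightarrow> nat \<Rightarrow> (nat \<Rightarrow> nat \<Rightarrow> nat) \<Rightarrow> (nat \<Rightarrow> nat \<Rightarrow> nat) \<Rightarrow> nat list" where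
  "circuit_code N1 N2 m u1 u2 = [2 * N1, 2 * m + N2] @ concat (map (clause_gates N1 u1) [0..<m]) @
     concat (map (output_gate N1 m u2) [0..<N2]) @ N2 # map (\<lambda>\<beta>. 2 * N1 + 2 * m + \<beta>) [0..<N2]"

lemma length_clause_gates [simp]: "length (clause_gates N1 u1 c) = 5 + N1"
  by (simp add: clause_gates_def)

lemma length_output_gate [simp]: "length (output_gate N1 m u2 \<beta>) = 2 + m"
  by (simp add: output_gate_def)

lemma length_concat_const: "(\<And>x. length (f x) = l) \<Longrightarrow> length (concat (map f xs)) = length xs * l"
  by (induction xs) auto

lemma length_circuit_code: "length (circuit_code N1 N2 m u1 u2) = 3 + m * (5 + N1) + N2 * (2 + m) + N2"
  by (simp add: circuit_code_def length_concat_const[of "clause_gates N1 u1" "5 + N1"]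
      length_concat_const[of "output_gate N1 m u2" "2 + m"])

lemma tri_CLAUSE_GATES:
  assumes c: "c < length Cs" and Cs: "ar s 4 = tape (fcode Cs)" "sc s vQ = length (fcode (take c Cs))"
    and s: "sc s vOne = 1" "sc s vZero = 0" "sc s vH = h" "h \<le> n" "sc s vN1 = 2 ^ h"
      "sc s vV = 2 * 2 ^ h + 2 * c" "ar s 5 = lval 0 h n 0" "emitted s xs"
    and M: "length xs + 5 + 2 ^ h \<le> M" "length (fcode Cs) \<le> M" "2 * n + 2 \<le> M" "2 * 2 ^ h + 2 * c + 2 \<le> M"
    and k: "length (Cs ! c) \<le> K" "17 + 2 ^ h * (14 + 5 * K + 12 * h) \<le> k"
  shows "tri M CLAUSE_GATES s k (\<lambda>s'. sc s' vV = 2 * 2 ^ h + 2 * Suc c \<and> sc s' vQ = length (fcode (take (Suc c) Cs)) \<and>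
    ar s' 5 = lval 0 h n 0 \<and>
    emitted s' (xs @ clause_gates (2 ^ h) (\<lambda>c. falsified 0 h n (Cs ! c)) c))"
proof -
  let ?q = "length (fcode (take c Cs))" and ?v = "2 * 2 ^ h + 2 * c" and ?N = "2 ^ h :: nat"
  let ?u = "\<lambda>\<alpha>. 2 * \<alpha> + falsified 0 h n (Cs ! c) \<alpha>"
  let ?xs = "snoc (snoc (snoc (snoc (snoc xs ?v) 1) 0) (Suc ?v)) ?N"
  let ?Q = "\<lambda>s'. sc s' vV = 2 * 2 ^ h + 2 * Suc c \<and> sc s' vQ = length (fcode (take (Suc c) Cs)) \<and>
    ar s' 5 = lval 0 h n 0 \<and>
    emitted s' (xs @ clause_gates (2 ^ h) (\<lambda>c. falsified 0 h n (Cs ! c)) c)"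
  let ?rest = "AddC vV vV vOne ;; GetC vT 4 vQ ;; AddC vQ vQ vT ;; AddC vQ vQ vOne"
  have len: "?q + 1 + length (Cs ! c) \<le> length (fcode Cs)"
    using arg_cong[OF fcode_split[OF c], of length] by simp
  have get: "ar s 4 ?q = length (Cs ! c)"
    using tape_nth_append[of 0 "clause_code (Cs ! c)" "fcode (take c Cs)" "fcode (drop (Suc c) Cs)"]
    by (simp add: Cs fcode_split[OF c] clause_code_def del: fcode_simps)
  let ?I = "\<lambda>\<alpha> (s' :: st). sc s' vA = 2 * \<alpha> \<and> ar s' 5 = lval 0 h n \<alpha>
      \<and> emitted s' (?xs @ map ?u [0..<\<alpha>])"
  have loop: "tri M (ForC vAl vN1 GATE1) s1 (1 + ?N * (14 + 5 * K + 12 * h))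
    (\<lambda>s'. ar s' 5 = lval 0 h n 0 \<and> emitted s' (?xs @ map ?u [0..<?N]))"
    if s1: "sc s1 vOne = 1" "sc s1 vZero = 0" "sc s1 vH = h" "sc s1 vN1 = ?N" "sc s1 vA = 0"
      "ar s1 4 = tape (fcode Cs)" "sc s1 vQ = ?q" "ar s1 5 = lval 0 h n 0" "emitted s1 ?xs" for s1
  proof (rule tri_ForC_const[where k = "13 + 5 * K + 12 * h" and I = ?I])
    fix \<alpha> s' assume \<alpha>: "\<alpha> < sc s1 vN1" and fr: "frame (ForC vAl vN1 GATE1) s1 s'"
      and I: "?I \<alpha> s'"
    have s': "sc s' vOne = 1" "sc s' vZero = 0" "sc s' vH = h" "ar s' 4 = tape (fcode Cs)" "sc s' vQ = ?q"
      using fr s1 by (simp_all add: frame_def)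
    have \<alpha>': "\<alpha> < ?N"
      using \<alpha> s1 by simp
    have eq: "?xs @ map ?u [0..<Suc \<alpha>] = (?xs @ map ?u [0..<\<alpha>]) @ [?u \<alpha>]"
      by simp
    show "tri M GATE1 (setx vAl \<alpha> s') (13 + 5 * K + 12 * h) (\<lambda>s'. sc s' vA = 2 * Suc \<alpha> \<and>
        ar s' 5 = lval 0 h n (Suc \<alpha>) \<and> emitted s' (?xs @ map ?u [0..<Suc \<alpha>]))"
      unfolding eq
      by (rule tri_GATE1[OF c]) (use s' I s(4) M \<alpha>' k in \<open>simp_all add: snoc_def\<close>)
  next
    fix s' :: st assume I: "sc s' vA = 2 * sc s1 vN1 \<and> ar s' 5 = lval 0 h n (sc s1 vN1) \<and>
      emitted s' (?xs @ map ?u [0..<sc s1 vN1])"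
    then show "ar (setx vAl (sc s1 vN1) s') 5 = lval 0 h n 0 \<and>
        emitted (setx vAl (sc s1 vN1) s') (?xs @ map ?u [0..<?N])"
      \<comment> \<open>After \<open>2 ^ h\<close> increments the counter has wrapped around to
        0.\<close>
      using s1 by (simp add: lval_wrap)
  qed (use s1 in simp_all)
  have body: "tri M (ForC vAl vN1 GATE1 ;; ?rest) s1 (5 + ?N * (14 + 5 * K + 12 * h)) ?Q"
    if s1: "sc s1 vOne = 1" "sc s1 vZero = 0" "sc s1 vH = h" "sc s1 vN1 = ?N" "sc s1 vA = 0"
      "ar s1 4 = tape (fcode Cs)" "sc s1 vQ = ?q" "ar s1 5 = lval 0 h n 0" "emitted s1 ?xs"
      "sc s1 vV = Suc ?v" for s1
  proof (rule tri_seq'[OF loop[OF s1(1-9)]])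
    fix s' assume Q: "ar s' 5 = lval 0 h n 0 \<and> emitted s' (?xs @ map ?u [0..<?N])"
      and fr: "frame (ForC vAl vN1 GATE1) s1 s'"
    have s': "sc s' vOne = 1" "ar s' 4 ?q = length (Cs ! c)" "sc s' vQ = ?q" "sc s' vV = Suc ?v"
      using fr s1 get Cs by (simp_all add: frame_def)
    have eq: "?xs @ map ?u [0..<?N] = xs @ clause_gates (2 ^ h) (\<lambda>c. falsified 0 h n (Cs ! c)) c"
      by (simp add: clause_gates_def snoc_def)
    show "tri M ?rest s' (5 + ?N * (14 + 5 * K + 12 * h) - (1 + ?N * (14 + 5 * K + 12 * h))) ?Q"
      using Q[unfolded eq] s' M len fcode_take_Suc[OF c] by (simp add: tri_simps)
  qed simp
  show ?thesis
    unfolding CLAUSE_GATES_def using s Cs M k emitted_Ip[OF s(8)]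
    by (auto simp: tri_simps budget tri_EMIT intro!: tri_conseq[OF body])
qed

lemma tri_OUTPUT_GATE:
  assumes Cs: "ar s 4 = tape (fcode Cs)" "sc s vM1 = length Cs"
    and s: "sc s vOne = 1" "sc s vH = h" "sc s vG = g" "h + g \<le> n" "sc s vN1 = 2 ^ h"
      "sc s vV = 2 * 2 ^ h + 2 * length Cs + \<beta>" "ar s 6 = lval h g n \<beta>" "emitted s xs"
    and M: "length xs + 2 + length Cs \<le> M" "length (fcode Cs) \<le> M" "2 * n + 2 \<le> M"
      "2 * 2 ^ h + 2 * length Cs + \<beta> + 2 \<le> M"
    and k: "\<And>c. c \<in> set Cs \<Longrightarrow> length c \<le> K" "10 + length Cs * (11 + 5 * K) + 12 * g \<le> k"
  shows "tri M OUTPUT_GATE s k (\<lambda>s'. sc s' vV = 2 * 2 ^ h + 2 * length Cs + Suc \<beta> \<and>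
    ar s' 6 = lval h g n (Suc \<beta>) \<and>
    emitted s' (xs @ output_gate (2 ^ h) (length Cs) (\<lambda>c. falsified h g n (Cs ! c)) \<beta>))"
proof -
  let ?m = "length Cs" and ?N = "2 ^ h :: nat" and ?v = "2 * 2 ^ h + 2 * length Cs + \<beta>"
  let ?u = "\<lambda>c. 2 * ?N + 2 * c + falsified h g n (Cs ! c) \<beta>"
  let ?xs = "snoc (snoc xs ?v) ?m"
  let ?Q = "\<lambda>s'. sc s' vV = 2 * 2 ^ h + 2 * length Cs + Suc \<beta> \<and> ar s' 6 = lval h g n (Suc \<beta>) \<and>
    emitted s' (xs @ output_gate (2 ^ h) (length Cs) (\<lambda>c. falsified h g n (Cs ! c)) \<beta>)"
  let ?I = "\<lambda>c (s' :: st). sc s' vA = 2 * ?N + 2 * c \<and> sc s' vP = length (fcode (take c Cs))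
      \<and> emitted s' (?xs @ map ?u [0..<c])"
  have loop: "tri M (ForC vAl vM1 GATE2) s1 (1 + ?m * (11 + 5 * K))
    (\<lambda>s'. emitted s' (?xs @ map ?u [0..<?m]))"
    if s1: "sc s1 vOne = 1" "sc s1 vM1 = ?m" "sc s1 vA = 2 * ?N" "ar s1 4 = tape (fcode Cs)"
      "sc s1 vP = 0" "ar s1 6 = lval h g n \<beta>" "emitted s1 ?xs" for s1
  proof (rule tri_ForC_const[where k = "10 + 5 * K" and I = ?I])
    fix c s' assume c: "c < sc s1 vM1" and fr: "frame (ForC vAl vM1 GATE2) s1 s'"
      and I: "?I c s'"
    have s': "sc s' vOne = 1" "ar s' 4 = tape (fcode Cs)" "ar s' 6 = lval h g n \<beta>"
      using fr s1 by (simp_all add: frame_def)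
    have c': "c < length Cs"
      using c s1 by simp
    have eq: "?xs @ map ?u [0..<Suc c] = (?xs @ map ?u [0..<c]) @ [?u c]"
      "2 * ?N + 2 * Suc c = 2 * ?N + 2 * c + 2"
      by simp_all
    show "tri M GATE2 (setx vAl c s') (10 + 5 * K) (\<lambda>s'. sc s' vA = 2 * ?N + 2 * Suc c \<and>
        sc s' vP = length (fcode (take (Suc c) Cs)) \<and> emitted s' (?xs @ map ?u [0..<Suc c]))"
      unfolding eq
      by (rule tri_GATE2[OF c', where K = K]) (use s' I M c' k(1) in \<open>simp_all add: snoc_def\<close>)
  qed (use s1 in simp_all)
  have inc: "tri M (NEXT_ASSIGNMENT 6 vH vG ;; AddC vV vV vOne) s1 (3 + 12 * g) ?Q"
    if s1: "sc s1 vOne = 1" "sc s1 vH = h" "sc s1 vG = g" "sc s1 vV = ?v" "ar s1 6 = lval h g n \<beta>"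
      "emitted s1 (?xs @ map ?u [0..<?m])" for s1
  proof (rule tri_seq')
    show "tri M (NEXT_ASSIGNMENT 6 vH vG) s1 (2 + 12 * sc s1 vG) (\<lambda>s'. ar s' 6 = lval (sc s1 vH) (sc s1 vG) n (Suc \<beta>))"
      by (rule tri_NEXT_ASSIGNMENT) (use s1 s(4) M in simp_all)
    fix s' assume t: "ar s' 6 = lval (sc s1 vH) (sc s1 vG) n (Suc \<beta>)" and fr: "frame (NEXT_ASSIGNMENT 6 vH vG) s1 s'"
    have s': "sc s' vOne = 1" "sc s' vV = ?v"
      using fr s1 by (simp_all add: frame_def)
    have eq: "?xs @ map ?u [0..<?m] = xs @ output_gate (2 ^ h) (length Cs) (\<lambda>c. falsified h g n (Cs ! c)) \<beta>"
      by (simp add: output_gate_def snoc_def)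
    have "emitted s' (?xs @ map ?u [0..<?m])"
      using s1 emitted_frame[OF fr] by simp
    then show "tri M (AddC vV vV vOne) s' (3 + 12 * g - (2 + 12 * sc s1 vG)) ?Q"
      using t s1 s' M eq by (simp add: tri_simps)
  qed (use s1 in simp)
  have body: "tri M (ForC vAl vM1 GATE2 ;; NEXT_ASSIGNMENT 6 vH vG ;; AddC vV vV vOne) s1
      (4 + ?m * (11 + 5 * K) + 12 * g) ?Q"
    if s1: "sc s1 vOne = 1" "sc s1 vM1 = ?m" "sc s1 vA = 2 * ?N" "ar s1 4 = tape (fcode Cs)"
      "sc s1 vP = 0" "ar s1 6 = lval h g n \<beta>" "emitted s1 ?xs"
      "sc s1 vH = h" "sc s1 vG = g" "sc s1 vV = ?v" for s1
  proof (rule tri_seq'[OF loop[OF s1(1-7)]])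
    fix s' assume Q: "emitted s' (?xs @ map ?u [0..<?m])" and fr: "frame (ForC vAl vM1 GATE2) s1 s'"
    have s': "sc s' vOne = 1" "sc s' vH = h" "sc s' vG = g" "sc s' vV = ?v" "ar s' 6 = lval h g n \<beta>"
      using fr s1 by (simp_all add: frame_def)
    show "tri M (NEXT_ASSIGNMENT 6 vH vG ;; AddC vV vV vOne) s'
        (4 + ?m * (11 + 5 * K) + 12 * g - (1 + ?m * (11 + 5 * K))) ?Q"
      by (rule tri_conseq[OF inc[OF s' Q]]) simp_all
  qed simp
  show ?thesis
    unfolding OUTPUT_GATE_def using s Cs M k(2) emitted_Ip[OF s(8)]
    by (auto simp: tri_simps budget tri_EMIT intro!: tri_conseq[OF body])
qed

definition WRITE_CIRCUIT :: com where
  "WRITE_CIRCUIT = AddC vV vN1 vN1 ;; EMIT vV ;; AddC vT vM1 vM1 ;; AddC vT vT vN2 ;; EMIT vT ;; SetC vQ 0 ;;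
     ForC vC vM1 CLAUSE_GATES ;; ForC vC vN2 OUTPUT_GATE ;; EMIT vN2 ;;
     ForC vC vN2 (AddC vT vN1 vN1 ;; AddC vT vT vM1 ;; AddC vT vT vM1 ;; AddC vT vT vC ;; EMIT vT)"

lemma WRITE_CIRCUIT_wr [simp]: "vN \<notin> wsc WRITE_CIRCUIT" "vOne \<notin> wsc WRITE_CIRCUIT" "vZero \<notin> wsc WRITE_CIRCUIT" "vN1 \<notin> wsc WRITE_CIRCUIT" "2 \<notin> war WRITE_CIRCUIT"
  "no_print WRITE_CIRCUIT" "wfc WRITE_CIRCUIT"
  by (auto simp: WRITE_CIRCUIT_def)

text \<open>The terms are the header, the loop over the clauses, the loop over the assignments of
  the second half, and the final list of outputs. Neither loop is nested in the other, so the total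
  is \<open>2 ^ h + 2 ^ g\<close> up to polynomial factors.\<close>

definition gen_steps :: "nat \<Rightarrow> nat \<Rightarrow> nat \<Rightarrow> nat \<Rightarrow> nat" where
  "gen_steps m K h g = 13 + m * (18 + 2 ^ h * (14 + 5 * K + 12 * h)) +
     2 ^ g * (11 + m * (11 + 5 * K) + 12 * g) + 2 ^ g * 7"

lemma tri_WRITE_CIRCUIT:
  assumes Cs: "ar s 4 = tape (fcode Cs)" "sc s vM1 = length Cs"
    and s: "sc s vOne = 1" "sc s vZero = 0" "sc s vH = h" "sc s vG = g" "h + g \<le> n"
      "sc s vN1 = 2 ^ h" "sc s vN2 = 2 ^ g"
      "ar s 5 = lval 0 h n 0" "ar s 6 = lval h g n 0" "emitted s []"
    and w: "w = circuit_code (2 ^ h) (2 ^ g) (length Cs) (\<lambda>c. falsified 0 h n (Cs ! c))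
      (\<lambda>c. falsified h g n (Cs ! c))"
    and M: "length w \<le> M" "length (fcode Cs) \<le> M" "2 * n + 2 \<le> M"
      "2 * 2 ^ h + 2 * length Cs + 2 ^ g + 2 \<le> M"
    and k: "\<And>c. c \<in> set Cs \<Longrightarrow> length c \<le> K" "gen_steps (length Cs) K h g \<le> k"
  shows "tri M WRITE_CIRCUIT s k (\<lambda>s'. ar s' 1 = tape w)"
proof -
  let ?m = "length Cs" and ?N1 = "2 ^ h :: nat" and ?N2 = "2 ^ g :: nat"
  let ?u1 = "\<lambda>c. falsified 0 h n (Cs ! c)" and ?u2 = "\<lambda>c. falsified h g n (Cs ! c)"
  let ?cg = "clause_gates ?N1 ?u1" and ?og = "output_gate ?N1 ?m ?u2"
  let ?x0 = "snoc (snoc [] (2 * ?N1)) (2 * ?m + ?N2)"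
  let ?x1 = "?x0 @ concat (map ?cg [0..<?m])"
  let ?x2 = "?x1 @ concat (map ?og [0..<?N2])"
  have lc: "length (concat (map ?cg xs)) = length xs * (5 + ?N1)" for xs
    by (simp add: length_concat_const)
  have lo: "length (concat (map ?og xs)) = length xs * (2 + ?m)" for xs
    by (simp add: length_concat_const)
  have lw: "length w = 3 + ?m * (5 + ?N1) + ?N2 * (2 + ?m) + ?N2"
    by (simp add: w length_circuit_code)
  have K: "length (Cs ! c) \<le> K" if "c < ?m" for c
    using that k(1) by simp
  let ?I = "\<lambda>c (s' :: st). sc s' vV = 2 * ?N1 + 2 * c \<and> sc s' vQ = length (fcode (take c
      Cs)) \<and> ar s' 5 = lval 0 h n 0 \<and> emitted s' (?x0 @ concat (map ?cg [0..<c]))"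
  have loop1: "tri M (ForC vC vM1 CLAUSE_GATES) s1 (1 + ?m * (18 + ?N1 * (14 + 5 * K + 12 * h)))
      (\<lambda>s'. sc s' vV = 2 * ?N1 + 2 * ?m \<and> emitted s' ?x1)"
    if s1: "ar s1 4 = tape (fcode Cs)" "sc s1 vM1 = ?m" "sc s1 vOne = 1" "sc s1 vZero = 0" "sc s1 vH = h"
      "sc s1 vN1 = ?N1" "ar s1 5 = lval 0 h n 0" "emitted s1 ?x0" "sc s1 vV = 2 * ?N1" "sc s1 vQ = 0" for s1
  proof (rule tri_ForC_const[where k = "17 + ?N1 * (14 + 5 * K + 12 * h)" and I = ?I])
    fix c s' assume c: "c < sc s1 vM1" and fr: "frame (ForC vC vM1 CLAUSE_GATES) s1 s'"
      and I: "?I c s'"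
    have c': "c < ?m"
      using c s1 by simp
    have s': "ar s' 4 = tape (fcode Cs)" "sc s' vOne = 1" "sc s' vZero = 0" "sc s' vH = h" "sc s' vN1 = ?N1"
      using fr s1 by (simp_all add: frame_def)
    have eq: "?x0 @ concat (map ?cg [0..<Suc c]) = (?x0 @ concat (map ?cg [0..<c])) @ ?cg c"
      by simp
    have "(c + 1) * (5 + ?N1) \<le> ?m * (5 + ?N1)"
      using c' by (intro mult_right_mono) auto
    then have bd: "length (?x0 @ concat (map ?cg [0..<c])) + 5 + ?N1 \<le> M"
      using M(1) lw unfolding length_append lc by (simp add: snoc_def)
    show "tri M CLAUSE_GATES (setx vC c s') (17 + ?N1 * (14 + 5 * K + 12 * h)) (\<lambda>s'. sc s' vV = 2 * ?N1 + 2 * Suc c \<and>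
        sc s' vQ = length (fcode (take (Suc c) Cs)) \<and> ar s' 5 = lval 0 h n 0 \<and>
        emitted s' (?x0 @ concat (map ?cg [0..<Suc c])))"
      unfolding eq
    proof (rule tri_CLAUSE_GATES[OF c', where K = K])
      show "length (?x0 @ concat (map ?cg [0..<c])) + 5 + ?N1 \<le> M"
        by (rule bd)
    qed (use s' I M s(5) c' K[OF c'] in simp_all)
  qed (use s1 in simp_all)
  let ?I = "\<lambda>b (s' :: st). sc s' vV = 2 * ?N1 + 2 * ?m + b \<and> ar s' 6 = lval h g n b \<and>
      emitted s' (?x1 @ concat (map ?og [0..<b]))"
  have loop2: "tri M (ForC vC vN2 OUTPUT_GATE) s1 (1 + ?N2 * (11 + ?m * (11 + 5 * K) + 12 * g))
      (\<lambda>s'. emitted s' ?x2)"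
    if s1: "ar s1 4 = tape (fcode Cs)" "sc s1 vM1 = ?m" "sc s1 vOne = 1" "sc s1 vH = h" "sc s1 vG = g"
      "sc s1 vN1 = ?N1" "ar s1 6 = lval h g n 0" "emitted s1 ?x1" "sc s1 vV = 2 * ?N1 + 2 * ?m"
      "sc s1 vN2 = ?N2" for s1
  proof (rule tri_ForC_const[where k = "10 + ?m * (11 + 5 * K) + 12 * g" and I = ?I])
    fix b s' assume b: "b < sc s1 vN2" and fr: "frame (ForC vC vN2 OUTPUT_GATE) s1 s'"
      and I: "?I b s'"
    have b': "b < ?N2"
      using b s1 by simp
    have s': "ar s' 4 = tape (fcode Cs)" "sc s' vM1 = ?m" "sc s' vOne = 1" "sc s' vH = h" "sc s' vG = g"
        "sc s' vN1 = ?N1"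
      using fr s1 by (simp_all add: frame_def)
    have eq: "?x1 @ concat (map ?og [0..<Suc b]) = (?x1 @ concat (map ?og [0..<b])) @ ?og b"
      by simp
    have "(b + 1) * (2 + ?m) \<le> ?N2 * (2 + ?m)"
      using b' by (intro mult_right_mono) auto
    then have bd: "length (?x1 @ concat (map ?og [0..<b])) + 2 + ?m \<le> M"
      using M(1) lw unfolding length_append lc lo by (simp add: snoc_def)
    show "tri M OUTPUT_GATE (setx vC b s') (10 + ?m * (11 + 5 * K) + 12 * g) (\<lambda>s'. sc s' vV = 2 * ?N1 + 2 * ?m + Suc b \<and>
        ar s' 6 = lval h g n (Suc b) \<and> emitted s' (?x1 @ concat (map ?og [0..<Suc b])))"
      unfolding eq
    proof (rule tri_OUTPUT_GATE[where K = K])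
      show "length (?x1 @ concat (map ?og [0..<b])) + 2 + ?m \<le> M"
        by (rule bd)
    qed (use s' I M s(5) b' k(1) in simp_all)
  qed (use s1 in simp_all)
  let ?out = "AddC vT vN1 vN1 ;; AddC vT vT vM1 ;; AddC vT vT vM1 ;; AddC vT vT vC ;; EMIT vT"
  let ?o = "\<lambda>b. 2 * ?N1 + 2 * ?m + b"
  let ?I = "\<lambda>b (s' :: st). emitted s' (snoc ?x2 ?N2 @ map ?o [0..<b])"
  have loop3: "tri M (ForC vC vN2 ?out) s1 (1 + ?N2 * 7) (\<lambda>s'. ar s' 1 = tape w)"
    if s1: "sc s1 vM1 = ?m" "sc s1 vOne = 1" "sc s1 vN1 = ?N1" "sc s1 vN2 = ?N2" "emitted s1 (snoc ?x2 ?N2)" for s1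
  proof (rule tri_ForC_const[where k = 6 and I = ?I])
    fix b s' assume b: "b < sc s1 vN2" and fr: "frame (ForC vC vN2 ?out) s1 s'"
      and I: "?I b s'"
    have b': "b < ?N2"
      using b s1 by simp
    have s': "sc s' vM1 = ?m" "sc s' vOne = 1" "sc s' vN1 = ?N1"
      using fr s1 by (simp_all add: frame_def)
    have eq: "snoc ?x2 ?N2 @ map ?o [0..<Suc b] = snoc (snoc ?x2 ?N2 @ map ?o [0..<b]) (?o b)"
      by (simp add: snoc_def)
    define y where "y = snoc ?x2 ?N2 @ map ?o [0..<b]"
    have "length y = 3 + ?m * (5 + ?N1) + ?N2 * (2 + ?m) + b"
      unfolding y_def snoc_def length_append lc lo by simp
    then have bd: "length y < M"
      using M(1) lw b' by simp
    show "tri M ?out (setx vC b s') 6 (\<lambda>s'. emitted s' (snoc ?x2 ?N2 @ map ?o [0..<Suc b]))"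
      unfolding eq y_def[symmetric]
      using s' I[folded y_def] emitted_Ip[OF I[folded y_def]] bd M(4) b'
      by (simp add: tri_simps tri_EMIT mult_2 add.assoc)
  next
    fix s' :: st assume I: "emitted s' (snoc ?x2 ?N2 @ map ?o [0..<sc s1 vN2])"
    have "snoc ?x2 ?N2 @ map ?o [0..<?N2] = w"
      by (simp add: w circuit_code_def snoc_def)
    then show "ar (setx vC (sc s1 vN2) s') 1 = tape w"
      using I s1 by (simp add: emitted_def)
  qed (use s1 in simp_all)
  let ?r3 = "EMIT vN2 ;; ForC vC vN2 ?out"
  have r3: "tri M ?r3 s1 (3 + ?N2 * 7) (\<lambda>s'. ar s' 1 = tape w)"
    if s1: "sc s1 vM1 = ?m" "sc s1 vOne = 1" "sc s1 vN1 = ?N1" "sc s1 vN2 = ?N2" "emitted s1 ?x2" for s1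
  proof -
    have "length ?x2 = 2 + ?m * (5 + ?N1) + ?N2 * (2 + ?m)"
      unfolding snoc_def length_append lc lo by simp
    then have bd: "length ?x2 < M"
      using M(1) lw by simp
    then show ?thesis
      using s1 emitted_Ip[OF s1(5)] unfolding tri_EMIT
      by (intro conjI tri_conseq[OF loop3]) (simp_all add: budget del: length_append)
  qed
  let ?r2 = "ForC vC vN2 OUTPUT_GATE ;; ?r3"
  have r2: "tri M ?r2 s1 (4 + ?N2 * (11 + ?m * (11 + 5 * K) + 12 * g) + ?N2 * 7) (\<lambda>s'. ar s' 1 = tape w)"
    if s1: "ar s1 4 = tape (fcode Cs)" "sc s1 vM1 = ?m" "sc s1 vOne = 1" "sc s1 vH = h" "sc s1 vG = g"
      "sc s1 vN1 = ?N1" "ar s1 6 = lval h g n 0" "emitted s1 ?x1" "sc s1 vV = 2 * ?N1 + 2 * ?m"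
      "sc s1 vN2 = ?N2" for s1
  proof (rule tri_seq'[OF loop2[OF s1]])
    fix s' assume Q: "emitted s' ?x2" and fr: "frame (ForC vC vN2 OUTPUT_GATE) s1 s'"
    have s': "sc s' vM1 = ?m" "sc s' vOne = 1" "sc s' vN1 = ?N1" "sc s' vN2 = ?N2"
      using fr s1 by (simp_all add: frame_def)
    show "tri M ?r3 s' (4 + ?N2 * (11 + ?m * (11 + 5 * K) + 12 * g) + ?N2 * 7 -
        (1 + ?N2 * (11 + ?m * (11 + 5 * K) + 12 * g))) (\<lambda>s'. ar s' 1 = tape w)"
      by (rule tri_conseq[OF r3[OF s' Q]]) simp_all
  qed simp
  let ?r1 = "ForC vC vM1 CLAUSE_GATES ;; ?r2"
  have r1: "tri M ?r1 s1 (gen_steps ?m K h g - 8) (\<lambda>s'. ar s' 1 = tape w)"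
    if s1: "ar s1 4 = tape (fcode Cs)" "sc s1 vM1 = ?m" "sc s1 vOne = 1" "sc s1 vZero = 0" "sc s1 vH = h"
      "sc s1 vN1 = ?N1" "ar s1 5 = lval 0 h n 0" "emitted s1 ?x0" "sc s1 vV = 2 * ?N1" "sc s1 vQ = 0"
      "sc s1 vG = g" "ar s1 6 = lval h g n 0" "sc s1 vN2 = ?N2" for s1
  proof (rule tri_seq'[OF loop1[OF s1(1-10)]])
    fix s' assume Q: "sc s' vV = 2 * ?N1 + 2 * ?m \<and> emitted s' ?x1" and fr: "frame (ForC vC vM1 CLAUSE_GATES) s1 s'"
    have s': "ar s' 4 = tape (fcode Cs)" "sc s' vM1 = ?m" "sc s' vOne = 1" "sc s' vH = h" "sc s' vG = g"
      "sc s' vN1 = ?N1" "ar s' 6 = lval h g n 0" "sc s' vN2 = ?N2"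
      using fr s1 by (simp_all add: frame_def)
    show "tri M ?r2 s' (gen_steps ?m K h g - 8 -
        (1 + ?m * (18 + ?N1 * (14 + 5 * K + 12 * h)))) (\<lambda>s'. ar s' 1 = tape w)"
      by (rule tri_conseq[OF r2]) (use s' Q in \<open>simp_all add: gen_steps_def\<close>)
  qed (simp add: gen_steps_def)
  have "8 \<le> gen_steps ?m K h g" "2 \<le> length w"
    by (simp_all add: gen_steps_def lw)
  then show ?thesis
    unfolding WRITE_CIRCUIT_def using s Cs M k(2) emitted_Ip[OF s(10)]
    by (auto simp: tri_simps budget tri_EMIT mult_2 intro!: tri_conseq[OF r1])
qed

section \<open>The first program: from the formula to the code of its OR-circuit\<close>

definition PROG1 :: com where
  "PROG1 = READ_CNF ;; HALVE ;; POW vN1 vH ;; POW vN2 vG ;; INIT_TABLE 5 vZero vH ;; INIT_TABLE 6 vH vG ;; WRITE_CIRCUIT"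

lemma READ_CLAUSE_wr [simp]: "wsc READ_CLAUSE = {vLen, vP, vJ, vL}" "war READ_CLAUSE = {4}" "no_print READ_CLAUSE" "wfc READ_CLAUSE"
  by (auto simp: READ_CLAUSE_def regions_def)

lemma READ_CNF_wr [simp]: "wsc READ_CNF = {vN, vM, vOne, vP, vC, vLen, vJ, vL, vT, vM1}" "war READ_CNF = {4}" "no_print READ_CNF" "wfc READ_CNF"
  by (auto simp: READ_CNF_def regions_def)

lemma HALVE_wr [simp]: "wsc HALVE = {vH, vG, vI, vT}" "war HALVE = {}" "wfc HALVE" "no_print HALVE"
  by (auto simp: HALVE_def)

lemma POW_wr [simp]: "wsc (POW x y) = {x, vI}" "war (POW x y) = {}" "no_print (POW x y)"
  "wfc (POW x y) \<longleftrightarrow> x \<noteq> vI \<and> y \<noteq> vI \<and> x \<noteq> y"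
  by (auto simp: POW_def)

lemma INIT_TABLE_wr [simp]: "wsc (INIT_TABLE r lo len) = {vI, vE}" "war (INIT_TABLE r lo len) = {r}" "no_print (INIT_TABLE r lo len)"
  "wfc (INIT_TABLE r lo len) \<longleftrightarrow> r \<in> regions \<and> len \<noteq> vI \<and> len \<noteq> vE"
  by (auto simp: INIT_TABLE_def)

lemma PROG1_wr [simp]: "wfc PROG1" "no_print PROG1"
  by (auto simp: PROG1_def regions_def)

text \<open>In the linear terms both halves of \<open>n\<close> are estimated by \<open>n\<close>
  itself; only the exponential part needs the exact halves.\<close>

definition prog1_steps :: "nat \<Rightarrow> nat \<Rightarrow> nat" where
  "prog1_steps n m = 10 + m * (5 + 4 * (2 * n + 1)) + (3 + 4 * n) + (2 + 2 * n) + (2 + 2 * n) +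
     (3 + 5 * n) + (3 + 5 * n) + gen_steps (m + 1) (2 * n + 1) (n div 2) (n - n div 2)"

lemma tri_PROG1:
  fixes n :: nat and F :: cnf
  defines "h \<equiv> n div 2" and "g \<equiv> n - n div 2" and "Cs \<equiv> F @ [[Pos n]]"
  assumes s: "itape s = encode_cnf n F" "sc s = (\<lambda>_. 0)" "ar s = (\<lambda>_ _. 0)"
    and w: "w = circuit_code (2 ^ h) (2 ^ g) (length Cs) (\<lambda>c. falsified 0 h n (Cs ! c))
      (\<lambda>c. falsified h g n (Cs ! c))"
    and K: "\<And>c. c \<in> set F \<Longrightarrow> length c \<le> 2 * n + 1"
    and M: "length w \<le> M" "length (fcode Cs) \<le> M" "2 * n + 2 \<le> M"
      "2 * 2 ^ h + 2 * length Cs + 2 ^ g + 2 \<le> M"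
  shows "tri M PROG1 s (prog1_steps n (length F)) (\<lambda>s'. ar s' 1 = tape w \<and> sc s' vN = n \<and> sc s' vOne = 1 \<and>
    sc s' vZero = 0 \<and> sc s' vN1 = 2 ^ h \<and> ar s' 2 = (\<lambda>_. 0))"
proof -
  let ?Q = "\<lambda>s'. ar s' 1 = tape w \<and> sc s' vN = n \<and> sc s' vOne = 1 \<and>
    sc s' vZero = 0 \<and> sc s' vN1 = 2 ^ h \<and> ar s' 2 = (\<lambda>_. 0)"
  let ?f = "tape (fcode Cs)" and ?z = "\<lambda>_. 0 :: nat"
  have hg: "h \<le> n" "g \<le> n" "h + g = n"
    by (simp_all add: h_def g_def)
  have nh: "n - h = g"
    using hg by simp
  have pow: "2 ^ h \<le> M" "2 ^ g \<le> M"
    using M(4) by linarith+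
  have "tri M PROG1 s ((10 + length F * (5 + 4 * (2 * n + 1))) + ((3 + 4 * n) + ((2 + 2 * h) + ((2 + 2 * g) +
     ((3 + 5 * h) + ((3 + 5 * g) + gen_steps (length Cs) (2 * n + 1) h g)))))) ?Q"
    unfolding PROG1_def
  proof (rule tri_seq)
    show "tri M READ_CNF s (10 + length F * (5 + 4 * (2 * n + 1))) (\<lambda>s'. sc s' vN = n \<and> sc s' vOne = 1 \<and>
        sc s' vM1 = length F + 1 \<and> ar s' 4 = tape (fcode (F @ [[Pos n]])))"
      by (rule tri_READ_CNF[where K = "2 * n + 1"]) (use s K M in \<open>simp_all add: Cs_def\<close>)
    fix s1 assume Q1: "sc s1 vN = n \<and> sc s1 vOne = 1 \<and> sc s1 vM1 = length F + 1 \<and>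
      ar s1 4 = tape (fcode (F @ [[Pos n]]))" and fr1: "frame READ_CNF s s1"
    have s1: "sc s1 vN = n" "sc s1 vOne = 1" "sc s1 vM1 = length Cs" "ar s1 4 = ?f" "sc s1 vZero = 0"
      "ar s1 1 = ?z" "ar s1 2 = ?z" "ar s1 5 = ?z" "ar s1 6 = ?z" "sc s1 vIp = 0"
      using Q1 fr1 s by (simp_all add: frame_def Cs_def)
    show "tri M (HALVE ;; POW vN1 vH ;; POW vN2 vG ;; INIT_TABLE 5 vZero vH ;; INIT_TABLE 6 vH vG ;; WRITE_CIRCUIT) s1
      ((3 + 4 * n) + ((2 + 2 * h) + ((2 + 2 * g) +
        ((3 + 5 * h) + ((3 + 5 * g) + gen_steps (length Cs) (2 * n + 1) h g))))) ?Q"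
    proof (rule tri_seq)
      show "tri M HALVE s1 (3 + 4 * n) (\<lambda>s'. sc s' vH = n div 2 \<and> sc s' vG = n - n div 2)"
        by (rule tri_HALVE) (use s1 M in simp_all)
      fix s2 assume "sc s2 vH = n div 2 \<and> sc s2 vG = n - n div 2" "frame HALVE s1 s2"
      then have s2: "sc s2 vN = n" "sc s2 vOne = 1" "sc s2 vM1 = length Cs" "ar s2 4 = ?f" "sc s2 vZero = 0"
        "ar s2 1 = ?z" "ar s2 2 = ?z" "ar s2 5 = ?z" "ar s2 6 = ?z" "sc s2 vIp = 0" "sc s2 vH = h" "sc s2 vG = g"
        using s1 by (simp_all add: frame_def h_def g_def)
      show "tri M (POW vN1 vH ;; POW vN2 vG ;; INIT_TABLE 5 vZero vH ;; INIT_TABLE 6 vH vG ;; WRITE_CIRCUIT) s2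
        ((2 + 2 * h) + ((2 + 2 * g) +
          ((3 + 5 * h) + ((3 + 5 * g) + gen_steps (length Cs) (2 * n + 1) h g)))) ?Q"
      proof (rule tri_seq)
        show "tri M (POW vN1 vH) s2 (2 + 2 * h) (\<lambda>s'. sc s' vN1 = 2 ^ h)"
          using tri_POW[of vN1 vH s2 M] pow s2 by simp
        fix s3 assume "sc s3 vN1 = 2 ^ h" "frame (POW vN1 vH) s2 s3"
        then have s3: "sc s3 vN = n" "sc s3 vOne = 1" "sc s3 vM1 = length Cs" "ar s3 4 = ?f" "sc s3 vZero = 0"
          "ar s3 1 = ?z" "ar s3 2 = ?z" "ar s3 5 = ?z" "ar s3 6 = ?z" "sc s3 vIp = 0" "sc s3 vH = h" "sc s3 vG = g"
          "sc s3 vN1 = 2 ^ h"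
          using s2 by (simp_all add: frame_def)
        show "tri M (POW vN2 vG ;; INIT_TABLE 5 vZero vH ;; INIT_TABLE 6 vH vG ;; WRITE_CIRCUIT) s3
          ((2 + 2 * g) + ((3 + 5 * h) + ((3 + 5 * g) + gen_steps (length Cs) (2 * n + 1) h g))) ?Q"
        proof (rule tri_seq)
          show "tri M (POW vN2 vG) s3 (2 + 2 * g) (\<lambda>s'. sc s' vN2 = 2 ^ g)"
            using tri_POW[of vN2 vG s3 M] pow s3 by simp
          fix s4 assume "sc s4 vN2 = 2 ^ g" "frame (POW vN2 vG) s3 s4"
          then have s4: "sc s4 vN = n" "sc s4 vOne = 1" "sc s4 vM1 = length Cs" "ar s4 4 = ?f" "sc s4 vZero = 0"
            "ar s4 1 = ?z" "ar s4 2 = ?z" "ar s4 5 = ?z" "ar s4 6 = ?z" "sc s4 vIp = 0" "sc s4 vH = h"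
            "sc s4 vG = g" "sc s4 vN1 = 2 ^ h" "sc s4 vN2 = 2 ^ g"
            using s3 by (simp_all add: frame_def)
          show "tri M (INIT_TABLE 5 vZero vH ;; INIT_TABLE 6 vH vG ;; WRITE_CIRCUIT) s4
            ((3 + 5 * h) + ((3 + 5 * g) + gen_steps (length Cs) (2 * n + 1) h g)) ?Q"
          proof (rule tri_seq)
            show "tri M (INIT_TABLE 5 vZero vH) s4 (3 + 5 * h) (\<lambda>s'. ar s' 5 = lval 0 h n 0)"
              using tri_INIT_TABLE[of vZero vH s4 n 5 M] s4 hg M by simp
            fix s5 assume "ar s5 5 = lval 0 h n 0" "frame (INIT_TABLE 5 vZero vH) s4 s5"
            then have s5: "sc s5 vN = n" "sc s5 vOne = 1" "sc s5 vM1 = length Cs" "ar s5 4 = ?f" "sc s5 vZero = 0"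
              "ar s5 1 = ?z" "ar s5 2 = ?z" "ar s5 5 = lval 0 h n 0" "ar s5 6 = ?z" "sc s5 vIp = 0" "sc s5 vH = h"
              "sc s5 vG = g" "sc s5 vN1 = 2 ^ h" "sc s5 vN2 = 2 ^ g"
              using s4 by (simp_all add: frame_def)
            show "tri M (INIT_TABLE 6 vH vG ;; WRITE_CIRCUIT) s5 ((3 + 5 * g) + gen_steps (length Cs) (2 * n + 1) h g) ?Q"
            proof (rule tri_seq)
              show "tri M (INIT_TABLE 6 vH vG) s5 (3 + 5 * g) (\<lambda>s'. ar s' 6 = lval h g n 0)"
                using tri_INIT_TABLE[of vH vG s5 n 6 M] s5 hg M by simp
              fix s6 assume "ar s6 6 = lval h g n 0" "frame (INIT_TABLE 6 vH vG) s5 s6"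
              then have s6: "sc s6 vN = n" "sc s6 vOne = 1" "sc s6 vM1 = length Cs" "ar s6 4 = ?f"
                "sc s6 vZero = 0" "ar s6 1 = ?z" "ar s6 2 = ?z" "ar s6 5 = lval 0 h n 0" "ar s6 6 = lval h g n 0"
                "sc s6 vIp = 0" "sc s6 vH = h" "sc s6 vG = g" "sc s6 vN1 = 2 ^ h" "sc s6 vN2 = 2 ^ g"
                using s5 by (simp_all add: frame_def)
              have "tri M WRITE_CIRCUIT s6 (gen_steps (length Cs) (2 * n + 1) h g) (\<lambda>s'. ar s' 1 = tape w)"
                by (rule tri_WRITE_CIRCUIT[OF _ _ _ _ _ _ _ _ _ _ _ _ w, where K = "2 * n + 1"])
                  (use s6 hg M K in \<open>auto simp: emitted_def Cs_def\<close>)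
              then show "tri M WRITE_CIRCUIT s6 (gen_steps (length Cs) (2 * n + 1) h g) ?Q"
                by (rule tri_conseq) (use s6 in \<open>simp_all add: frame_def\<close>)
            qed
          qed
        qed
      qed
    qed
  qed
  then show ?thesis
    by (rule tri_conseq) (use hg nh in \<open>simp_all add: prog1_steps_def Cs_def flip: h_def g_def\<close>)
qed

section \<open>Evaluating a circuit\<close>

text \<open>
  Gates that reach no output may have astronomically large values in a SUM-circuit, so values are
  cut off at \<open>cap\<close>, the number of inputs set to one; for an XOR-circuit they are reduced modulo 2.
\<close>

definition red :: "bool \<Rightarrow> nat \<Rightarrow> nat \<Rightarrow> nat" where
  "red x cap a = (if x then a mod 2 else min a cap)"

lemma red_red_add: "red x cap (red x cap a + b) = red x cap (a + b)"
  by (auto simp: red_def mod_add_left_eq)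

lemma red_add_red: "red x cap (a + red x cap b) = red x cap (a + b)"
  using red_red_add[of x cap b a] by (simp add: add.commute)

lemma red_0 [simp]: "red x cap 0 = 0"
  by (simp add: red_def)

lemma red_le: "(x \<Longrightarrow> cap = 1) \<Longrightarrow> red x cap a \<le> cap"
proof -
  assume *: "x \<Longrightarrow> cap = 1"
  have "a mod 2 \<le> 1"
    using mod_less_divisor[of 2 a] by linarith
  then show ?thesis
    using * by (simp add: red_def)
qed

text \<open>On natural numbers, truncation at \<open>cap\<close> and reduction modulo 2 are both
  compatible with addition, so reducing at every gate gives the same reduced result as reducing once
  at the end.\<close>

lemma red_sum_list: "red x cap (a + (\<Sum>u\<leftarrow>us. red x cap (f u))) = red x cap (a + (\<Sum>u\<leftarrow>us. f u))"
proof (induction us arbitrary: a)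
  case (Cons u us)
  have "red x cap (a + (red x cap (f u) + (\<Sum>u\<leftarrow>us. red x cap (f u)))) =
      red x cap ((a + red x cap (f u)) + (\<Sum>u\<leftarrow>us. f u))"
    using Cons[of "a + red x cap (f u)"] by (simp add: add.assoc)
  also have "\<dots> = red x cap (a + (\<Sum>u\<leftarrow>us. f u) + red x cap (f u))"
    by (simp add: ac_simps)
  also have "\<dots> = red x cap (a + (f u + (\<Sum>u\<leftarrow>us. f u)))"
    by (subst red_add_red) (simp add: ac_simps)
  finally show ?case
    by simp
qed simp

text \<open>\<open>vT\<close> becomes the excess over the cap. Subtracting it once truncates; if the
  cap is 1 and the sum at most 2, subtracting it twice sends 2 to 0, which is reduction modulo
  2.\<close>

definition REDUCE :: "bool \<Rightarrow> com" where
  "REDUCE x = SubC vT vAcc vCap ;; SubC vAcc vAcc vT ;; SubC vAcc vAcc (if x then vT else vZero)"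

definition ADD_VALUES :: "bool \<Rightarrow> com" where
  "ADD_VALUES x = ForC vJ vLen (GetC vL 2 vP ;; AddC vP vP vOne ;; GetC vT 5 vL ;; AddC vAcc vAcc vT ;; REDUCE x)"

lemma ADD_VALUES_wr [simp]: "wsc (ADD_VALUES x) = {vJ, vL, vP, vT, vAcc}" "war (ADD_VALUES x) = {}" "no_print (ADD_VALUES x)" "wfc (ADD_VALUES x)"
  by (auto simp: ADD_VALUES_def REDUCE_def regions_def)

lemma REDUCE_arith:
  assumes "x \<Longrightarrow> cap = 1" "a \<le> cap" "b \<le> cap"
  shows "a + b - (a + b - cap) - (if x then a + b - cap else 0) = red x cap (a + b)"
proof (cases x)
  case True
  then have "cap = 1" "a = 0 \<or> a = 1" "b = 0 \<or> b = 1"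
    using assms by auto
  then show ?thesis
    using True by (auto simp: red_def)
qed (simp add: red_def)

lemma tri_ADD_VALUES:
  assumes w: "ar s 2 = tape (xs @ us @ ys)" "sc s vP = length xs" "sc s vLen = length us"
    and s: "sc s vOne = 1" "sc s vZero = 0" "sc s vCap = cap" "sc s vAcc = red x cap a"
      "\<And>u. u \<in> set us \<Longrightarrow> ar s 5 u = V u" "\<And>u. u \<in> set us \<Longrightarrow> V u \<le> cap" "x \<Longrightarrow> cap = 1"
    and M: "length xs + length us \<le> M" "2 * cap \<le> M" and k: "1 + 8 * length us \<le> k"
  shows "tri M (ADD_VALUES x) s k (\<lambda>s'. sc s' vAcc = red x cap (a + (\<Sum>u\<leftarrow>us. V u)) \<and>
    sc s' vP = length xs + length us)"
proof -
  let ?body = "GetC vL 2 vP ;; AddC vP vP vOne ;; GetC vT 5 vL ;; AddC vAcc vAcc vT ;; REDUCE x"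
  let ?A = "\<lambda>i. a + (\<Sum>u\<leftarrow>take i us. V u)"
  let ?I = "\<lambda>i (s' :: st). sc s' vAcc = red x cap (?A i) \<and> sc s' vP = length xs + i"
  show ?thesis
    unfolding ADD_VALUES_def
  proof (rule tri_ForC_const[where k = 7 and I = ?I])
    fix i s' assume i: "i < sc s vLen" and fr: "frame (ForC vJ vLen ?body) s s'"
      and I: "?I i s'"
    have i': "i < length us"
      using i w by simp
    have fr': "ar s' = ar s" "sc s' vOne = 1" "sc s' vZero = 0" "sc s' vCap = cap"
      using fr s by (simp_all add: frame_def REDUCE_def fun_eq_iff)
    have u: "ar s 2 (length xs + i) = us ! i" "ar s 5 (us ! i) = V (us ! i)"
      using tape_nth_append[OF i'] w s(5) i' by simp_all
    have le: "red x cap (?A i) \<le> cap" "V (us ! i) \<le> cap"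
      using red_le[OF s(7)] s(6) i' by simp_all
    have new: "red x cap (?A (Suc i)) = red x cap (red x cap (?A i) + V (us ! i))"
      unfolding red_red_add using i' by (simp add: take_Suc_conv_app_nth add.assoc)
    define r where "r = red x cap (?A i)"
    have *: "r + V (us ! i) - (r + V (us ! i) - cap) - (if x then r + V (us ! i) - cap else 0) =
        red x cap (r + V (us ! i))"
      using le s(7) by (intro REDUCE_arith) (auto simp: r_def)
    show "tri M ?body (setx vJ i s') 7 (?I (Suc i))"
      unfolding new r_def[symmetric]
      using I[folded r_def] fr' u le[folded r_def] * i' M
      by (cases x) (simp_all add: tri_simps REDUCE_def)
  qed (use w s k in simp_all)
qed

definition EVAL_GATE :: "bool \<Rightarrow> com" where
  "EVAL_GATE x = GetC vV 2 vP ;; AddC vP vP vOne ;; GetC vLen 2 vP ;; AddC vP vP vOne ;; SetC vAcc 0 ;; ADD_VALUES x ;; PutC 5 vV vAcc"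

lemma EVAL_GATE_wr [simp]: "wsc (EVAL_GATE x) = {vV, vLen, vJ, vL, vP, vT, vAcc}" "war (EVAL_GATE x) = {5}" "no_print (EVAL_GATE x)" "wfc (EVAL_GATE x)"
  by (auto simp: EVAL_GATE_def regions_def)

lemma tri_EVAL_GATE:
  assumes w: "ar s 2 = tape (xs @ (v # length us # us) @ ys)" "sc s vP = length xs"
    and s: "sc s vOne = 1" "sc s vZero = 0" "sc s vCap = cap"
      "\<And>u. u \<in> set us \<Longrightarrow> ar s 5 u = red x cap (val u)" "x \<Longrightarrow> cap = 1"
    and M: "length xs + 2 + length us \<le> M" "2 * cap \<le> M" and k: "7 + 8 * length us \<le> k"
  shows "tri M (EVAL_GATE x) s k (\<lambda>s'. ar s' 5 = (ar s 5)(v := red x cap (\<Sum>u\<leftarrow>us. val u)) \<and>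
    sc s' vP = length xs + 2 + length us)"
proof -
  have g: "ar s 2 (length xs) = v" "ar s 2 (Suc (length xs)) = length us"
    using tape_nth_append[of 0 "v # length us # us" xs ys] tape_nth_append[of 1 "v # length us # us" xs ys] w
    by simp_all
  let ?Q = "\<lambda>s'. ar s' 5 = (ar s 5)(v := red x cap (\<Sum>u\<leftarrow>us. val u)) \<and> sc s' vP = length xs + 2 + length us"
  have body: "tri M (ADD_VALUES x ;; PutC 5 vV vAcc) s1 (2 + 8 * length us) ?Q"
    if s1: "ar s1 2 = ar s 2" "ar s1 5 = ar s 5" "sc s1 vP = length xs + 2" "sc s1 vLen = length us"
      "sc s1 vV = v" "sc s1 vAcc = 0" "sc s1 vOne = 1" "sc s1 vZero = 0" "sc s1 vCap = cap" for s1
  proof (rule tri_seq')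
    have "red x cap (0 + (\<Sum>u\<leftarrow>us. red x cap (val u))) = red x cap (\<Sum>u\<leftarrow>us. val u)"
      unfolding red_sum_list by simp
    moreover have "tri M (ADD_VALUES x) s1 (1 + 8 * length us) (\<lambda>s'. sc s' vAcc =
        red x cap (0 + (\<Sum>u\<leftarrow>us. red x cap (val u))) \<and> sc s' vP = length (xs @ [v, length us]) + length us)"
      by (rule tri_ADD_VALUES[where ys = ys]) (use s1 w s M red_le in \<open>simp_all\<close>)
    ultimately show "tri M (ADD_VALUES x) s1 (1 + 8 * length us) (\<lambda>s'. sc s' vAcc =
        red x cap (\<Sum>u\<leftarrow>us. val u) \<and> sc s' vP = length (xs @ [v, length us]) + length us)"
      by simp
    fix s' assume Q: "sc s' vAcc = red x cap (\<Sum>u\<leftarrow>us. val u) \<and> sc s' vP = length (xs @ [v, length us]) + length us"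
      and fr: "frame (ADD_VALUES x) s1 s'"
    have "ar s' 5 = ar s 5" "sc s' vV = v"
      using fr s1 by (simp_all add: frame_def)
    then show "tri M (PutC 5 vV vAcc) s' (2 + 8 * length us - (1 + 8 * length us)) ?Q"
      using Q by (simp add: tri_simps)
  qed simp
  show ?thesis
    unfolding EVAL_GATE_def using w s(1-3) g M k
    by (auto simp: tri_simps budget intro!: tri_conseq[OF body])
qed

text \<open>Only the odd inputs, those of actual assignments, become one; the dummies get zero, so
  that the matrix entries in their columns are not counted.\<close>

definition SET_INPUTS :: com where
  "SET_INPUTS = SetC vA 0 ;; ForC vI vN1 (PutC 5 vA vZero ;; AddC vA vA vOne ;; PutC 5 vA vOne ;; AddC vA vA vOne)"

lemma tri_SET_INPUTS:
  assumes "sc s vOne = 1" "sc s vZero = 0" "sc s vN1 = N" "2 * N \<le> M"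
  shows "tri M SET_INPUTS s (2 + 5 * N) (\<lambda>s'. \<forall>j < 2 * N. ar s' 5 j = j mod 2)"
proof -
  let ?body = "PutC 5 vA vZero ;; AddC vA vA vOne ;; PutC 5 vA vOne ;; AddC vA vA vOne"
  have "tri M (ForC vI vN1 ?body) (setx vA 0 s) (1 + N * 5) (\<lambda>s'. \<forall>j < 2 * N. ar s' 5 j = j mod 2)"
  proof (rule tri_ForC_const[where k = 4 and
        I = "\<lambda>i s'. sc s' vA = 2 * i \<and> (\<forall>j < 2 * i. ar s' 5 j = j mod 2)"])
    fix i s' assume i: "i < sc (setx vA 0 s) vN1" and fr: "frame (ForC vI vN1 ?body) (setx vA 0 s) s'"
      and I: "sc s' vA = 2 * i \<and> (\<forall>j < 2 * i. ar s' 5 j = j mod 2)"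
    have s': "sc s' vOne = 1" "sc s' vZero = 0"
      using fr assms by (simp_all add: frame_def)
    have "\<forall>j < 2 * Suc i. ((ar s' 5)(2 * i := 0, Suc (2 * i) := 1)) j = j mod 2"
      using I by (auto simp: less_Suc_eq)
    then show "tri M ?body (setx vI i s') 4 (\<lambda>s'. sc s' vA = 2 * Suc i \<and> (\<forall>j < 2 * Suc i. ar s' 5 j = j mod 2))"
      using I s' i assms(3,4) by (simp add: tri_simps)
  qed (use assms in simp_all)
  then show ?thesis
    unfolding SET_INPUTS_def by (simp add: tri_simps mult.commute)
qed

lemma SET_INPUTS_wr [simp]: "wsc SET_INPUTS = {vA, vI}" "war SET_INPUTS = {5}" "no_print SET_INPUTS" "wfc SET_INPUTS"
  by (auto simp: SET_INPUTS_def regions_def)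

definition gate_list :: "(nat \<Rightarrow> nat list) \<Rightarrow> nat list \<Rightarrow> nat list" where
  "gate_list ps vs = concat (map (\<lambda>v. v # length (ps v) # ps v) vs)"

lemma gate_list_simps [simp]: "gate_list ps [] = []"
  "gate_list ps (v # vs) = v # length (ps v) # ps v @ gate_list ps vs"
  "gate_list ps (us @ vs) = gate_list ps us @ gate_list ps vs"
  by (simp_all add: gate_list_def)

lemma length_gate_list: "length (gate_list ps vs) = (\<Sum>i<length vs. 2 + length (ps (vs ! i)))"
  by (simp add: gate_list_def length_concat comp_def sum_list_sum_nth atLeast0LessThan)

text \<open>A code lists the gates in topological order, so one pass suffices: the in-neighbours of
  the \<open>i\<close>-th gate are inputs or already evaluated. The circuit enters only through a
  function \<open>val\<close> that satisfies the gate equations.\<close>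

lemma tri_gates:
  assumes w: "ar s 2 = tape ([a, b] @ gate_list ps vs @ ys)" "sc s vP = 2" "sc s vD = length vs"
    and s: "sc s vOne = 1" "sc s vZero = 0" "sc s vCap = cap" "x \<Longrightarrow> cap = 1"
      "\<And>u. u < N \<Longrightarrow> ar s 5 u = red x cap (val u)"
    and top: "\<And>i. i < length vs \<Longrightarrow> set (ps (vs ! i)) \<subseteq> {..<N} \<union> set (take i vs)"
    and val: "\<And>v. v \<in> set vs \<Longrightarrow> val v = (\<Sum>u\<leftarrow>ps v. val u)"
    and M: "2 + length (gate_list ps vs) \<le> M" "2 * cap \<le> M" and k: "1 + 8 * length (gate_list ps vs) \<le> k"
  shows "tri M (ForC vC vD (EVAL_GATE x)) s k (\<lambda>s'. sc s' vP = 2 + length (gate_list ps vs) \<and>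
    (\<forall>u \<in> {..<N} \<union> set vs. ar s' 5 u = red x cap (val u)))"
proof (rule tri_ForC[where k = "\<lambda>i. 7 + 8 * length (ps (vs ! i))" and
      I = "\<lambda>i s'. sc s' vP = 2 + length (gate_list ps (take i vs)) \<and>
        (\<forall>u \<in> {..<N} \<union> set (take i vs). ar s' 5 u = red x cap (val u))"])
  fix i s' assume i: "i < sc s vD" and fr: "frame (ForC vC vD (EVAL_GATE x)) s s'"
    and I: "sc s' vP = 2 + length (gate_list ps (take i vs)) \<and>
        (\<forall>u \<in> {..<N} \<union> set (take i vs). ar s' 5 u = red x cap (val u))"
  have i': "i < length vs"
    using i w by simp
  let ?v = "vs ! i"
  have vs: "take (Suc i) vs = take i vs @ [?v]" "vs = take i vs @ ?v # drop (Suc i) vs"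
    using i' by (simp_all add: take_Suc_conv_app_nth id_take_nth_drop)
  have gl: "gate_list ps vs = gate_list ps (take i vs) @ (?v # length (ps ?v) # ps ?v) @ gate_list ps (drop (Suc i) vs)"
    by (subst vs(2)) simp
  have s': "ar s' 2 = tape (([a, b] @ gate_list ps (take i vs)) @ (?v # length (ps ?v) # ps ?v) @
      (gate_list ps (drop (Suc i) vs) @ ys))" "sc s' vOne = 1" "sc s' vZero = 0" "sc s' vCap = cap"
    using fr w(1)[unfolded gl] s by (simp_all add: frame_def)
  have len: "2 + length (gate_list ps (take i vs)) + 2 + length (ps ?v) \<le> M"
    using M(1) unfolding gl by simp
  have "tri M (EVAL_GATE x) (setx vC i s') (7 + 8 * length (ps ?v)) (\<lambda>s''.
      ar s'' 5 = (ar (setx vC i s') 5)(?v := red x cap (\<Sum>u\<leftarrow>ps ?v. val u)) \<and>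
      sc s'' vP = length ([a, b] @ gate_list ps (take i vs)) + 2 + length (ps ?v))"
  proof (rule tri_EVAL_GATE)
    fix u assume "u \<in> set (ps ?v)"
    then show "ar (setx vC i s') 5 u = red x cap (val u)"
      using top[OF i'] I by auto
  qed (use s' s(4) I len M in simp_all)
  then show "tri M (EVAL_GATE x) (setx vC i s') (7 + 8 * length (ps ?v)) (\<lambda>s'.
      sc s' vP = 2 + length (gate_list ps (take (Suc i) vs)) \<and>
      (\<forall>u \<in> {..<N} \<union> set (take (Suc i) vs). ar s' 5 u = red x cap (val u)))"
    by (rule tri_conseq) (use I i' val[of ?v] in \<open>auto simp: vs(1)\<close>)
next
  have "1 + (\<Sum>i<length vs. 1 + (7 + 8 * length (ps (vs ! i)))) \<le> 1 + 8 * (\<Sum>i<length vs. 2 + length (ps (vs ! i)))"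
    unfolding sum_distrib_left by (intro add_left_mono sum_mono) simp
  then show "1 + (\<Sum>i<sc s vD. 1 + (7 + 8 * length (ps (vs ! i)))) \<le> k"
    using k w(3) by (simp add: length_gate_list)
qed (use w s in auto)

text \<open>For XOR the accumulator starts at the truncated difference \<open>1 - n\<close>, which
  is 1 only for \<open>n = 0\<close> and thus the parity of \<open>2 ^ n\<close>. For SUM the cap is
  raised from the number of first-half assignments to \<open>2 ^ n\<close> before the outputs are
  added, because the total counts pairs, and the printed number is \<open>2 ^ n\<close> minus the
  total.\<close>

definition PROG2 :: "bool \<Rightarrow> com" where
  "PROG2 x = SET_INPUTS ;; AddC vCap (if x then vOne else vN1) vZero ;; GetC vD 2 vOne ;; SetC vP 2 ;;
     ForC vC vD (EVAL_GATE x) ;; GetC vLen 2 vP ;; AddC vP vP vOne ;;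
     (if x then SubC vAcc vOne vN else POW vCap vN ;; SetC vAcc 0) ;; ADD_VALUES x ;;
     SubC vT (if x then vAcc else vCap) (if x then vZero else vAcc) ;; PrintC vT"

lemma wfc_PROG2 [simp]: "wfc (PROG2 x)"
  by (auto simp: PROG2_def regions_def)

lemma tri_PROG2:
  fixes x :: bool and N n :: nat
  defines "cap \<equiv> if x then 1 else N"
  defines "res \<equiv> \<lambda>S. if x then (1 - n + S) mod 2 else 2 ^ n - min S (2 ^ n)"
  assumes w: "ar s 2 = tape w" "w = [2 * N, length vs] @ gate_list ps vs @ length outs # outs"
    and s: "sc s vOne = 1" "sc s vZero = 0" "sc s vN1 = N" "sc s vN = n" "1 \<le> N" "N \<le> 2 ^ n"
    and top: "\<And>i. i < length vs \<Longrightarrow> set (ps (vs ! i)) \<subseteq> {..<2 * N} \<union> set (take i vs)"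
    and val: "\<And>v. v \<in> set vs \<Longrightarrow> val v = (\<Sum>u\<leftarrow>ps v. val u)" "\<And>u. u < 2 * N \<Longrightarrow> val u = u mod 2"
    and outs: "set outs \<subseteq> {..<2 * N} \<union> set vs"
    and M: "length w \<le> M" "2 * 2 ^ n \<le> M"
  shows "tri M (PROG2 x) s (20 + 5 * N + 2 * n + 8 * length w)
    (\<lambda>s'. otape s' = otape s @ [res (\<Sum>u\<leftarrow>outs. red x cap (val u))])"
proof -
  let ?Q = "\<lambda>s'. otape s' = otape s @ [res (\<Sum>u\<leftarrow>outs. red x cap (val u))]"
  let ?G = "gate_list ps vs" and ?V = "\<lambda>u. red x cap (val u)"
  have cap: "x \<Longrightarrow> cap = 1" "cap \<le> 2 ^ n" "1 \<le> cap"
    using s(5,6) by (auto simp: cap_def)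
  have lw: "length w = 3 + length ?G + length outs"
    by (simp add: w)
  have g: "ar s 2 (Suc 0) = length vs" "ar s 2 (2 + length ?G) = length outs"
    using tape_nth_append[of 1 w "[]" "[]"] tape_nth_append[of 0 "length outs # outs" "[2 * N, length vs] @ ?G" "[]"]
    unfolding w by (simp_all add: eval_nat_numeral)
  let ?fin = "SubC vT (if x then vAcc else vCap) (if x then vZero else vAcc) ;; PrintC vT"
  let ?cap = "if x then 1 else 2 ^ n" and ?a = "if x then 1 - n else 0"
  have fin: "tri M (ADD_VALUES x ;; ?fin) s1 (3 + 8 * length outs) ?Q"
    if s1: "ar s1 2 = tape w" "sc s1 vP = 3 + length ?G" "sc s1 vLen = length outs" "sc s1 vOne = 1" "sc s1 vZero = 0"
      "sc s1 vCap = ?cap" "sc s1 vAcc = ?a" "\<forall>u \<in> {..<2 * N} \<union> set vs. ar s1 5 u = ?V u" "otape s1 = otape s" for s1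
  proof (rule tri_seq')
    show "tri M (ADD_VALUES x) s1 (1 + 8 * length outs) (\<lambda>s'. sc s' vAcc =
      red x ?cap (?a + (\<Sum>u\<leftarrow>outs. ?V u)) \<and> sc s' vP = length ([2 * N, length vs] @ ?G @ [length outs]) + length outs)"
    proof (rule tri_ADD_VALUES[where ys = "[]"])
      show "?V u \<le> ?cap" for u
        using red_le[of x cap "val u"] cap by (auto split: if_split)
      show "sc s1 vAcc = red x ?cap ?a"
        using s1 by (simp add: red_def)
      have "(2::nat) \<le> 2 * 2 ^ n"
        by simp
      then have "2 \<le> M"
        using M(2) by (rule order_trans)
      then show "2 * ?cap \<le> M"
        using M(2) by simp
    qed (use s1 w M lw outs in auto)
    fix s' assume Q: "sc s' vAcc = red x ?cap (?a + (\<Sum>u\<leftarrow>outs. ?V u)) \<and>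
      sc s' vP = length ([2 * N, length vs] @ ?G @ [length outs]) + length outs" and fr: "frame (ADD_VALUES x) s1 s'"
    have "sc s' vCap = ?cap" "sc s' vZero = 0" "otape s' = otape s"
      using fr s1 by (simp_all add: frame_def)
    then show "tri M ?fin s' (3 + 8 * length outs - (1 + 8 * length outs)) ?Q"
      using Q by (cases x) (simp_all add: tri_simps res_def red_def)
  qed simp
  let ?mid = "(if x then SubC vAcc vOne vN else POW vCap vN ;; SetC vAcc 0)"
  define F where "F = (ADD_VALUES x ;; ?fin)"
  note fin = fin[folded F_def]
  have mid: "tri M (?mid ;; F) s1 (6 + 2 * n + 8 * length outs) ?Q"
    if s1: "ar s1 2 = tape w" "sc s1 vP = 3 + length ?G" "sc s1 vLen = length outs" "sc s1 vOne = 1" "sc s1 vZero = 0"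
      "sc s1 vCap = cap" "sc s1 vN = n" "\<forall>u \<in> {..<2 * N} \<union> set vs. ar s1 5 u = ?V u" "otape s1 = otape s" for s1
  proof (cases x)
    case True
    then show ?thesis
      using s1 cap by (auto simp: tri_simps intro!: tri_conseq[OF fin])
  next
    case False
    have "tri M (POW vCap vN ;; SetC vAcc 0 ;; F) s1 (6 + 2 * n + 8 * length outs) ?Q"
    proof (rule tri_seq')
      show "tri M (POW vCap vN) s1 (2 + 2 * n) (\<lambda>s'. sc s' vCap = 2 ^ n)"
        using tri_POW[of vCap vN s1 M] s1 M by simp
      fix s' assume Q: "sc s' vCap = 2 ^ n" and fr: "frame (POW vCap vN) s1 s'"
      have "tri M F (setx vAcc 0 s') (3 + 8 * length outs) ?Q"
        by (rule tri_conseq[OF fin]) (use fr Q s1 False in \<open>simp_all add: frame_def\<close>)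
      then show "tri M (SetC vAcc 0 ;; F) s' (6 + 2 * n + 8 * length outs - (2 + 2 * n)) ?Q"
        by (simp add: tri_simps)
    qed simp
    then show ?thesis
      using False by (simp add: tri_assoc)
  qed
  define D where "D = (?mid ;; F)"
  note mid = mid[folded D_def]
  let ?r = "GetC vLen 2 vP ;; AddC vP vP vOne ;; D"
  have gates: "tri M (ForC vC vD (EVAL_GATE x) ;; ?r) s1 (9 + 8 * length ?G + 2 * n + 8 * length outs) ?Q"
    if s1: "ar s1 2 = tape w" "sc s1 vP = 2" "sc s1 vD = length vs" "sc s1 vOne = 1" "sc s1 vZero = 0"
      "sc s1 vCap = cap" "sc s1 vN = n" "\<forall>u < 2 * N. ar s1 5 u = u mod 2" "otape s1 = otape s" for s1
  proof (rule tri_seq')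
    have "red x cap (u mod 2) = u mod 2" for u
      using cap(3) mod_less_divisor[of 2 u] by (auto simp: red_def min_def simp del: mod_less_divisor)
    then show "tri M (ForC vC vD (EVAL_GATE x)) s1 (1 + 8 * length ?G) (\<lambda>s'. sc s' vP = 2 + length ?G \<and>
        (\<forall>u \<in> {..<2 * N} \<union> set vs. ar s' 5 u = ?V u))"
      by (intro tri_gates[where ys = "length outs # outs"]) (use s1 w cap top val M lw in simp_all)
    fix s' assume Q: "sc s' vP = 2 + length ?G \<and> (\<forall>u \<in> {..<2 * N} \<union> set vs. ar s' 5 u = ?V u)"
      and fr: "frame (ForC vC vD (EVAL_GATE x)) s1 s'"
    have s': "ar s' 2 = tape w" "sc s' vOne = 1" "sc s' vZero = 0" "sc s' vCap = cap" "sc s' vN = n" "otape s' = otape s"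
      using fr s1 by (simp_all add: frame_def)
    show "tri M ?r s' (9 + 8 * length ?G + 2 * n + 8 * length outs - (1 + 8 * length ?G)) ?Q"
      using s' Q g[unfolded w(1)] M(1) lw
      by (auto simp: tri_simps intro!: tri_conseq[OF mid])
  qed simp
  define E where "E = (ForC vC vD (EVAL_GATE x) ;; ?r)"
  note gates = gates[folded E_def]
  have "tri M (PROG2 x) s ((2 + 5 * N) + (3 + (9 + 8 * length ?G + 2 * n + 8 * length outs))) ?Q"
    unfolding PROG2_def F_def[symmetric] D_def[symmetric] E_def[symmetric]
  proof (rule tri_seq)
    have "2 * N \<le> M"
      using s(6) M(2) by linarith
    then show "tri M SET_INPUTS s (2 + 5 * N) (\<lambda>s'. \<forall>j < 2 * N. ar s' 5 j = j mod 2)"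
      using s by (intro tri_SET_INPUTS)
    fix s' assume Q: "\<forall>j < 2 * N. ar s' 5 j = j mod 2" and fr: "frame SET_INPUTS s s'"
    have s': "ar s' 2 = tape w" "sc s' vOne = 1" "sc s' vZero = 0" "sc s' vN1 = N" "sc s' vN = n" "otape s' = otape s"
      using fr s w by (simp_all add: frame_def)
    have "cap \<le> M" "2 \<le> M"
      using cap(2) M lw by linarith+
    then show "tri M (AddC vCap (if x then vOne else vN1) vZero ;; GetC vD 2 vOne ;; SetC vP 2 ;;
        E) s' (3 + (9 + 8 * length ?G + 2 * n + 8 * length outs)) ?Q"
      using s' Q g[unfolded w(1)] by (auto simp: tri_simps cap_def intro!: tri_conseq[OF gates])
  qed
  then show ?thesis
    by (rule tri_conseq) (use lw in simp_all)
qed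

section \<open>The OR-circuit of a formula\<close>

text \<open>As \<open>2 * N1\<close> is even, parity alone separates dummy gates from clause gates
  below \<open>2 * N1 + 2 * m\<close>. From each pair of neighbouring candidates the bit
  \<open>u1\<close> or \<open>u2\<close> picks one in-neighbour.\<close>

definition gate_preds :: "nat \<Rightarrow> nat \<Rightarrow> (nat \<Rightarrow> nat \<Rightarrow> nat) \<Rightarrow> (nat \<Rightarrow> nat \<Rightarrow> nat) \<Rightarrow> nat \<Rightarrow> nat list" where
  "gate_preds N1 m u1 u2 v =
     (if v < 2 * N1 + 2 * m
      then if even v then [0] else map (\<lambda>\<alpha>. 2 * \<alpha> + u1 ((v - 2 * N1) div 2) \<alpha>) [0..<N1]
      else map (\<lambda>c. 2 * N1 + 2 * c + u2 c (v - (2 * N1 + 2 * m))) [0..<m])"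

text \<open>
  Inputs \<open>2 * \<alpha> + 1\<close> stand for the assignments of the first half of the variables, inputs
  \<open>2 * \<alpha>\<close> are dummies, and so are the gates \<open>2 * N1 + 2 * c\<close>: they make all in-degrees positive and
  independent of the formula.
\<close>

definition or_circuit ::
  "nat \<Rightarrow> nat \<Rightarrow> nat \<Rightarrow> (nat \<Rightarrow> nat \<Rightarrow> nat) \<Rightarrow> (nat \<Rightarrow> nat \<Rightarrow> nat) \<Rightarrow> circuit" where
  "or_circuit N1 N2 m u1 u2 = \<lparr>num_inputs = 2 * N1, num_gates = 2 * m + N2,
     wires = {(u, v). v \<in> {2 * N1..<2 * N1 + 2 * m + N2} \<and> u \<in> set (gate_preds N1 m u1 u2 v)},
     outputs = map (\<lambda>\<beta>. 2 * N1 + 2 * m + \<beta>) [0..<N2]\<rparr>"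

lemma or_circuit_simps [simp]:
  "num_inputs (or_circuit N1 N2 m u1 u2) = 2 * N1"
  "num_gates (or_circuit N1 N2 m u1 u2) = 2 * m + N2"
  "outputs (or_circuit N1 N2 m u1 u2) = map (\<lambda>\<beta>. 2 * N1 + 2 * m + \<beta>) [0..<N2]"
  "vertices (or_circuit N1 N2 m u1 u2) = {..<2 * N1 + 2 * m + N2}"
  by (auto simp: or_circuit_def vertices_def)

lemma wires_or: "wires (or_circuit N1 N2 m u1 u2) =
    {(u, v). v \<in> set [2 * N1..<2 * N1 + 2 * m + N2] \<and> u \<in> set (gate_preds N1 m u1 u2 v)}"
  by (simp add: or_circuit_def)

text \<open>These are the paths from input \<open>j\<close> to output \<beta> through the two gates
  of clause \<open>c\<close>: via the clause gate if \<beta> falsifies \<open>c\<close>, otherwise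
  via the dummy gate, which sees only input 0.\<close>

definition feeds :: "nat \<Rightarrow> (nat \<Rightarrow> nat \<Rightarrow> nat) \<Rightarrow> (nat \<Rightarrow> nat \<Rightarrow> nat) \<Rightarrow> nat \<Rightarrow> nat \<Rightarrow> nat \<Rightarrow> bool" where
  "feeds N1 u1 u2 c \<beta> j \<longleftrightarrow> (if u2 c \<beta> = 1 then \<exists>\<alpha><N1. j = 2 * \<alpha> + u1 c \<alpha> else j = 0)"

definition or_matrix ::
  "nat \<Rightarrow> nat \<Rightarrow> nat \<Rightarrow> (nat \<Rightarrow> nat \<Rightarrow> nat) \<Rightarrow> (nat \<Rightarrow> nat \<Rightarrow> nat) \<Rightarrow> bool mat" where
  "or_matrix N1 N2 m u1 u2 = mat N2 (2 * N1) (\<lambda>(\<beta>, j).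
     \<exists>c<m. feeds N1 u1 u2 c \<beta> j)"

lemma card_wires_le:
  "finite {(u, v). v \<in> set vs \<and> u \<in> set (ps v)} \<and>
   card {(u, v). v \<in> set vs \<and> u \<in> set (ps v)} \<le> length (gate_list ps vs)"
proof (induction vs)
  case (Cons v vs)
  let ?W = "{(u, v). v \<in> set vs \<and> u \<in> set (ps v)}"
  have eq: "{(u, w). w \<in> set (v # vs) \<and> u \<in> set (ps w)} = (\<lambda>u. (u, v)) ` set (ps v) \<union> ?W"
    by auto
  have "card ((\<lambda>u. (u, v)) ` set (ps v) \<union> ?W) \<le> card ((\<lambda>u. (u, v)) ` set (ps v)) + card ?W"
    by (rule card_Un_le)
  also have "card ((\<lambda>u. (u, v)) ` set (ps v)) \<le> length (ps v)"
    using card_image_le[of "set (ps v)" "\<lambda>u. (u, v)"] card_length[of "ps v"] by simp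
  finally show ?case
    unfolding eq using Cons by simp
qed simp

context
  fixes N1 N2 m :: nat and u1 u2 :: "nat \<Rightarrow> nat \<Rightarrow> nat"
  assumes u1: "\<And>c \<alpha>. u1 c \<alpha> \<le> 1" and u2: "\<And>c \<beta>. u2 c \<beta> \<le> 1"
    and m: "1 \<le> m" and N: "1 \<le> N1" "N1 \<le> N2"
begin

abbreviation (input) "orc \<equiv> or_circuit N1 N2 m u1 u2"
abbreviation (input) "pl \<equiv> gate_preds N1 m u1 u2"
abbreviation (input) "O1 \<equiv> 2 * N1 + 2 * m"

lemma pl_dummy: "c < m \<Longrightarrow> pl (2 * N1 + 2 * c) = [0]"
  by (simp add: gate_preds_def)

lemma pl_clause: "c < m \<Longrightarrow> pl (Suc (2 * N1 + 2 * c)) = map (\<lambda>\<alpha>. 2 * \<alpha> + u1 c \<alpha>) [0..<N1]"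
  by (simp add: gate_preds_def Suc_diff_le)

lemma pl_output: "pl (O1 + \<beta>) = map (\<lambda>c. 2 * N1 + 2 * c + u2 c \<beta>) [0..<m]"
  by (simp add: gate_preds_def)

lemma gate_cases:
  assumes "v \<in> {2 * N1..<O1 + N2}"
  obtains c where "c < m" "v = 2 * N1 + 2 * c" | c where "c < m" "v = Suc (2 * N1 + 2 * c)"
    | \<beta> where "\<beta> < N2" "v = O1 + \<beta>"
proof (cases "v < O1")
  case True
  define d where "d = v - 2 * N1"
  have d: "v = 2 * N1 + d" "d < 2 * m"
    using assms True by (auto simp: d_def)
  show ?thesis
  proof (cases "even d")
    case True
    then obtain c where "d = 2 * c"
      by (elim evenE)
    then show ?thesis
      using that(1)[of c] d by simp
  next
    case False
    then obtain c where "d = 2 * c + 1"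
      by (elim oddE)
    then show ?thesis
      using that(2)[of c] d by simp
  qed
next
  case False
  then show ?thesis
    using that(3)[of "v - O1"] assms by auto
qed

lemma u1_lt: "\<alpha> < N1 \<Longrightarrow> 2 * \<alpha> + u1 c \<alpha> < 2 * N1"
  using u1[of c \<alpha>] by linarith

lemma u2_lt: "c < m \<Longrightarrow> 2 * N1 + 2 * c + u2 c \<beta> < O1"
  using u2[of c \<beta>] by linarith

text \<open>Different \<open>a\<close> occupy disjoint pairs of consecutive numbers. This makes the
  lists of in-neighbours free of repetitions, as \<open>encodes\<close> demands.\<close>

lemma inj_u: "inj_on (\<lambda>a. b + 2 * a + u a) S" if "\<And>a. u a \<le> (1::nat)" for u and b :: nat
proof (rule inj_onI)
  fix a a' assume "b + 2 * a + u a = b + 2 * a' + u a'"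
  then show "a = a'"
    using that[of a] that[of a'] by linarith
qed

lemma pl_props:
  assumes "v \<in> {2 * N1..<O1 + N2}"
  shows "distinct (pl v)" "pl v \<noteq> []" "set (pl v) \<subseteq> {..<v}"
    "set (pl v) \<subseteq> {..<2 * N1} \<union> {2 * N1..<v}"
proof -
  have "distinct (pl v) \<and> pl v \<noteq> [] \<and> set (pl v) \<subseteq> {..<v}"
    using assms
  proof (cases v rule: gate_cases)
    case (1 c)
    then show ?thesis
      using N by (simp add: pl_dummy)
  next
    case (2 c)
    have "inj_on (\<lambda>\<alpha>. 0 + 2 * \<alpha> + u1 c \<alpha>) {0..<N1}"
      by (rule inj_u) (rule u1)
    moreover have "2 * \<alpha> + u1 c \<alpha> < v" if "\<alpha> < N1" for \<alpha>
      using u1_lt[OF that, of c] 2 by simp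
    ultimately show ?thesis
      using 2 N by (auto simp: pl_clause distinct_map)
  next
    case (3 \<beta>)
    have "inj_on (\<lambda>c. 2 * N1 + 2 * c + u2 c \<beta>) {0..<m}"
      by (rule inj_u) (rule u2)
    moreover have "2 * N1 + 2 * c + u2 c \<beta> < v" if "c < m" for c
      using u2_lt[OF that, of \<beta>] 3 by simp
    ultimately show ?thesis
      unfolding 3 pl_output using m by (auto simp: distinct_map)
  qed
  then show "distinct (pl v)" "pl v \<noteq> []" "set (pl v) \<subseteq> {..<v}"
    "set (pl v) \<subseteq> {..<2 * N1} \<union> {2 * N1..<v}"
    by (auto simp: not_less)
qed

lemma preds_or: "preds orc v = (if v \<in> {2 * N1..<O1 + N2} then set (pl v) else {})"
proof (cases "v \<in> {2 * N1..<O1 + N2}")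
  case True
  then show ?thesis
    by (simp add: preds_def wires_or)
next
  case False
  then have "preds orc v = {}"
    unfolding preds_def wires_or set_upt by blast
  with False show ?thesis
    by (simp only: if_False)
qed

lemma circuit_code_eq:
  "circuit_code N1 N2 m u1 u2 = [2 * N1, 2 * m + N2] @ gate_list pl [2 * N1..<O1 + N2] @
     N2 # outputs orc"
proof -
  have 1: "k \<le> m \<Longrightarrow> gate_list pl [2 * N1..<2 * N1 + 2 * k] = concat (map (clause_gates N1 u1) [0..<k])" for k
  proof (induction k)
    case (Suc k)
    have "[2 * N1..<2 * N1 + 2 * Suc k] = [2 * N1..<2 * N1 + 2 * k] @ [2 * N1 + 2 * k, Suc (2 * N1 + 2 * k)]"
      by simp
    then show ?case
      using Suc by (simp add: pl_dummy pl_clause clause_gates_def)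
  qed simp
  have 2: "gate_list pl [O1..<O1 + k] = concat (map (output_gate N1 m u2) [0..<k])" for k
    by (induction k) (simp_all add: pl_output output_gate_def)
  have "[2 * N1..<O1 + N2] = [2 * N1..<O1] @ [O1..<O1 + N2]"
    using upt_add_eq_append[of "2 * N1" O1 N2] by simp
  then show ?thesis
    using 1[of m] 2[of N2] by (simp add: circuit_code_def)
qed

lemma csize_or_le: "csize orc \<le> length (circuit_code N1 N2 m u1 u2)"
  using card_wires_le[of "[2 * N1..<O1 + N2]" pl] unfolding circuit_code_eq csize_def wires_or
  by simp

lemma encodes_or: "encodes (circuit_code N1 N2 m u1 u2) orc"
  unfolding encodes_def
proof (intro exI conjI)
  let ?vs = "[2 * N1..<O1 + N2]"
  show "set ?vs = vertices orc - {..<num_inputs orc}"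
    by (auto simp: vertices_def)
  show "\<forall>i<length ?vs. preds orc (?vs ! i) \<subseteq> {..<num_inputs orc} \<union> set (take i ?vs)"
  proof (intro allI impI)
    fix i assume i: "i < length ?vs"
    then have "take i ?vs = [2 * N1..<2 * N1 + i]" "?vs ! i = 2 * N1 + i" "2 * N1 + i \<in> {2 * N1..<O1 + N2}"
      by (simp_all add: take_upt)
    then show "preds orc (?vs ! i) \<subseteq> {..<num_inputs orc} \<union> set (take i ?vs)"
      using pl_props(4)[of "2 * N1 + i"] by (simp add: preds_or)
  qed
  show "\<forall>v\<in>set ?vs. distinct (pl v) \<and> set (pl v) = preds orc v"
    using pl_props by (auto simp: preds_or)
  show "circuit_code N1 N2 m u1 u2 = [num_inputs orc, num_gates orc] @
      concat (map (\<lambda>v. v # length (pl v) # pl v) ?vs) @ length (outputs orc) # outputs orc"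
    unfolding circuit_code_eq by (simp add: gate_list_def)
qed simp

lemma wf_or: "wf_circuit orc"
proof -
  have wires: "(u, v) \<in> wires orc \<Longrightarrow> v \<in> {2 * N1..<O1 + N2} \<and> u < v" for u v
    using pl_props(3)[of v] by (auto simp: wires_or)
  have fin: "finite (wires orc)"
    unfolding wires_or using card_wires_le[of "[2 * N1..<O1 + N2]" pl] by blast
  have "wires orc \<subseteq> less_than"
    using wires by auto
  then have "acyclic (wires orc)"
    by (rule acyclic_subset[OF wf_acyclic[OF wf_less_than]])
  moreover have "wires orc \<subseteq> vertices orc \<times> vertices orc"
  proof
    fix e assume "e \<in> wires orc"
    then show "e \<in> vertices orc \<times> vertices orc"
      using wires[of "fst e" "snd e"] by (cases e) simp
  qed
  moreover have "\<forall>v\<in>vertices orc. preds orc v = {} \<longleftrightarrow> v < num_inputs orc"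
    using pl_props(2) by (auto simp: preds_or vertices_def)
  moreover have "num_inputs orc \<le> csize orc"
  proof -
    \<comment> \<open>Clause 0 alone provides enough wires: \<open>N1\<close> into its clause gate,
      and one from its clause or dummy gate into each of the \<open>N2 \<ge> N1\<close>
      outputs.\<close>
    let ?A = "(\<lambda>\<alpha>. (2 * \<alpha> + u1 0 \<alpha>, Suc (2 * N1))) ` {..<N1}"
    let ?B = "(\<lambda>\<beta>. (2 * N1 + u2 0 \<beta>, O1 + \<beta>)) ` {..<N2}"
    have "card ?A = N1"
    proof -
      have "inj_on (\<lambda>\<alpha>. 0 + 2 * \<alpha> + u1 0 \<alpha>) {..<N1}"
        by (rule inj_u) (rule u1)
      then have "inj_on (\<lambda>\<alpha>. (2 * \<alpha> + u1 0 \<alpha>, Suc (2 * N1))) {..<N1}"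
        by (auto simp: inj_on_def)
      then show ?thesis
        by (simp add: card_image)
    qed
    moreover have "card ?B = N2"
      by (subst card_image) (auto simp: inj_on_def)
    moreover have "card (?A \<union> ?B) = card ?A + card ?B"
      using m by (intro card_Un_disjoint) auto
    moreover have "?A \<union> ?B \<subseteq> wires orc"
    proof -
      have "(2 * \<alpha> + u1 0 \<alpha>, Suc (2 * N1)) \<in> wires orc" if "\<alpha> < N1" for \<alpha>
        using m that pl_clause[of 0] by (simp add: wires_or)
      moreover have "(2 * N1 + u2 0 \<beta>, O1 + \<beta>) \<in> wires orc" if "\<beta> < N2" for \<beta>
      proof -
        have "2 * N1 + u2 0 \<beta> \<in> set (pl (O1 + \<beta>))"
          unfolding pl_output set_map by (rule image_eqI[where x = 0]) (use m in auto)
        then show ?thesis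
          using that by (simp add: wires_or)
      qed
      ultimately show ?thesis
        by blast
    qed
    ultimately show ?thesis
      using card_mono[OF fin, of "?A \<union> ?B"] N by (simp add: csize_def)
  qed
  ultimately show ?thesis
    by (auto simp: wf_circuit_def distinct_map)
qed

lemma or_computes_or: "or_computes orc (or_matrix N1 N2 m u1 u2)"
  unfolding or_computes_def
proof (intro conjI allI impI)
  show "or_matrix N1 N2 m u1 u2 \<in> carrier_mat (length (outputs orc)) (num_inputs orc)"
    by (simp add: or_matrix_def)
  fix x and i assume "i < dim_row (or_matrix N1 N2 m u1 u2)"
  then have i: "i < N2"
    by (simp add: or_matrix_def)
  let ?val = "circuit_value (\<lambda>f U. \<exists>u\<in>U. f u) orc x"
  have val: "?val v = (if v < num_inputs orc then x v else \<exists>u\<in>preds orc v. ?val u)" for v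
    by (rule circuit_value_unfold[OF wf_or]) auto
  have inputs: "?val v = x v" if "v < 2 * N1" for v
    using that by (subst val) simp
  have dummy: "?val (2 * N1 + 2 * c) = x 0" if "c < m" for c
    using that N inputs[of 0] pl_dummy[OF that] by (subst val) (simp add: preds_or)
  have clause: "?val (Suc (2 * N1 + 2 * c)) = (\<exists>\<alpha><N1. x (2 * \<alpha> + u1 c \<alpha>))" if "c < m" for c
    using that inputs u1_lt[of _ c] pl_clause[OF that]
    by (subst val) (auto simp: preds_or Bex_def)
  have out: "?val (O1 + i) = (\<exists>c<m. ?val (2 * N1 + 2 * c + u2 c i))"
    using i pl_output[of i] by (subst val) (auto simp: preds_or Bex_def)
  have gate: "?val (2 * N1 + 2 * c + u2 c i) = (\<exists>j. feeds N1 u1 u2 c i j \<and> x j)"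
    if "c < m" for c
  proof -
    have "u2 c i = 0 \<or> u2 c i = 1"
      using u2[of c i] by linarith
    then show ?thesis
      using dummy[OF that] clause[OF that] by (auto simp: feeds_def)
  qed
  have lt: "j < 2 * N1" if "feeds N1 u1 u2 c i j" for c j
    using that N u1_lt[of _ c] by (auto simp: feeds_def split: if_splits)
  have "?val (outputs orc ! i) = (\<exists>c<m. \<exists>j. feeds N1 u1 u2 c i j \<and> x j)"
    using out gate i by (auto simp del: One_nat_def)
  also have "\<dots> = (\<exists>j<2 * N1. (\<exists>c<m. feeds N1 u1 u2 c i j) \<and> x j)"
    using lt by blast
  also have "\<dots> = (\<exists>j<dim_col (or_matrix N1 N2 m u1 u2). or_matrix N1 N2 m u1 u2 $$ (i, j) \<and> x j)"
    using i by (simp add: or_matrix_def conj_commute cong: conj_cong)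
  finally show "?val (outputs orc ! i) =
      (\<exists>j<dim_col (or_matrix N1 N2 m u1 u2). or_matrix N1 N2 m u1 u2 $$ (i, j) \<and> x j)" .
qed

text \<open>A dummy gate leads only to input 0, which is even. So the odd columns are not affected
  by the padding and record exactly which pairs falsify a common clause.\<close>

lemma or_matrix_odd:
  assumes "\<beta> < N2" "\<alpha> < N1"
  shows "or_matrix N1 N2 m u1 u2 $$ (\<beta>, 2 * \<alpha> + 1) \<longleftrightarrow> (\<exists>c<m. u1 c \<alpha> = 1 \<and> u2 c \<beta> = 1)"
proof -
  have "(2 * \<alpha> + 1 = 2 * \<alpha>' + u1 c \<alpha>') \<longleftrightarrow> \<alpha>' = \<alpha> \<and> u1 c \<alpha>' = 1" for \<alpha>' c
  proof -
    have "u1 c \<alpha>' = 0 \<or> u1 c \<alpha>' = 1"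
      using u1[of c \<alpha>'] by linarith
    moreover have "2 * \<alpha> + 1 \<noteq> 2 * \<alpha>'"
      by presburger
    ultimately show ?thesis
      by auto
  qed
  then have "feeds N1 u1 u2 c \<beta> (2 * \<alpha> + 1) \<longleftrightarrow> u1 c \<alpha> = 1 \<and> u2 c \<beta> = 1" for c
    using assms(2) by (auto simp: feeds_def simp del: One_nat_def)
  then show ?thesis
    using assms by (simp add: or_matrix_def)
qed

end

section \<open>Evaluating SUM- and XOR-circuits over the natural numbers\<close>

text \<open>An additive map commutes with every sum gate. Thus one evaluation over the natural
  numbers serves both kinds of circuit: it is an image of the evaluation over formal linear forms,
  and its own image modulo 2 is the evaluation over \<open>bit\<close>.\<close>

lemma circuit_value_hom:
  assumes D: "wf_circuit D" and f: "f 0 = 0" "\<And>a b. f (a + b) = f a + f b"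
    and x: "\<And>j. j < num_inputs D \<Longrightarrow> f (x j) = y j"
  shows "f (circuit_value sum D x v) = circuit_value sum D y v"
proof (induction v rule: wf_induct_rule[OF wf_wires[OF D]])
  case (1 v)
  have f_sum: "f (sum g U) = (\<Sum>u\<in>U. f (g u))" for g :: "nat \<Rightarrow> _" and U
    by (induction U rule: infinite_finite_induct) (simp_all add: f)
  have unfold: "circuit_value sum D z v =
      (if v < num_inputs D then z v else sum (circuit_value sum D z) (preds D v))"
    for z :: "nat \<Rightarrow> 'z::comm_monoid_add"
    by (rule circuit_value_unfold[OF D]) (auto intro: sum.cong)
  show ?case
    unfolding unfold[of x] unfolding unfold[of y]
    using x 1 by (auto simp: f_sum preds_def intro!: sum.cong)
qed

lemma circuit_value_sum_unfold:
  assumes "wf_circuit D"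
  shows "circuit_value sum D z v =
    (if v < num_inputs D then z v else sum (circuit_value sum D z) (preds D v))"
  by (rule circuit_value_unfold[OF assms]) (auto intro: sum.cong)

definition odd_value :: "circuit \<Rightarrow> nat \<Rightarrow> nat" where
  "odd_value D = circuit_value sum D (\<lambda>j. j mod 2)"

lemma sum_computes_odd_value:
  assumes D: "wf_circuit D" "sum_computes D A" and i: "i < dim_row A"
  shows "odd_value D (outputs D ! i) = (\<Sum>j<dim_col A. of_bool (A $$ (i, j)) * (j mod 2))"
proof -
  let ?N = "dim_col A"
  have N: "num_inputs D = ?N"
    using D by (auto simp: sum_computes_def)
  \<comment> \<open>\<open>f\<close> evaluates a formal linear form at the vector with ones at the
    odd positions.\<close>
  define f :: "(nat \<Rightarrow>\<^sub>0 nat) \<Rightarrow> nat" where "f = (\<lambda>p. \<Sum>j<?N. Poly_Mapping.lookup p j * (j mod 2))"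
  have f_single: "f (Poly_Mapping.single j a) = a * (j mod 2)" if "j < ?N" for j a
    using that by (simp add: f_def Poly_Mapping.lookup_single when_def if_distrib[of "\<lambda>a. a * _"] sum.delta' cong: if_cong)
  have f_add: "f 0 = 0" "f (p + q) = f p + f q" for p q
    by (simp_all add: f_def Poly_Mapping.lookup_add distrib_right sum.distrib)
  have f_sum: "f (sum g U) = (\<Sum>u\<in>U. f (g u))" for g :: "nat \<Rightarrow> _" and U
    by (induction U rule: infinite_finite_induct) (simp_all add: f_add)
  have "odd_value D (outputs D ! i) =
      f (circuit_value sum D (\<lambda>j. Poly_Mapping.single j 1 :: nat \<Rightarrow>\<^sub>0 nat) (outputs D ! i))"
    unfolding odd_value_def
    by (rule circuit_value_hom[symmetric, OF D(1)]) (use f_add f_single N in simp_all)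
  also have "\<dots> = f (\<Sum>j<?N. Poly_Mapping.single j (of_bool (A $$ (i, j))))"
    using D(2) i by (simp add: sum_computes_def)
  also have "\<dots> = (\<Sum>j<?N. of_bool (A $$ (i, j)) * (j mod 2))"
    unfolding f_sum by (intro sum.cong) (use f_single in simp_all)
  finally show ?thesis .
qed

lemma of_nat_bit_eq_iff: "(of_nat a :: bit) = of_nat b \<longleftrightarrow> a mod 2 = b mod 2"
proof -
  have "(of_nat c :: bit) = of_bool (odd c)" for c
    by (induction c) auto
  then show ?thesis
    by (simp add: mod_2_eq_odd)
qed

text \<open>Over the natural numbers a gate of an XOR-circuit may take any value; only the residue
  is determined, and \<open>of_nat\<close> into \<open>bit\<close> is the additive map that extracts
  it.\<close>

lemma xor_computes_odd_value:
  assumes D: "wf_circuit D" "xor_computes D A" and i: "i < dim_row A"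
  shows "odd_value D (outputs D ! i) mod 2 = (\<Sum>j<dim_col A. of_bool (A $$ (i, j)) * (j mod 2)) mod 2"
proof -
  have "(of_nat (odd_value D (outputs D ! i)) :: bit) = circuit_value sum D (\<lambda>j. of_nat (j mod 2)) (outputs D ! i)"
    unfolding odd_value_def by (rule circuit_value_hom[OF D(1)]) simp_all
  also have "\<dots> = (\<Sum>j<dim_col A. of_bool (A $$ (i, j)) * of_nat (j mod 2))"
    using D(2) i by (simp add: xor_computes_def)
  also have "\<dots> = of_nat (\<Sum>j<dim_col A. of_bool (A $$ (i, j)) * (j mod 2))"
    by (simp only: of_nat_sum of_nat_mult of_nat_of_bool)
  finally show ?thesis
    unfolding of_nat_bit_eq_iff .
qed

lemma sum_odd: "(\<Sum>j<2 * N. a j * (j mod 2)) = (\<Sum>\<alpha><N. a (2 * \<alpha> + 1))" for a :: "nat \<Rightarrow> nat"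
  by (induction N) simp_all

section \<open>Counting satisfying assignments\<close>

definition join_halves :: "nat \<Rightarrow> nat \<Rightarrow> nat \<times> nat \<Rightarrow> nat \<Rightarrow> bool" where
  "join_halves n h = (\<lambda>(\<alpha>, \<beta>). restrict (\<lambda>i. if i < h then bit \<alpha> i else bit \<beta> (i - h)) {..<n})"

lemma nat_eq_if_bits:
  fixes a b :: nat
  assumes "a < 2 ^ h" "b < 2 ^ h" "\<And>i. i < h \<Longrightarrow> bit a i = bit b i"
  shows "a = b"
proof -
  have "take_bit h a = take_bit h b"
    using assms(3) by (intro bit_eqI) (auto simp: bit_take_bit_iff)
  then show ?thesis
    using assms(1,2) by (simp add: take_bit_nat_eq_self)
qed

text \<open>Each half is recovered from its binary digits, which gives injectivity; surjectivity
  follows by comparing cardinalities.\<close>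

lemma bij_join_halves:
  assumes "h + g = n"
  shows "bij_betw (join_halves n h) ({..<2 ^ h} \<times> {..<2 ^ g}) ({..<n} \<rightarrow>\<^sub>E UNIV)"
proof -
  let ?S = "{..<2 ^ h :: nat} \<times> {..<2 ^ g :: nat}" and ?P = "{..<n} \<rightarrow>\<^sub>E (UNIV :: bool set)"
  have inj: "inj_on (join_halves n h) ?S"
  proof (intro inj_onI, clarsimp)
    fix a b a' b' :: nat
    assume lt: "a < 2 ^ h" "b < 2 ^ g" "a' < 2 ^ h" "b' < 2 ^ g" and eq: "join_halves n h (a, b) = join_halves n h (a', b')"
    have eq': "join_halves n h (a, b) i = join_halves n h (a', b') i" for i
      using eq by simp
    have "a = a'"
    proof (rule nat_eq_if_bits[OF lt(1,3)])
      fix i assume "i < h"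
      then show "bit a i = bit a' i"
        using eq'[of i] assms by (simp add: join_halves_def)
    qed
    moreover have "b = b'"
    proof (rule nat_eq_if_bits[OF lt(2,4)])
      fix i assume "i < g"
      then show "bit b i = bit b' i"
        using eq'[of "h + i"] assms by (simp add: join_halves_def)
    qed
    ultimately show "a = a' \<and> b = b'" ..
  qed
  have "card (join_halves n h ` ?S) = card ?P"
    by (simp add: card_image[OF inj] card_funcsetE power_add[symmetric] assms)
  moreover have "join_halves n h ` ?S \<subseteq> ?P"
    by (auto simp: join_halves_def)
  ultimately have "join_halves n h ` ?S = ?P"
    by (intro card_subset_eq) (simp_all add: finite_PiE)
  then show ?thesis
    using inj by (simp add: bij_betw_def)
qed

lemma lval_literal:
  assumes "h + g = n" "var l < n"
  shows "lval 0 h n \<alpha> (encode_literal l) = of_bool (var l < h \<and> holds (join_halves n h (\<alpha>, \<beta>)) l)"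
    "lval h g n \<beta> (encode_literal l) = of_bool (h \<le> var l \<and> holds (join_halves n h (\<alpha>, \<beta>)) l)"
proof -
  have b: "bit a i \<longleftrightarrow> a div 2 ^ i mod 2 = 1" for a i :: nat
    by (simp add: bit_iff_odd odd_iff_mod_2_eq_one)
  have b': "a div 2 ^ i mod 2 = 0 \<or> a div 2 ^ i mod 2 = 1" for a i :: nat
    by linarith
  show "lval 0 h n \<alpha> (encode_literal l) = of_bool (var l < h \<and> holds (join_halves n h (\<alpha>, \<beta>)) l)"
    using assms b'[of \<alpha> "var l"] by (cases l) (auto simp: lval_def join_halves_def b)
  show "lval h g n \<beta> (encode_literal l) = of_bool (h \<le> var l \<and> holds (join_halves n h (\<alpha>, \<beta>)) l)"
    using assms b'[of \<beta> "var l - h"] by (cases l) (auto simp: lval_def join_halves_def b)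
qed

text \<open>A literal belongs to one half and is false in the table of the other, so no literal is
  true in either table exactly if none is true under the joined assignment.\<close>

lemma falsified_iff:
  assumes "h + g = n" "\<forall>l\<in>set c. var l < n"
  shows "falsified 0 h n c \<alpha> = 1 \<and> falsified h g n c \<beta> = 1 \<longleftrightarrow> \<not> (\<exists>l\<in>set c. holds (join_halves n h (\<alpha>, \<beta>)) l)"
proof -
  have "1 - S = 1 \<longleftrightarrow> S = 0" for S :: nat
    by linarith
  then have f: "falsified lo len n c a = 1 \<longleftrightarrow> (\<forall>l\<in>set c. lval lo len n a (encode_literal l) = 0)" for lo len a
    unfolding falsified_def by (simp only: sum_list_nonneg_eq_0_iff) simp
  show ?thesis
    unfolding f using assms(2) lval_literal(1)[OF assms(1), of _ \<alpha> \<beta>]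
      lval_literal(2)[OF assms(1), of _ \<beta> \<alpha>] by (auto simp: not_less)
qed

text \<open>Pairs of halves correspond to assignments, and the added clause is never falsified, so
  the counted pairs form exactly the complement of the satisfying assignments.\<close>

lemma num_sat_count:
  fixes n :: nat and F :: cnf
  assumes hg: "h + g = n" and F: "cnf_over n F" and Cs: "Cs = F @ [[Pos n]]"
  shows "num_sat n F + card {(\<alpha>, \<beta>) \<in> {..<2 ^ h} \<times> {..<2 ^ g}.
    \<exists>c < length Cs. falsified 0 h n (Cs ! c) \<alpha> = 1 \<and> falsified h g n (Cs ! c) \<beta> = 1} = 2 ^ n"
proof -
  let ?S = "{..<2 ^ h :: nat} \<times> {..<2 ^ g :: nat}"
  let ?sat = "\<lambda>a. \<forall>c\<in>set F. \<exists>l\<in>set c. holds a l"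
  have last: "\<not> falsified 0 h n [Pos n] \<alpha> = 1" for \<alpha>
    using hg by (simp add: falsified_def lval_def)
  have bad: "(\<exists>c < length Cs. falsified 0 h n (Cs ! c) \<alpha> = 1 \<and> falsified h g n (Cs ! c) \<beta> = 1) \<longleftrightarrow>
      \<not> ?sat (join_halves n h (\<alpha>, \<beta>))" for \<alpha> \<beta>
  proof -
    have "(\<exists>c < length Cs. falsified 0 h n (Cs ! c) \<alpha> = 1 \<and> falsified h g n (Cs ! c) \<beta> = 1) \<longleftrightarrow>
        (\<exists>c \<in> set Cs. falsified 0 h n c \<alpha> = 1 \<and> falsified h g n c \<beta> = 1)"
      using list_ex_length[of "\<lambda>c. falsified 0 h n c \<alpha> = 1 \<and> falsified h g n c \<beta> = 1" Cs]
      by (simp only: list_ex_iff)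
    also have "\<dots> \<longleftrightarrow> (\<exists>c \<in> set F. falsified 0 h n c \<alpha> = 1 \<and> falsified h g n c \<beta> = 1)"
      using last by (auto simp: Cs)
    also have "\<dots> \<longleftrightarrow> (\<exists>c \<in> set F. \<not> (\<exists>l\<in>set c. holds (join_halves n h (\<alpha>, \<beta>)) l))"
      using F by (intro bex_cong refl falsified_iff[OF hg]) (simp add: cnf_over_def)
    finally show ?thesis
      by simp
  qed
  have "num_sat n F = card {a \<in> {..<n} \<rightarrow>\<^sub>E UNIV. ?sat a}"
    by (simp add: num_sat_def)
  also have "{a \<in> {..<n} \<rightarrow>\<^sub>E UNIV. ?sat a} = join_halves n h ` {p \<in> ?S. ?sat (join_halves n h p)}"
    unfolding bij_betw_imp_surj_on[OF bij_join_halves[OF hg], symmetric] by blast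
  also have "card \<dots> = card {p \<in> ?S. ?sat (join_halves n h p)}"
    by (rule card_image, rule inj_on_subset[OF bij_betw_imp_inj_on[OF bij_join_halves[OF hg]]]) blast
  finally have sat: "num_sat n F = card {p \<in> ?S. ?sat (join_halves n h p)}" .
  have "card {p \<in> ?S. ?sat (join_halves n h p)} + card {p \<in> ?S. \<not> ?sat (join_halves n h p)} =
      card ({p \<in> ?S. ?sat (join_halves n h p)} \<union> {p \<in> ?S. \<not> ?sat (join_halves n h p)})"
  proof (rule card_Un_disjoint[symmetric])
    have "finite ?S"
      by simp
    then show "finite {p \<in> ?S. ?sat (join_halves n h p)}" "finite {p \<in> ?S. \<not> ?sat (join_halves n h p)}"
      by (rule rev_finite_subset, blast)+
  qed blast
  also have "{p \<in> ?S. ?sat (join_halves n h p)} \<union> {p \<in> ?S. \<not> ?sat (join_halves n h p)} = ?S"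
    by blast
  also have "card ?S = 2 ^ n"
    using hg by (simp add: power_add[symmetric])
  also have "{p \<in> ?S. \<not> ?sat (join_halves n h p)} = {(\<alpha>, \<beta>) \<in> ?S.
    \<exists>c < length Cs. falsified 0 h n (Cs ! c) \<alpha> = 1 \<and> falsified h g n (Cs ! c) \<beta> = 1}"
    using bad by auto
  finally show ?thesis
    using sat by simp
qed

section \<open>The reduction as a random access machine\<close>

definition reduction :: "bool \<Rightarrow> ram \<Rightarrow> ram" where
  "reduction x P = (let a = code PROG1 0; b = sim P (length a) in a @ b @ code (PROG2 x) (length a + length b))"

lemma encodes_D:
  assumes D: "wf_circuit D" and w: "encodes w D"
  obtains vs ps where "w = [num_inputs D, length vs] @ gate_list ps vs @ length (outputs D) # outputs D"
    "\<And>i. i < length vs \<Longrightarrow> set (ps (vs ! i)) \<subseteq> {..<num_inputs D} \<union> set (take i vs)"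
    "set vs = vertices D - {..<num_inputs D}"
    "\<And>v. v \<in> set vs \<Longrightarrow> odd_value D v = (\<Sum>u\<leftarrow>ps v. odd_value D u)"
    "num_gates D = length vs"
proof -
  obtain vs ps where vs: "distinct vs" "set vs = vertices D - {..<num_inputs D}"
    and top: "\<forall>i < length vs. preds D (vs ! i) \<subseteq> {..<num_inputs D} \<union> set (take i vs)"
    and ps: "\<forall>v \<in> set vs. distinct (ps v) \<and> set (ps v) = preds D v"
    and weq: "w = [num_inputs D, num_gates D] @ concat (map (\<lambda>v. v # length (ps v) # ps v) vs) @
      length (outputs D) # outputs D"
    using w unfolding encodes_def by blast
  have "set vs = {num_inputs D..<num_inputs D + num_gates D}"
    using vs(2) by (auto simp: vertices_def)
  then have lvs: "num_gates D = length vs"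
    using distinct_card[OF vs(1)] by simp
  have val: "odd_value D v = (\<Sum>u\<leftarrow>ps v. odd_value D u)" if "v \<in> set vs" for v
  proof -
    have "odd_value D v = sum (odd_value D) (preds D v)"
      unfolding odd_value_def by (subst circuit_value_sum_unfold[OF D]) (use that vs(2) in auto)
    then show ?thesis
      using ps that by (simp add: sum_list_distinct_conv_sum_set)
  qed
  show thesis
  proof (rule that[of vs ps])
    show "set (ps (vs ! i)) \<subseteq> {..<num_inputs D} \<union> set (take i vs)" if "i < length vs" for i
    proof -
      have "set (ps (vs ! i)) = preds D (vs ! i)"
        using ps that by simp
      then show ?thesis
        using top that by blast
    qed
  qed (use weq vs lvs val in \<open>simp_all add: gate_list_def\<close>)
qed

lemma length_le_gate_list: "length vs \<le> length (gate_list ps vs)"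
  by (induction vs) auto

lemma gate_list_le:
  assumes "\<And>v. v \<in> set vs \<Longrightarrow> v < B \<and> length (ps v) < B \<and> set (ps v) \<subseteq> {..<B}"
  shows "a \<in> set (gate_list ps vs) \<Longrightarrow> a < B"
  using assms by (induction vs) auto

lemma length_ps_le: "v \<in> set vs \<Longrightarrow> length (ps v) \<le> length (gate_list ps vs)"
  by (induction vs) auto

text \<open>The converter appears only through one halting run on \<open>w\<close>. Its time
  \<open>t\<close> enters the bound twice: for the simulation, and for the evaluation, which scans
  an output of length at most \<open>t\<close>.\<close>

theorem reduction_correct:
  fixes n :: nat and F :: cnf and x :: bool
  defines "h \<equiv> n div 2" and "g \<equiv> n - n div 2" and "Cs \<equiv> F @ [[Pos n]]"
  defines "u1 \<equiv> \<lambda>c. falsified 0 h n (Cs ! c)" and "u2 \<equiv> \<lambda>c. falsified h g n (Cs ! c)"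
  defines "w \<equiv> circuit_code (2 ^ h) (2 ^ g) (length Cs) u1 u2"
  defines "cap \<equiv> if x then 1 else 2 ^ h"
  assumes K: "\<And>c. c \<in> set F \<Longrightarrow> length c \<le> 2 * n + 1"
    and P: "ram_outputs P w t w'" and D: "wf_circuit D" "encodes w' D" "num_inputs D = 2 * 2 ^ h"
    and M: "length w \<le> M" "length (fcode Cs) \<le> M" "2 * n + 2 \<le> M"
      "2 * 2 ^ h + 2 * length Cs + 2 ^ g + 2 \<le> M" "2 * 2 ^ n \<le> M" "2 * 2 ^ h + t \<le> M"
      "\<And>a. a \<in> set (encode_cnf n F) \<Longrightarrow> a \<le> M"
  shows "\<exists>t'. ram_outputs (reduction x P) (encode_cnf n F) t'
      [if x then (1 - n + (\<Sum>u\<leftarrow>outputs D. red x cap (odd_value D u))) mod 2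
       else 2 ^ n - min (\<Sum>u\<leftarrow>outputs D. red x cap (odd_value D u)) (2 ^ n)] \<and>
    t' \<le> prog1_steps n (length F) * (6 * unit_cost M) + (3 + t * sim_cost t) +
      (20 + 5 * 2 ^ h + 2 * n + 8 * t) * (6 * unit_cost M)"
proof -
  let ?R = "reduction x P" and ?U = "6 * unit_cost M"
  let ?a = "code PROG1 0"
  let ?b = "sim P (length ?a)"
  let ?c = "code (PROG2 x) (length ?a + length ?b)"
  define res where "res = (if x then (1 - n + (\<Sum>u\<leftarrow>outputs D. red x cap (odd_value D u))) mod 2
       else 2 ^ n - min (\<Sum>u\<leftarrow>outputs D. red x cap (odd_value D u)) (2 ^ n))"
  have R: "?R = ?a @ ?b @ ?c"
    by (simp add: reduction_def Let_def)
  have at1: "code_at ?R 0 ?a"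
    unfolding code_at_def R by (rule exI[of _ "[]"]) simp
  have at2: "code_at ?R (length ?a) ?b"
    unfolding code_at_def R by blast
  have at3: "code_at ?R (length ?a + length ?b) ?c"
    unfolding code_at_def R by (rule exI[of _ "?a @ ?b"]) simp
  define s0 where "s0 = \<lparr>sc = (\<lambda>_. 0), ar = (\<lambda>_ _. 0), itape = encode_cnf n F, otape = []\<rparr>"
  define cf0 where "cf0 = \<lparr>pc = 0, reg = (\<lambda>_. 0), input_tape = encode_cnf n F, output_tape = []\<rparr>"
  have rep0: "rep s0 cf0"
    by (simp add: rep_def s0_def cf0_def)
  have bd0: "bounded M s0"
    using M(7) by (simp add: bounded_def s0_def)
  have t1: "tri M PROG1 s0 (prog1_steps n (length F)) (\<lambda>s'. ar s' 1 = tape w \<and> sc s' vN = n \<and> sc s' vOne = 1 \<and>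
    sc s' vZero = 0 \<and> sc s' vN1 = 2 ^ h \<and> ar s' 2 = (\<lambda>_. 0))"
    unfolding h_def
    by (rule tri_PROG1)
      (use K M in \<open>simp_all add: s0_def w_def u1_def u2_def Cs_def h_def g_def\<close>)
  define s1 where "s1 = sem PROG1 s0"
  have s1: "ar s1 1 = tape w" "sc s1 vN = n" "sc s1 vOne = 1" "sc s1 vZero = 0" "sc s1 vN1 = 2 ^ h"
      "ar s1 2 = (\<lambda>_. 0)"
    and safe1: "safe M PROG1 s0" and steps1: "steps PROG1 s0 \<le> prog1_steps n (length F)"
    using t1 by (simp_all add: tri_def s1_def)
  have bd1: "bounded M s1"
    unfolding s1_def by (rule bounded_sem[OF bd0 _ safe1]) simp
  have ot1: "otape s1 = []"
    unfolding s1_def by (subst sem_no_print) (simp_all add: s0_def)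
  have at1': "code_at ?R (pc cf0) (code PROG1 (pc cf0))"
    using at1 by (simp add: cf0_def)
  obtain cf1 where cf1: "reaches ?R cf0 (steps PROG1 s0 * ?U) cf1" "rep s1 cf1"
    "pc cf1 = pc cf0 + length (code PROG1 (pc cf0))" "\<forall>i. reg cf1 (adr 0 i) = reg cf0 (adr 0 i)"
    using code_correct[OF at1' rep0 bd0 _ safe1] unfolding s1_def by auto
  have pc1: "pc cf1 = length ?a"
    using cf1(3) by (simp add: cf0_def)
  define s2 where "s2 = s1\<lparr>ar := (ar s1)(2 := tape w')\<rparr>"
  have "code_at ?R (pc cf1) (sim P (pc cf1))" "reg cf1 (adr 0 i) = 0" for i
    using at2 pc1 cf1(4) by (simp_all add: cf0_def)
  then obtain cf2 where cf2: "reaches ?R cf1 (3 + t * sim_cost t) cf2" "rep s2 cf2"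
    "pc cf2 = pc cf1 + length (sim P (pc cf1))"
    using sim_correct[OF P _ cf1(2) _ s1(1,6)] unfolding s2_def by blast
  have pc2: "pc cf2 = length ?a + length ?b"
    using cf2(3) pc1 by simp
  obtain vs ps where enc: "w' = [num_inputs D, length vs] @ gate_list ps vs @ length (outputs D) # outputs D"
    and top: "\<And>i. i < length vs \<Longrightarrow> set (ps (vs ! i)) \<subseteq> {..<num_inputs D} \<union> set (take i vs)"
    and vs: "set vs = vertices D - {..<num_inputs D}"
    and val: "\<And>v. v \<in> set vs \<Longrightarrow> odd_value D v = (\<Sum>u\<leftarrow>ps v. odd_value D u)"
    and ng: "num_gates D = length vs"
    by (rule encodes_D[OF D(1,2)]) blast
  have lw': "length w' \<le> t"
    using halts_from_length[OF P[unfolded ram_outputs_def]] by simp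
  have outs: "set (outputs D) \<subseteq> {..<num_inputs D} \<union> set vs" "set (outputs D) \<subseteq> vertices D"
    using D(1) vs by (auto simp: wf_circuit_def)
  have w'_le: "a \<le> M" if a: "a \<in> set w'" for a
  proof -
    \<comment> \<open>The numbers in the converter's output are bounded through its running time:
      the code lists every gate, so vertices lie below the number of inputs plus the length of
      \<open>w'\<close>, and this length is at most \<open>t\<close>.\<close>
    let ?B = "2 * 2 ^ h + length w'"
    have vert: "v < ?B" if "v \<in> vertices D" for v
      using that D(3) ng length_le_gate_list[of vs ps] enc by (auto simp: vertices_def)
    have gl: "b < ?B" if b: "b \<in> set (gate_list ps vs)" for b
    proof (rule gate_list_le[OF _ b])
      fix v assume v: "v \<in> set vs"
      then obtain i where i: "i < length vs" "v = vs ! i"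
        by (auto simp: in_set_conv_nth)
      have "set (ps v) \<subseteq> {..<num_inputs D} \<union> set vs"
        using top[OF i(1)] i set_take_subset[of i vs] by blast
      then have "set (ps v) \<subseteq> vertices D"
        using vs by (auto simp: vertices_def)
      moreover have "length (ps v) < ?B"
        using length_ps_le[OF v, of ps] enc by simp
      ultimately show "v < ?B \<and> length (ps v) < ?B \<and> set (ps v) \<subseteq> {..<?B}"
        using v vs vert by auto
    qed
    have "a \<le> ?B"
    proof -
      consider "a = num_inputs D" | "a = length vs" | "a \<in> set (gate_list ps vs)" | "a = length (outputs D)"
        | "a \<in> set (outputs D)"
        using a enc by auto
      then show ?thesis
      proof cases
        case 2
        then show ?thesis
          using length_le_gate_list[of vs ps] enc by simp
      next
        case 3
        then show ?thesis
          using gl[of a] by simp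
      next
        case 5
        then show ?thesis
          using outs(2) vert[of a] by (simp add: subset_eq less_imp_le)
      qed (use D(3) enc in simp_all)
    qed
    then show ?thesis
      using lw' M(6) by linarith
  qed
  have bd2: "bounded M s2"
    using bd1 w'_le by (auto simp: bounded_def s2_def tape_def regions_def)
  have hn: "(1::nat) \<le> 2 ^ h" "(2::nat) ^ h \<le> 2 ^ n"
    by (simp_all add: h_def)
  have inputs: "odd_value D u = u mod 2" if "u < 2 * 2 ^ h" for u
    unfolding odd_value_def by (subst circuit_value_sum_unfold[OF D(1)]) (use that D(3) in simp)
  have "length w' \<le> M"
    using lw' M(6) by linarith
  then have "tri M (PROG2 x) s2 (20 + 5 * 2 ^ h + 2 * n + 8 * length w') (\<lambda>s'. otape s' = otape s2 @ [res])"
    unfolding res_def cap_def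
    by (intro tri_PROG2[where ps = ps and vs = vs and val = "odd_value D"])
      (use s1 D(3) enc top val outs inputs hn M in \<open>simp_all add: s2_def\<close>)
  then have t2: "safe M (PROG2 x) s2" "steps (PROG2 x) s2 \<le> 20 + 5 * 2 ^ h + 2 * n + 8 * length w'"
    "otape (sem (PROG2 x) s2) = [res]"
    using ot1 by (simp_all add: tri_def s2_def)
  have at3': "code_at ?R (pc cf2) (code (PROG2 x) (pc cf2))"
    using at3 pc2 by simp
  obtain cf3 where cf3: "reaches ?R cf2 (steps (PROG2 x) s2 * ?U) cf3" "rep (sem (PROG2 x) s2) cf3"
    "pc cf3 = pc cf2 + length (code (PROG2 x) (pc cf2))"
    using code_correct[OF at3' cf2(2) bd2 _ t2(1)] by auto
  have "reaches ?R cf0 (steps PROG1 s0 * ?U + (3 + t * sim_cost t) + steps (PROG2 x) s2 * ?U) cf3"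
    by (rule reaches_trans[OF reaches_trans[OF cf1(1) cf2(1)] cf3(1)])
  then obtain t' where t': "reach ?R cf0 t' cf3"
    "t' \<le> steps PROG1 s0 * ?U + (3 + t * sim_cost t) + steps (PROG2 x) s2 * ?U"
    unfolding reaches_def by blast
  have "length ?R \<le> pc cf3"
    using cf3(3) pc2 R by simp
  then have "halts_from ?R cf0 t' (output_tape cf3)"
    by (rule reach_halts[OF t'(1)])
  moreover have "output_tape cf3 = [res]"
    using cf3(2) t2(3) by (simp add: rep_def)
  ultimately have "ram_outputs ?R (encode_cnf n F) t' [res]"
    by (simp add: ram_outputs_def cf0_def)
  moreover have "t' \<le> prog1_steps n (length F) * ?U + (3 + t * sim_cost t) +
      (20 + 5 * 2 ^ h + 2 * n + 8 * t) * ?U"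
  proof -
    have steps2: "steps (PROG2 x) s2 \<le> 20 + 5 * 2 ^ h + 2 * n + 8 * t"
      using t2(2) lw' by linarith
    then show ?thesis
      using t'(2) mult_right_mono[OF steps1, of ?U] mult_right_mono[OF steps2, of ?U] by linarith
  qed
  ultimately show ?thesis
    unfolding res_def by blast
qed

section \<open>Counting falsifying pairs from the outputs of the converted circuit\<close>

definition bad_pairs :: "nat \<Rightarrow> nat \<Rightarrow> nat \<Rightarrow> (nat \<Rightarrow> nat \<Rightarrow> nat) \<Rightarrow> (nat \<Rightarrow> nat \<Rightarrow> nat) \<Rightarrow> (nat \<times> nat) set" where
  "bad_pairs N1 N2 m u1 u2 = {(\<alpha>, \<beta>) \<in> {..<N1} \<times> {..<N2}. \<exists>c<m. u1 c \<alpha> = 1 \<and> u2 c \<beta> = 1}"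

lemma card_bad_pairs:
  "card (bad_pairs N1 N2 m u1 u2) =
    (\<Sum>\<beta><N2. \<Sum>\<alpha><N1. of_bool (\<exists>c<m. u1 c \<alpha> = 1 \<and> u2 c \<beta> = 1))"
proof -
  let ?Q = "\<lambda>\<alpha> \<beta>. \<exists>c<m. u1 c \<alpha> = 1 \<and> u2 c \<beta> = 1"
  let ?B = "bad_pairs N1 N2 m u1 u2"
  have "card ?B = (\<Sum>p\<in>{..<N1} \<times> {..<N2}. if p \<in> ?B then 1 else 0)"
    by (subst sum.inter_restrict[symmetric])
      (auto simp: bad_pairs_def intro!: arg_cong[where f = card])
  also have "\<dots> = (\<Sum>\<alpha><N1. \<Sum>\<beta><N2. if (\<alpha>, \<beta>) \<in> ?B then 1 else 0)"
    by (simp add: sum.cartesian_product)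
  also have "\<dots> = (\<Sum>\<beta><N2. \<Sum>\<alpha><N1. if (\<alpha>, \<beta>) \<in> ?B then 1 else 0)"
    by (rule sum.swap)
  also have "\<dots> = (\<Sum>\<beta><N2. \<Sum>\<alpha><N1. of_bool (?Q \<alpha> \<beta>))"
    by (intro sum.cong refl) (auto simp: bad_pairs_def)
  finally show ?thesis .
qed

text \<open>A row sum over the odd columns counts assignments of the first half, so it is at most
  \<open>N1\<close> and the cap does not distort an output of a SUM-circuit. For an XOR-circuit only
  residues survive, and they determine the parity of the total.\<close>

lemma sum_outputs:
  fixes u1 u2 :: "nat \<Rightarrow> nat \<Rightarrow> nat"
  assumes u1: "\<And>c \<alpha>. u1 c \<alpha> \<le> 1" and u2: "\<And>c \<beta>. u2 c \<beta> \<le> 1"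
    and m: "1 \<le> m" and N: "1 \<le> N1" "N1 \<le> N2"
    and D: "wf_circuit D" "(if x then xor_computes else sum_computes) D (or_matrix N1 N2 m u1 u2)"
  shows "num_inputs D = 2 * N1"
    "x \<Longrightarrow> (\<Sum>u\<leftarrow>outputs D. red x N1 (odd_value D u)) mod 2 = card (bad_pairs N1 N2 m u1 u2) mod 2"
    "\<not> x \<Longrightarrow> (\<Sum>u\<leftarrow>outputs D. red x N1 (odd_value D u)) = card (bad_pairs N1 N2 m u1 u2)"
proof -
  let ?A = "or_matrix N1 N2 m u1 u2" and ?B = "\<lambda>\<beta>. \<Sum>\<alpha><N1. of_bool (\<exists>c<m. u1 c \<alpha> = 1 \<and> u2 c \<beta> = 1) :: nat"
  have dim: "dim_row ?A = N2" "dim_col ?A = 2 * N1"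
    by (simp_all add: or_matrix_def)
  have cA: "?A \<in> carrier_mat (length (outputs D)) (num_inputs D)"
    using D(2) by (cases x) (simp_all add: xor_computes_def sum_computes_def)
  then show "num_inputs D = 2 * N1"
    using dim by auto
  have lo: "length (outputs D) = N2"
    using cA dim by auto
  have row: "(\<Sum>j<dim_col ?A. of_bool (?A $$ (i, j)) * (j mod 2)) = ?B i" if "i < N2" for i
    unfolding dim sum_odd
    by (intro sum.cong refl arg_cong[where f = of_bool] or_matrix_odd[OF u1 u2 m N that]) simp
  have le: "?B i \<le> N1" for i
    using sum_bounded_above[of "{..<N1}" "\<lambda>\<alpha>. of_bool (\<exists>c<m. u1 c \<alpha> = 1 \<and> u2 c i = 1) :: nat" 1] by simp
  have val: "red x N1 (odd_value D (outputs D ! i)) = red x N1 (?B i)" if "i < N2" for i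
  proof (cases x)
    case True
    then show ?thesis
      using xor_computes_odd_value[OF D(1), of ?A i] D(2) that dim row[OF that] by (simp add: red_def)
  next
    case False
    then show ?thesis
      using sum_computes_odd_value[OF D(1), of ?A i] D(2) that dim row[OF that] by (simp add: red_def)
  qed
  have S: "(\<Sum>u\<leftarrow>outputs D. red x N1 (odd_value D u)) = (\<Sum>i\<leftarrow>[0..<N2]. red x N1 (?B i))"
  proof -
    have "(\<Sum>u\<leftarrow>outputs D. red x N1 (odd_value D u)) = (\<Sum>i<N2. red x N1 (odd_value D (outputs D ! i)))"
      by (simp add: sum_list_sum_nth lo atLeast0LessThan)
    also have "\<dots> = (\<Sum>i<N2. red x N1 (?B i))"
      by (intro sum.cong) (simp_all add: val)
    also have "\<dots> = (\<Sum>i\<leftarrow>[0..<N2]. red x N1 (?B i))"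
      by (simp add: interv_sum_list_conv_sum_set_nat atLeast0LessThan)
    finally show ?thesis .
  qed
  have B: "(\<Sum>i\<leftarrow>[0..<N2]. ?B i) = card (bad_pairs N1 N2 m u1 u2)"
    by (simp add: interv_sum_list_conv_sum_set_nat atLeast0LessThan card_bad_pairs)
  show "(\<Sum>u\<leftarrow>outputs D. red x N1 (odd_value D u)) = card (bad_pairs N1 N2 m u1 u2)" if "\<not> x"
    unfolding S B[symmetric] using that le by (simp add: red_def min_absorb1)
  show "(\<Sum>u\<leftarrow>outputs D. red x N1 (odd_value D u)) mod 2 = card (bad_pairs N1 N2 m u1 u2) mod 2" if x
    unfolding S B[symmetric] using red_sum_list[of x N1 0 ?B "[0..<N2]"] that by (simp add: red_def)
qed

section \<open>Running time\<close>

lemma length_clause_le: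
  assumes "cnf_over n F" "c \<in> set F"
  shows "length c \<le> 2 * n"
proof -
  have "l \<in> Pos ` {..<n} \<union> Neg ` {..<n}" if "l \<in> set c" for l
  proof -
    have "var l < n"
      using assms that by (auto simp: cnf_over_def)
    then show ?thesis
      by (cases l) simp_all
  qed
  then have "card (set c) \<le> card (Pos ` {..<n} \<union> Neg ` {..<n})"
    by (intro card_mono) auto
  also have "\<dots> \<le> n + n"
    by (rule order_trans[OF card_Un_le]) (intro add_mono; simp add: card_image_le[THEN order_trans])
  finally show ?thesis
    using assms distinct_card[of c] by (auto simp: cnf_over_def)
qed

lemma length_fcode_le: "(\<And>c. c \<in> set F \<Longrightarrow> length c \<le> K) \<Longrightarrow> length (fcode F) \<le> length F * Suc K"
proof (induction F)
  case (Cons c F)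
  have "length c \<le> K" "length (fcode F) \<le> length F * Suc K"
    using Cons.prems by (simp, intro Cons.IH, simp)
  then show ?case
    by simp
qed simp

lemma encode_cnf_le:
  assumes F: "cnf_over n F" and a: "a \<in> set (encode_cnf n F)"
  shows "a \<le> 2 * (n + length F + 1)"
proof -
  consider "a = n" | "a = length F" | c where "c \<in> set F" "a = length c"
    | c l where "c \<in> set F" "l \<in> set c" "a = encode_literal l"
    using a by (auto simp: encode_cnf_def)
  then show ?thesis
  proof cases
    case (3 c)
    then show ?thesis
      using length_clause_le[OF F 3(1)] by simp
  next
    case (4 c l)
    then have "var l < n"
      using F by (auto simp: cnf_over_def)
    then show ?thesis
      using 4(3) by (cases l) auto
  qed simp_all
qed

text \<open>Every term is compared with \<open>Y = X * X * N\<close>; 118 is the sum of the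
  coefficients 13, 18, 36, 11, 21, 12 and 7.\<close>

lemma gen_steps_le:
  assumes "m + 1 \<le> X" "K \<le> 2 * X" "h \<le> X" "g \<le> X" "h \<le> g" "1 \<le> X"
  shows "gen_steps (m + 1) K h g \<le> 118 * (X ^ 2 * 2 ^ g)"
proof -
  define N where "N = (2::nat) ^ g"
  define Y where "Y = X * X * N"
  have N: "1 \<le> N" "2 ^ h \<le> N"
    using assms(5) by (auto simp: N_def intro: power_increasing)
  have XX: "X \<le> X * X" "1 \<le> X * X"
    using assms(6) by simp_all
  have "X * X * 1 \<le> Y"
    unfolding Y_def using N by (intro mult_left_mono) auto
  then have Y: "X \<le> Y" "1 \<le> Y"
    using XX by linarith+
  have Y2: "N \<le> Y" "X * N \<le> Y"
    using mult_right_mono[OF XX(1), of N] mult_right_mono[OF XX(2), of N] by (simp_all add: Y_def)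
  have "2 ^ h * (14 + 5 * K + 12 * h) \<le> N * (36 * X)"
    using N(2) by (rule mult_mono) (use assms in linarith)+
  then have "18 + 2 ^ h * (14 + 5 * K + 12 * h) \<le> 18 + N * (36 * X)"
    by (rule add_left_mono)
  with assms(1) have "(m + 1) * (18 + 2 ^ h * (14 + 5 * K + 12 * h)) \<le> X * (18 + N * (36 * X))"
    by (rule mult_mono) simp_all
  also have "\<dots> = 18 * X + 36 * Y"
    by (simp add: algebra_simps Y_def)
  finally have a: "(m + 1) * (18 + 2 ^ h * (14 + 5 * K + 12 * h)) \<le> 18 * X + 36 * Y" .
  have "(m + 1) * (11 + 5 * K) \<le> X * (21 * X)"
    using assms(1) by (rule mult_mono) (use assms in linarith)+
  then have "11 + (m + 1) * (11 + 5 * K) + 12 * g \<le> 11 + X * (21 * X) + 12 * X"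
    using assms(4) by linarith
  then have "N * (11 + (m + 1) * (11 + 5 * K) + 12 * g) \<le> N * (11 + X * (21 * X) + 12 * X)"
    by (rule mult_left_mono) simp
  also have "\<dots> = 11 * N + 21 * Y + 12 * (X * N)"
    by (simp add: algebra_simps Y_def)
  finally have b: "N * (11 + (m + 1) * (11 + 5 * K) + 12 * g) \<le> 11 * N + 21 * Y + 12 * (X * N)" .
  have "gen_steps (m + 1) K h g = 13 + (m + 1) * (18 + 2 ^ h * (14 + 5 * K + 12 * h)) +
      N * (11 + (m + 1) * (11 + 5 * K) + 12 * g) + N * 7"
    by (simp add: gen_steps_def N_def)
  also have "\<dots> \<le> 118 * Y"
    using a b Y Y2 by linarith
  finally show ?thesis
    by (simp add: Y_def N_def power2_eq_square)
qed

lemma prog1_steps_le: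
  assumes X: "X = n + m + 1"
  shows "prog1_steps n m \<le> 200 * (X ^ 2 * 2 ^ (n - n div 2))"
proof -
  let ?N = "2 ^ (n - n div 2) :: nat"
  have gs: "gen_steps (m + 1) (2 * n + 1) (n div 2) (n - n div 2) \<le> 118 * (X ^ 2 * ?N)"
    by (rule gen_steps_le) (use X in simp_all)
  have XX: "X \<le> X * X" "1 \<le> X * X"
    using X by simp_all
  have XN: "X * X * 1 \<le> X ^ 2 * ?N"
    unfolding power2_eq_square by (rule mult_left_mono) simp_all
  have "m * (5 + 4 * (2 * n + 1)) \<le> X * (13 * X)"
    by (rule mult_mono) (use X in simp_all)
  then show ?thesis
    unfolding prog1_steps_def using gs XX XN X by linarith
qed

lemma length_circuit_code_le:
  assumes "m \<le> X" "1 \<le> X" "N1 \<le> N2" "1 \<le> N2"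
  shows "length (circuit_code N1 N2 m u1 u2) \<le> 13 * (X * N2)"
proof -
  define p where "p = X * N2"
  have "1 * 1 \<le> p" "1 * N2 \<le> p"
    unfolding p_def using assms by (intro mult_mono; simp)+
  moreover have "m * (5 + N1) \<le> X * (6 * N2)"
    using assms by (intro mult_mono) simp_all
  then have "m * (5 + N1) \<le> 6 * p"
    by (simp add: p_def mult.left_commute)
  moreover have "N2 * (2 + m) \<le> N2 * (3 * X)"
    using assms by (intro mult_left_mono) simp_all
  then have "N2 * (2 + m) \<le> 3 * p"
    by (simp add: p_def mult.commute mult.left_commute)
  ultimately show ?thesis
    unfolding length_circuit_code p_def[symmetric] by linarith
qed

text \<open>Uses \<open>c < 2 ^ c\<close> and \<open>X < 2 ^ X\<close>. Numbers of this size have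
  linearly many digits in \<open>X\<close>, so the logarithmic cost criterion adds only a polynomial
  factor.\<close>

lemma floorlog_poly_le:
  assumes "b \<le> c * X ^ j * 2 ^ n" "n \<le> X" "1 \<le> X"
  shows "floorlog 2 b \<le> (c + j + 1) * X"
proof -
  have "X ^ j \<le> (2 ^ X) ^ j"
    by (rule power_mono[OF less_imp_le[OF less_exp]]) simp
  then have "c * X ^ j * 2 ^ n \<le> c * (2 ^ (X * j) * 2 ^ n)"
    by (simp add: power_mult)
  also have "\<dots> < 2 ^ c * (2 ^ (X * j) * 2 ^ n)"
    by (rule mult_strict_right_mono[OF less_exp]) simp
  finally have "b < 2 ^ (c + X * j + n)"
    using le_less_trans[OF assms(1)] by (simp add: power_add mult.assoc)
  then have "floorlog 2 b \<le> c + X * j + n"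
    by (intro floorlog_leI) simp_all
  also have "\<dots> \<le> c * X + X * j + X"
    using assms by (intro add_mono) simp_all
  finally show ?thesis
    by (simp add: algebra_simps)
qed

text \<open>The finitely many exceptional values are absorbed into the constant, and 1 is added
  because the logarithm vanishes at \<open>s = 1\<close>. The constant is integral since it also
  enters bounds on natural numbers.\<close>

lemma bigo_bound:
  fixes T :: "nat \<Rightarrow> real"
  assumes "T \<in> O(\<lambda>s. real s powr a * ln (real s) ^ k)"
  obtains c :: nat where "\<And>s. 1 \<le> s \<Longrightarrow> T s \<le> c * (1 + real s powr a * ln (real s) ^ k)"
proof -
  let ?f = "\<lambda>s. real s powr a * ln (real s) ^ k"
  obtain d where d: "d > 0" "eventually (\<lambda>s. norm (T s) \<le> d * norm (?f s)) at_top"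
    using landau_o.bigE[OF assms] .
  then obtain s0 where s0: "\<And>s. s \<ge> s0 \<Longrightarrow> norm (T s) \<le> d * norm (?f s)"
    unfolding eventually_at_top_linorder by blast
  define c where "c = nat \<lceil>d + (\<Sum>s<s0. \<bar>T s\<bar>)\<rceil>"
  have c: "d + (\<Sum>s<s0. \<bar>T s\<bar>) \<le> real c"
    unfolding c_def by linarith
  have pos: "0 \<le> (\<Sum>s<s0. \<bar>T s\<bar>)"
    by (intro sum_nonneg) simp
  have dc: "d \<le> real c"
    using c pos by linarith
  have "T s \<le> c * (1 + ?f s)" if s: "1 \<le> s" for s
  proof -
    have f: "0 \<le> ?f s"
      using s by simp
    show ?thesis
    proof (cases "s \<ge> s0")
      case True
      have "T s \<le> d * ?f s"
        using s0[OF True] f by simp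
      also have "\<dots> \<le> c * (1 + ?f s)"
        using dc f by (intro mult_mono) simp_all
      finally show ?thesis .
    next
      case False
      then have "\<bar>T s\<bar> \<le> (\<Sum>s<s0. \<bar>T s\<bar>)"
        by (intro member_le_sum) simp_all
      then have "T s \<le> real c * 1"
        using c d(1) by simp
      also have "\<dots> \<le> c * (1 + ?f s)"
        using f by (intro mult_left_mono) simp_all
      finally show ?thesis .
    qed
  qed
  then show thesis
    by (rule that)
qed

text \<open>The exponent of the theorem arises here: raising \<open>2 powr (n / 2)\<close> to the
  power \<open>2 - \<epsilon>\<close> gives \<open>2 powr ((1 - \<epsilon> / 2) * n)\<close>. The 26
  is 13 from the circuit length times 2 from rounding \<open>n / 2\<close> up, 676 is its square,
  and 27 comes from \<open>ln (26 * X) \<le> 26 * X - 1\<close> together with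
  \<open>n / 2 \<le> X\<close>.\<close>

lemma converter_time:
  fixes X s \<epsilon> :: real and n k :: nat
  assumes \<epsilon>: "0 < \<epsilon>" "\<epsilon> \<le> 1" and s: "1 \<le> s" "s \<le> 26 * X * 2 powr (n / 2)" and X: "1 \<le> X" "real n \<le> X"
  shows "s powr (2 - \<epsilon>) * ln s ^ k \<le> 676 * 27 ^ k * (X ^ (k + 2) * 2 powr ((1 - \<epsilon> / 2) * n))"
proof -
  have "s powr (2 - \<epsilon>) \<le> (26 * X * 2 powr (n / 2)) powr (2 - \<epsilon>)"
    using s \<epsilon> by (intro powr_mono2) simp_all
  also have "\<dots> = (26 * X) powr (2 - \<epsilon>) * 2 powr ((1 - \<epsilon> / 2) * n)"
    using X by (simp add: powr_mult powr_powr field_simps)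
  also have "(26 * X) powr (2 - \<epsilon>) \<le> (26 * X) powr 2"
    using X \<epsilon> by (intro powr_mono) simp_all
  also have "(26 * X) powr 2 = 676 * X ^ 2"
    using X by (simp add: power2_eq_square)
  finally have 1: "s powr (2 - \<epsilon>) \<le> 676 * X ^ 2 * 2 powr ((1 - \<epsilon> / 2) * n)"
    by simp
  have "ln s \<le> ln (26 * X * 2 powr (n / 2))"
    using s X by simp
  also have "\<dots> = ln (26 * X) + n / 2 * ln 2"
    using X by (simp add: ln_mult ln_powr)
  also have "\<dots> \<le> (26 * X - 1) + n / 2 * 1"
    using X ln_le_minus_one[of "26 * X"] ln_le_minus_one[of 2]
    by (intro add_mono mult_left_mono) simp_all
  also have "\<dots> \<le> 27 * X"
    using X by simp
  finally have "ln s ^ k \<le> (27 * X) ^ k"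
    using s by (intro power_mono) simp_all
  then have "s powr (2 - \<epsilon>) * ln s ^ k \<le> (676 * X ^ 2 * 2 powr ((1 - \<epsilon> / 2) * n)) * (27 * X) ^ k"
    using 1 s by (intro mult_mono) simp_all
  also have "\<dots> = 676 * 27 ^ k * (X ^ (k + 2) * 2 powr ((1 - \<epsilon> / 2) * n))"
    by (simp add: power_mult_distrib power_add power2_eq_square algebra_simps)
  finally show ?thesis .
qed

text \<open>Circuits with \<open>N\<close> outputs and size at most \<open>13 * N\<close> suffice: a
  code of the converted circuit lists \<open>N\<close> outputs, yet a time in \<open>o(s)\<close> is
  eventually at most \<open>s / 14\<close>, which is below \<open>N\<close>. The 14 is chosen to
  exceed 13.\<close>

lemma sublinear_converter_impossible:
  assumes \<epsilon>: "1 < \<epsilon>" and T: "T \<in> O(\<lambda>s. real s powr (2 - \<epsilon>) * ln (real s) ^ k)"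
    and conv: "converts_or (if x then xor_computes else sum_computes) P T"
  shows False
proof -
  have "(\<lambda>s. real s powr (2 - \<epsilon>) * ln (real s) ^ k) \<in> o(\<lambda>s. real s)"
    using \<epsilon> by real_asymp
  then have "T \<in> o(\<lambda>s. real s)"
    by (rule landau_o.big_small_trans[OF T])
  then have "eventually (\<lambda>s. norm (T s) \<le> 1 / 14 * norm (real s)) at_top"
    by (rule landau_o.smallD) simp
  then obtain s0 where s0: "\<And>s. s \<ge> s0 \<Longrightarrow> T s \<le> s / 14"
    unfolding eventually_at_top_linorder by fastforce
  define N where "N = Suc s0"
  let ?z = "\<lambda>_ _. 0 :: nat"
  let ?C = "or_circuit N N 1 ?z ?z" and ?A = "or_matrix N N 1 ?z ?z"
  have N: "1 \<le> N" "N \<le> N" "s0 \<le> N"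
    by (simp_all add: N_def)
  have wf: "wf_circuit ?C" "or_computes ?C ?A" "encodes (circuit_code N N 1 ?z ?z) ?C"
    by (rule wf_or or_computes_or encodes_or; use N in simp)+
  obtain t w' D where D: "ram_outputs P (circuit_code N N 1 ?z ?z) t w'" "real t \<le> T (csize ?C)" "wf_circuit D"
    "(if x then xor_computes else sum_computes) D ?A" "encodes w' D"
    using conv wf unfolding converts_or_def by blast
  have "csize ?C \<le> 13 * (1 * N)"
    by (rule order_trans[OF csize_or_le length_circuit_code_le]) (use N in simp_all)
  moreover have "2 * N \<le> csize ?C"
    using wf(1) by (simp add: wf_circuit_def)
  ultimately have "real t \<le> 13 * N / 14"
    using D(2) s0[of "csize ?C"] N by simp
  moreover have "N \<le> t"
  proof -
    have "?A \<in> carrier_mat (length (outputs D)) (num_inputs D)"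
      using D(4) by (cases x) (simp_all add: xor_computes_def sum_computes_def)
    then have "length (outputs D) = N"
      by (auto simp: or_matrix_def)
    moreover have "length (outputs D) \<le> length w'"
      using D(5) by (auto simp: encodes_def)
    moreover have "length w' \<le> t"
      using halts_from_length[OF D(1)[unfolded ram_outputs_def]] by simp
    ultimately show ?thesis
      by simp
  qed
  ultimately show False
    using N by linarith
qed

lemma halves_le:
  "2 ^ (n div 2) \<le> (2 ^ (n - n div 2) :: nat)" "(2::nat) ^ (n - n div 2) \<le> 2 ^ n"
  by (auto intro!: power_increasing)

lemma half_power_le: "real (2 ^ (n - n div 2)) \<le> 2 * 2 powr (real n / 2)"
proof -
  have "2 * (n - n div 2) \<le> n + 1"
    by linarith
  then have "real (n - n div 2) \<le> 1 + real n / 2"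
    by linarith
  then have "2 powr real (n - n div 2) \<le> 2 powr (1 + real n / 2)"
    by (intro powr_mono) simp_all
  moreover have "real (2 ^ (n - n div 2)) = 2 powr real (n - n div 2)"
    using powr_realpow[of 2 "n - n div 2"] by simp
  ultimately show ?thesis
    by (simp only: powr_add) simp
qed

text \<open>\<open>E\<close> stands for the target exponential, \<open>U\<close> and
  \<open>S\<close> for the logarithmic cost factors. The exponent \<open>k + 3\<close> is
  \<open>k + 2\<close> from the converter and 1 from the cost factors; the constants are
  \<open>2592 = 6 * 400 + 6 * 32\<close> and \<open>49 = 1 + 6 * 8\<close>.\<close>

lemma total_time:
  fixes X E t e c1 N1 N2 n :: real and k :: nat
  assumes X: "1 \<le> X" "n \<le> X" and E: "1 \<le> E" and N: "N1 \<le> N2" "N2 \<le> 2 * E" "0 \<le> N2"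
    and t: "0 \<le> t" "t \<le> c1 * (X ^ (k + 2) * E)" and e: "0 \<le> e" "0 \<le> c1"
    and U: "0 \<le> U" "U \<le> e * X" "0 \<le> S" "S \<le> e * X"
  shows "200 * (X ^ 2 * N2) * (6 * U) + (3 + t * S) + (20 + 5 * N1 + 2 * n + 8 * t) * (6 * U) \<le>
    E * ((3 + 2592 * e + 49 * c1 * e) * X ^ (k + 3))"
proof -
  define Z where "Z = E * X ^ (k + 2)"
  have pw: "X ^ 2 \<le> X ^ (k + 2)" "X \<le> X ^ (k + 2)" "1 \<le> X ^ (k + 2)"
    using X power_increasing[of 2 "k + 2" X] power_increasing[of 1 "k + 2" X] one_le_power[of X "k + 2"]
    by simp_all
  have Z: "E * X ^ 2 \<le> Z" "X \<le> Z" "1 \<le> Z" "E \<le> Z"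
  proof -
    show "E * X ^ 2 \<le> Z"
      unfolding Z_def using pw E by (intro mult_left_mono) simp_all
    have "1 * X \<le> E * X ^ (k + 2)" "1 * 1 \<le> E * X ^ (k + 2)" "E * 1 \<le> E * X ^ (k + 2)"
      using pw E X by (intro mult_mono; simp)+
    then show "X \<le> Z" "1 \<le> Z" "E \<le> Z"
      by (simp_all add: Z_def)
  qed
  have tZ: "t \<le> c1 * Z"
    using t(2) by (simp add: Z_def mult.commute mult.left_commute)
  have ZX: "1 * 1 \<le> Z * X"
    using Z(3) X(1) by (intro mult_mono) simp_all
  have "X ^ 2 * N2 \<le> X ^ 2 * (2 * E)"
    using N by (intro mult_left_mono) simp_all
  then have X2: "200 * (X ^ 2 * N2) \<le> 400 * Z"
    using Z(1) by (simp add: mult.commute)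
  have 1: "200 * (X ^ 2 * N2) * (6 * U) \<le> 400 * Z * (6 * (e * X))"
    using X2 by (rule mult_mono) (use U Z(3) in simp_all)
  have 2: "t * S \<le> c1 * Z * (e * X)"
    using tZ U t(1) e Z(3) by (intro mult_mono) simp_all
  have "20 + 5 * N1 + 2 * n + 8 * t \<le> (32 + 8 * c1) * Z"
    using Z N X tZ by (simp add: algebra_simps)
  moreover have "0 \<le> (32 + 8 * c1) * Z"
    using e Z(3) by simp
  ultimately have 3: "(20 + 5 * N1 + 2 * n + 8 * t) * (6 * U) \<le> (32 + 8 * c1) * Z * (6 * (e * X))"
    using U by (intro mult_mono) simp_all
  have "E * ((3 + 2592 * e + 49 * c1 * e) * X ^ (k + 3)) =
      3 * (Z * X) + 400 * Z * (6 * (e * X)) + c1 * Z * (e * X) + (32 + 8 * c1) * Z * (6 * (e * X))"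
    by (simp add: Z_def power_add algebra_simps eval_nat_numeral)
  then show ?thesis
    using 1 2 3 ZX by linarith
qed

theorem fast_converter_counts:
  assumes \<epsilon>: "0 < \<epsilon>" "\<epsilon> \<le> 1" and T: "T \<in> O(\<lambda>s. real s powr (2 - \<epsilon>) * ln (real s) ^ k)"
    and conv: "converts_or (if x then xor_computes else sum_computes) P T"
  shows "\<exists>c. \<exists>k::nat. cnf_computable_in (\<lambda>n F. if x then num_sat n F mod 2 else num_sat n F)
    (\<lambda>n m. 2 powr ((1 - \<epsilon> / 2) * real n) * (c * (real n + real m + 1) ^ k))"
proof -
  from bigo_bound[OF T] obtain c0 :: nat
    where c0: "\<And>s. 1 \<le> s \<Longrightarrow> T s \<le> real c0 * (1 + real s powr (2 - \<epsilon>) * ln (real s) ^ k)"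
    by metis
  define c1 where "c1 = c0 * (1 + 676 * 27 ^ k)"
  \<comment> \<open>\<open>8 * M + 8\<close> will be at most
    \<open>(816 + 8 * c1) * X ^ (k + 2) * 2 ^ n\<close>, hence have at most
    \<open>(q + 1) * X\<close> digits; \<open>e\<close> then dominates the coefficients
    \<open>1 + 2 * (q + 1)\<close> and \<open>13 + 3 * (q + 1)\<close> of the two cost
    factors.\<close>
  define q where "q = (816 + 8 * c1) + (k + 2)"
  define e where "e = 16 + 3 * q"
  define c where "c = 3 + 2592 * real e + 49 * real c1 * real e"
  show ?thesis
    unfolding cnf_computable_in_def
  proof (rule exI[of _ c], rule exI[of _ "k + 3"], rule exI[of _ "reduction x P"], intro allI impI)
    fix n F assume F: "cnf_over n F"
    let ?h = "n div 2" and ?g = "n - n div 2" and ?Cs = "F @ [[Pos n]]"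
    let ?u1 = "\<lambda>c. falsified 0 ?h n (?Cs ! c)" and ?u2 = "\<lambda>c. falsified ?h ?g n (?Cs ! c)"
    let ?N1 = "2 ^ ?h :: nat" and ?N2 = "2 ^ ?g :: nat" and ?m = "length ?Cs"
    let ?C = "or_circuit ?N1 ?N2 ?m ?u1 ?u2" and ?A = "or_matrix ?N1 ?N2 ?m ?u1 ?u2"
    let ?w = "circuit_code ?N1 ?N2 ?m ?u1 ?u2"
    define X where "X = n + length F + 1"
    define E where "E = 2 powr ((1 - \<epsilon> / 2) * real n)"
    have m1: "1 \<le> ?m" "?m \<le> X"
      by (simp_all add: X_def)
    have N: "1 \<le> ?N1" "?N1 \<le> ?N2" "1 \<le> ?N2" "?N2 \<le> 2 ^ n" "?N1 \<le> 2 ^ n"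
      using halves_le[of n] by simp_all
    note circ = falsified_le falsified_le m1(1) N(1,2)
    have C: "wf_circuit ?C" "or_computes ?C ?A" "encodes ?w ?C"
      by (rule wf_or[OF circ] or_computes_or[OF circ] encodes_or[OF circ])+
    obtain t w' D where P: "ram_outputs P ?w t w'" "real t \<le> T (csize ?C)"
      and D: "wf_circuit D" "(if x then xor_computes else sum_computes) D ?A" "encodes w' D"
      using conv C unfolding converts_or_def by blast
    note outs = sum_outputs[OF circ D(1,2)]
    have X1: "1 \<le> X" "n \<le> X"
      by (simp_all add: X_def)
    have lw: "length ?w \<le> 13 * (X * ?N2)"
      by (rule length_circuit_code_le[OF m1(2) X1(1) N(2,3)])
    \<comment> \<open>Here \<epsilon> \<le> 1 is essential: the target dominates
      \<open>2 powr (n / 2)\<close>, and with it the work of writing the circuit.\<close>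
    have E: "1 \<le> E" "E \<le> 2 ^ n" "2 powr (real n / 2) \<le> E"
    proof -
      have "0 \<le> (1 - \<epsilon> / 2) * real n" "(1 - \<epsilon> / 2) * real n \<le> 1 * real n"
        "1 / 2 * real n \<le> (1 - \<epsilon> / 2) * real n"
        using \<epsilon> by (simp, (intro mult_right_mono; simp)+)
      then have "2 powr 0 \<le> E" "E \<le> 2 powr (1 * real n)" "2 powr (1 / 2 * real n) \<le> E"
        unfolding E_def by (intro powr_mono; simp)+
      then show "1 \<le> E" "E \<le> 2 ^ n" "2 powr (real n / 2) \<le> E"
        by (simp_all add: powr_realpow)
    qed
    have t_le: "real t \<le> c1 * (real X ^ (k + 2) * E)"
    proof -
      let ?s = "csize ?C"
      have "num_inputs ?C \<le> ?s"
        using C(1) unfolding wf_circuit_def by blast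
      then have s1: "1 \<le> ?s"
        using N(1) unfolding or_circuit_simps by linarith
      have "?s \<le> 13 * (X * ?N2)"
        using csize_or_le[OF circ] lw by (rule order_trans)
      then have "real ?s \<le> real (13 * (X * ?N2))"
        by (rule of_nat_mono)
      also have "\<dots> = 13 * (real X * real ?N2)"
        by simp
      also have "\<dots> \<le> 13 * (real X * (2 * 2 powr (real n / 2)))"
        using half_power_le[of n] by (intro mult_left_mono) simp_all
      finally have s2: "real ?s \<le> 26 * real X * 2 powr (real n / 2)"
        by simp
      have "1 \<le> real X ^ (k + 2)"
        using X1(1) by (intro one_le_power) simp
      then have "1 * 1 \<le> real X ^ (k + 2) * E"
        using E(1) by (intro mult_mono) simp_all
      moreover have "real ?s powr (2 - \<epsilon>) * ln (real ?s) ^ k \<le> 676 * 27 ^ k * (real X ^ (k + 2) * E)"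
        unfolding E_def by (rule converter_time) (use \<epsilon> s1 s2 X1 in simp_all)
      ultimately have "1 + real ?s powr (2 - \<epsilon>) * ln (real ?s) ^ k \<le> (1 + 676 * 27 ^ k) * (real X ^ (k + 2) * E)"
        unfolding distrib_right by linarith
      then have "real c0 * (1 + real ?s powr (2 - \<epsilon>) * ln (real ?s) ^ k) \<le>
          real c0 * ((1 + 676 * 27 ^ k) * (real X ^ (k + 2) * E))"
        by (rule mult_left_mono) simp
      also have "\<dots> = c1 * (real X ^ (k + 2) * E)"
        by (simp add: c1_def distrib_left)
      finally show ?thesis
        using P(2) c0[OF s1] by linarith
    qed
    define Z where "Z = X ^ 2 * 2 ^ n"
    \<comment> \<open>A common bound on all numbers in the two programs: \<open>100 * Z\<close>
      generously covers lengths, counters and \<open>2 ^ n\<close>, and \<open>t\<close> covers the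
      vertex names in the converter's output.\<close>
    define M where "M = 100 * Z + t"
    have Z: "X * ?N2 \<le> Z" "X \<le> Z" "2 ^ n \<le> Z" "1 \<le> Z" "X * X \<le> Z"
    proof -
      have XX: "X \<le> X ^ 2" "1 \<le> X ^ 2"
        using X1(1) by (simp_all add: power2_eq_square)
      have "X * ?N2 \<le> Z" "X * 1 \<le> Z" "1 * 2 ^ n \<le> Z" "1 * 1 \<le> Z" "X ^ 2 * 1 \<le> Z"
        unfolding Z_def by (rule mult_mono; use XX N(4) in simp)+
      then show "X * ?N2 \<le> Z" "X \<le> Z" "2 ^ n \<le> Z" "1 \<le> Z" "X * X \<le> Z"
        by (simp_all only: mult_1 mult_1_right power2_eq_square)
    qed
    have K: "length c \<le> 2 * n + 1" if "c \<in> set F" for c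
      using length_clause_le[OF F that] by simp
    have "length (fcode F) \<le> length F * Suc (2 * n + 1)"
      by (rule length_fcode_le[OF K])
    also have "\<dots> \<le> X * (2 * X)"
      by (rule mult_mono) (simp_all add: X_def)
    finally have lf: "length (fcode ?Cs) \<le> 2 * (X * X) + 2"
      by simp
    let ?cap = "if x then 1 else ?N1"
    let ?S = "\<Sum>u\<leftarrow>outputs D. red x ?cap (odd_value D u)"
    have "\<exists>t'. ram_outputs (reduction x P) (encode_cnf n F) t'
        [if x then (1 - n + ?S) mod 2 else 2 ^ n - min ?S (2 ^ n)] \<and>
      t' \<le> prog1_steps n (length F) * (6 * unit_cost M) + (3 + t * sim_cost t) +
        (20 + 5 * ?N1 + 2 * n + 8 * t) * (6 * unit_cost M)"
    proof (rule reduction_correct[OF K P(1) D(1,3) outs(1)])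
      show "length ?w \<le> M" "length (fcode ?Cs) \<le> M" "2 * n + 2 \<le> M" "2 * 2 ^ n \<le> M" "2 * ?N1 + t \<le> M"
        using lw lf Z X1 N(5) unfolding M_def by linarith+
      have "?m \<le> Z"
        using m1(2) Z(2) by (rule order_trans)
      then show "2 * ?N1 + 2 * ?m + ?N2 + 2 \<le> M"
        using Z N(4,5) unfolding M_def by linarith
      fix a assume "a \<in> set (encode_cnf n F)"
      then have "a \<le> 2 * X"
        unfolding X_def by (rule encode_cnf_le[OF F])
      then show "a \<le> M"
        using Z unfolding M_def by linarith
    qed
    then obtain t' where out: "ram_outputs (reduction x P) (encode_cnf n F) t'
        [if x then (1 - n + ?S) mod 2 else 2 ^ n - min ?S (2 ^ n)]"
      and t': "t' \<le> prog1_steps n (length F) * (6 * unit_cost M) + (3 + t * sim_cost t) +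
        (20 + 5 * ?N1 + 2 * n + 8 * t) * (6 * unit_cost M)"
      by blast
    let ?B = "card (bad_pairs ?N1 ?N2 ?m ?u1 ?u2)"
    have count: "num_sat n F + ?B = 2 ^ n"
      unfolding bad_pairs_def by (rule num_sat_count[OF _ F]) simp_all
    have res: "(if x then (1 - n + ?S) mod 2 else 2 ^ n - min ?S (2 ^ n)) =
        (if x then num_sat n F mod 2 else num_sat n F)"
    proof (cases x)
      case True
      have "?S mod 2 = ?B mod 2"
        using outs(2)[OF True] True by (simp add: red_def)
      \<comment> \<open>By truncation on the left, both sides are 1 for \<open>n = 0\<close> and 0
        otherwise.\<close>
      moreover have "(1 - n) mod 2 = 2 ^ n mod 2"
        by (cases n) simp_all
      ultimately have "(1 - n + ?S) mod 2 = (2 ^ n + ?B) mod 2"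
        by (rule mod_add_cong[rotated])
      \<comment> \<open>Modulo 2 the number of falsifying pairs may be added instead of
        subtracted.\<close>
      also have "2 ^ n + ?B = num_sat n F + 2 * ?B"
        using count by linarith
      also have "(num_sat n F + 2 * ?B) mod 2 = num_sat n F mod 2"
        by simp
      finally show ?thesis
        using True by simp
    next
      case False
      then have S: "?S = ?B"
        using outs(3) by simp
      have "2 ^ n - min ?S (2 ^ n) = num_sat n F"
        unfolding S using count by linarith
      then show ?thesis
        using False by (simp only: if_False)
    qed
    have tn: "t \<le> c1 * X ^ (k + 2) * 2 ^ n"
    proof -
      have "c1 * (real X ^ (k + 2) * E) \<le> c1 * (real X ^ (k + 2) * 2 ^ n)"
        using E(2) by (intro mult_left_mono) simp_all
      then have "real t \<le> real (c1 * X ^ (k + 2) * 2 ^ n)"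
        using t_le by (simp add: mult.assoc)
      then show ?thesis
        by (simp only: of_nat_le_iff)
    qed
    define Y where "Y = X ^ (k + 2) * 2 ^ n"
    have "Z \<le> Y"
      unfolding Z_def Y_def using X1(1) by (intro mult_right_mono power_increasing) simp_all
    moreover define p where "p = c1 * Y"
    have "t \<le> p"
      using tn by (simp only: Y_def p_def mult.assoc)
    ultimately have "8 * M + 8 \<le> 816 * Y + 8 * p"
      using Z(4) unfolding M_def by simp
    then have M_le: "8 * M + 8 \<le> (816 + 8 * c1) * X ^ (k + 2) * 2 ^ n"
      by (simp only: Y_def p_def mult.assoc distrib_right)
    have fl: "floorlog 2 (8 * M + 8) \<le> (q + 1) * X"
      using floorlog_poly_le[OF M_le X1(2,1)] by (simp add: q_def add.assoc)
    have "floorlog 2 (8 * t + 8) \<le> floorlog 2 (8 * M + 8)"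
      by (rule floorlog_mono) (simp add: M_def)
    then have US: "unit_cost M \<le> e * X" "sim_cost t \<le> e * X"
      using fl X1(1) unfolding unit_cost_def sim_cost_def e_def by (simp_all add: algebra_simps)
    have "t' \<le> 200 * (X ^ 2 * ?N2) * (6 * unit_cost M) + (3 + t * sim_cost t) +
        (20 + 5 * ?N1 + 2 * n + 8 * t) * (6 * unit_cost M)"
      using t' mult_right_mono[OF prog1_steps_le[OF X_def], of "6 * unit_cost M"] by linarith
    then have "real t' \<le> real (200 * (X ^ 2 * ?N2) * (6 * unit_cost M) + (3 + t * sim_cost t) +
        (20 + 5 * ?N1 + 2 * n + 8 * t) * (6 * unit_cost M))"
      by (rule of_nat_mono)
    also have "\<dots> = 200 * (real X ^ 2 * real ?N2) * (6 * real (unit_cost M)) + (3 + real t * real (sim_cost t)) +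
        (20 + 5 * real ?N1 + 2 * real n + 8 * real t) * (6 * real (unit_cost M))"
      by simp
    also have "\<dots> \<le> E * ((3 + 2592 * real e + 49 * real c1 * real e) * real X ^ (k + 3))"
    proof (rule total_time)
      show "real ?N2 \<le> 2 * E"
        using half_power_le[of n] E(3) by linarith
      show "real ?N1 \<le> real ?N2"
        using N(2) by (rule of_nat_mono)
      show "real (unit_cost M) \<le> real e * real X" "real (sim_cost t) \<le> real e * real X"
        using US unfolding of_nat_mult[symmetric] of_nat_le_iff by simp_all
    qed (use X1 E(1) t_le in simp_all)
    also have "\<dots> = 2 powr ((1 - \<epsilon> / 2) * real n) * (c * (real n + real (length F) + 1) ^ (k + 3))"
      by (simp add: E_def c_def X_def add_ac)
    finally show "\<exists>t. ram_outputs (reduction x P) (encode_cnf n F) t [if x then num_sat n F mod 2 else num_sat n F] \<and>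
        real t \<le> 2 powr ((1 - \<epsilon> / 2) * real n) * (c * (real n + real (length F) + 1) ^ (k + 3))"
      using out unfolding res by blast
  qed
qed

theorem theorem20:
  fixes \<epsilon> :: real
  assumes "\<epsilon> > 0"
  shows
    "((\<exists>P T. \<exists>k::nat. converts_or sum_computes P T \<and>
          T \<in> O(\<lambda>s. real s powr (2 - \<epsilon>) * ln (real s) ^ k)) \<longrightarrow>
      (\<exists>c. \<exists>k::nat. cnf_computable_in num_sat
          (\<lambda>n m. 2 powr ((1 - \<epsilon> / 2) * real n) * (c * (real n + real m + 1) ^ k))))
     \<and>
     ((\<exists>P T. \<exists>k::nat. converts_or xor_computes P T \<and>
          T \<in> O(\<lambda>s. real s powr (2 - \<epsilon>) * ln (real s) ^ k)) \<longrightarrow>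
      (\<exists>c. \<exists>k::nat. cnf_computable_in (\<lambda>n F. num_sat n F mod 2)
          (\<lambda>n m. 2 powr ((1 - \<epsilon> / 2) * real n) * (c * (real n + real m + 1) ^ k))))"
proof (intro conjI impI; elim exE conjE)
  fix P :: ram and T :: "nat \<Rightarrow> real" and k :: nat
  assume T: "T \<in> O(\<lambda>s. real s powr (2 - \<epsilon>) * ln (real s) ^ k)"
  {
    assume "converts_or sum_computes P T"
    then show "\<exists>c. \<exists>k::nat. cnf_computable_in num_sat
        (\<lambda>n m. 2 powr ((1 - \<epsilon> / 2) * real n) * (c * (real n + real m + 1) ^ k))"
      using fast_converter_counts[of \<epsilon> T k False P] sublinear_converter_impossible[of \<epsilon> T k False P] assms T
      by (cases "\<epsilon> \<le> 1") simp_all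
  }
  {
    assume "converts_or xor_computes P T"
    then show "\<exists>c. \<exists>k::nat. cnf_computable_in (\<lambda>n F. num_sat n F mod 2)
        (\<lambda>n m. 2 powr ((1 - \<epsilon> / 2) * real n) * (c * (real n + real m + 1) ^ k))"
      using fast_converter_counts[of \<epsilon> T k True P] sublinear_converter_impossible[of \<epsilon> T k True P] assms T
      by (cases "\<epsilon> \<le> 1") simp_all
  }
qed

end
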